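(* Let $\lambda(N)\in\mathbb{GT}_N$ be a regular sequence of signatures with $m[\lambda(N)]\to\mathbf m$ weakly. Then for every fixed $k\ge2$, uniformly over an open complex neighborhood of $(x_1,\dots,x_k)=(1^k)$, $$\lim_{N\to\infty}\partial_1\partial_2\log\frac{s_{\lambda(N)}(x_1,\dots,x_k,1^{N-k})}{s_{\lambda(N)}(1^N)}=\partial_1\partial_2\log\Big(1-(x_1-1)(x_2-1)\frac{x_1H'_{\mathbf m}(x_1)-x_2H'_{\mathbf m}(x_2)}{x_1-x_2}\Big),$$ and, for $k\ge3$, $$\lim_{N\to\infty}\partial_1\partial_2\partial_3\log\frac{s_{\lambda(N)}(x_1,\dots,x_k,1^{N-k})}{s_{\lambda(N)}(1^N)}=0.$$
   Context: $\mathbb{GT}_N$: signatures $\lambda_1\ge\dots\ge\lambda_N$ of integers; $s_\lambda$ the Schur function; $m[\lambda]=\frac1N\sum_{i=1}^N\delta(\frac{\lambda_i+N-i}N)$. Regular sequence: there are a piecewise-continuous $f$ on $[0,1]$ and $C$ with $\lim_N\frac1N\sum_j|\lambda_j(N)/N-f(j/N)|=0$ and $|\lambda_j(N)/N-f(j/N)|<C$ for all $j,N$. For a compactly supported probability measure $\mathbf m$: $C_{\mathbf m}(z)=\int\frac{d\mathbf m(x)}{z-x}$, $C^{(-1)}_{\mathbf m}$ its functional inverse near $0$, $H'_{\mathbf m}(z)=\frac{C^{(-1)}_{\mathbf m}(\log z)}z-\frac1{z-1}$ (holomorphic near $1$). *)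

theory Defs
  imports "HOL-Probability.Probability"
begin

definition is_signature :: "nat \<Rightarrow> (nat \<Rightarrow> int) \<Rightarrow> bool" where
  "is_signature N lam \<longleftrightarrow> (\<forall>i j. 1 \<le> i \<longrightarrow> i \<le> j \<longrightarrow> j \<le> N \<longrightarrow> lam j \<le> lam i)"

definition diagram :: "nat \<Rightarrow> (nat \<Rightarrow> int) \<Rightarrow> (nat \<times> nat) set" where
  "diagram N lam = {(i, j). 1 \<le> i \<and> i \<le> N \<and> 1 \<le> j \<and> int j \<le> lam i - lam N}"

definition ssyt :: "nat \<Rightarrow> (nat \<Rightarrow> int) \<Rightarrow> ((nat \<times> nat) \<Rightarrow> nat) set" where
  "ssyt N lam = {T \<in> diagram N lam \<rightarrow>\<^sub>E {1..N}.
      (\<forall>i j. (i, j) \<in> diagram N lam \<longrightarrow> (i, Suc j) \<in> diagram N lam \<longrightarrow> T (i, j) \<le> T (i, Suc j)) \<and>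
      (\<forall>i j. (i, j) \<in> diagram N lam \<longrightarrow> (Suc i, j) \<in> diagram N lam \<longrightarrow> T (i, j) < T (Suc i, j))}"

text \<open>Schur function s_lam(x_1,...,x_N) of a signature (Laurent polynomial):
  (x_1 ... x_N)^(lam_N) times the Schur polynomial of the partition lam - lam_N.\<close>
definition schur :: "nat \<Rightarrow> (nat \<Rightarrow> int) \<Rightarrow> (nat \<Rightarrow> complex) \<Rightarrow> complex" where
  "schur N lam x = (\<Prod>i=1..N. x i) powi (lam N) *
     (\<Sum>T\<in>ssyt N lam. \<Prod>c\<in>diagram N lam. x (T c))"

definition norm_schur :: "nat \<Rightarrow> (nat \<Rightarrow> int) \<Rightarrow> nat \<Rightarrow> (nat \<Rightarrow> complex) \<Rightarrow> complex" where
  "norm_schur N lam k x = schur N lam (\<lambda>i. if i \<le> k then x i else 1) / schur N lam (\<lambda>_. 1)"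

definition emp_measure :: "nat \<Rightarrow> (nat \<Rightarrow> int) \<Rightarrow> real measure" where
  "emp_measure N lam = distr (uniform_count_measure {1..N}) borel
      (\<lambda>i. (real_of_int (lam i) + real N - real i) / real N)"

definition piecewise_continuous01 :: "(real \<Rightarrow> real) \<Rightarrow> bool" where
  "piecewise_continuous01 f \<longleftrightarrow> (\<exists>S. finite S \<and>
     (\<forall>x\<in>{0..1} - S. continuous (at x within {0..1}) f) \<and>
     (\<forall>x\<in>S \<inter> {0<..1}. \<exists>l. (f \<longlongrightarrow> l) (at_left x)) \<and>
     (\<forall>x\<in>S \<inter> {0..<1}. \<exists>l. (f \<longlongrightarrow> l) (at_right x)))"

definition regular_seq :: "(nat \<Rightarrow> nat \<Rightarrow> int) \<Rightarrow> bool" where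
  "regular_seq lam \<longleftrightarrow> (\<exists>f C. piecewise_continuous01 f \<and>
     (\<lambda>N. (1 / real N) * (\<Sum>j=1..N. \<bar>real_of_int (lam N j) / real N - f (real j / real N)\<bar>))
        \<longlonglongrightarrow> 0 \<and>
     (\<forall>N j. 1 \<le> j \<longrightarrow> j \<le> N \<longrightarrow> \<bar>real_of_int (lam N j) / real N - f (real j / real N)\<bar> < C))"

definition cauchy_tr :: "real measure \<Rightarrow> complex \<Rightarrow> complex" where
  "cauchy_tr m z = (LINT x|m. 1 / (z - complex_of_real x))"

text \<open>H'_m: the (germ at 1 of the) holomorphic function equal to
  C^(-1)(log z)/z - 1/(z-1) near 1, where C^(-1) is the functional inverse of the
  Cauchy transform near 0 (the branch tending to infinity at 0).\<close>
definition Hprime :: "real measure \<Rightarrow> complex \<Rightarrow> complex" where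
  "Hprime m = (SOME h. \<exists>r>0. \<exists>s>0. \<exists>G.
      filterlim G at_infinity (at 0) \<and>
      (\<forall>w\<in>ball 0 s - {0}. cauchy_tr m (G w) = w) \<and>
      h holomorphic_on ball 1 r \<and>
      (\<forall>z\<in>ball 1 r - {1}. Ln z \<in> ball 0 s \<and> h z = G (Ln z) / z - 1 / (z - 1)))"

definition pd :: "nat \<Rightarrow> ((nat \<Rightarrow> complex) \<Rightarrow> complex) \<Rightarrow> (nat \<Rightarrow> complex) \<Rightarrow> complex" where
  "pd i f x = deriv (\<lambda>z. f (x(i := z))) (x i)"

text \<open>d_1 d_2 log f = d_2 (d_1 f / f) (independent of the branch of log).\<close>
definition logd12 :: "((nat \<Rightarrow> complex) \<Rightarrow> complex) \<Rightarrow> (nat \<Rightarrow> complex) \<Rightarrow> complex" where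
  "logd12 f = pd 2 (\<lambda>y. pd 1 f y / f y)"

definition logd123 :: "((nat \<Rightarrow> complex) \<Rightarrow> complex) \<Rightarrow> (nat \<Rightarrow> complex) \<Rightarrow> complex" where
  "logd123 f = pd 3 (logd12 f)"

text \<open>(x1 H'(x1) - x2 H'(x2))/(x1 - x2), extended holomorphically to the diagonal.\<close>
definition divdiff_H :: "real measure \<Rightarrow> complex \<Rightarrow> complex \<Rightarrow> complex" where
  "divdiff_H m a b = (if a = b then deriv (\<lambda>z. z * Hprime m z) a
                      else (a * Hprime m a - b * Hprime m b) / (a - b))"

definition limit_fn :: "real measure \<Rightarrow> (nat \<Rightarrow> complex) \<Rightarrow> complex" where
  "limit_fn m x = 1 - (x 1 - 1) * (x 2 - 1) * divdiff_H m (x 1) (x 2)"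

definition polydisc1 :: "nat \<Rightarrow> real \<Rightarrow> (nat \<Rightarrow> complex) set" where
  "polydisc1 k e = {x. \<forall>i\<in>{1..k}. cmod (x i - 1) < e}"

end

theory Submission
  imports Defs "HOL-Complex_Analysis.Complex_Analysis" "Jordan_Normal_Form.Determinant"
begin

text \<open>
  Put \<open>l\<^sub>j = \<lambda>\<^sub>j + N - j\<close> and \<open>A\<^sub>p(x) = \<Sum>\<^sub>j x\<^bsup>l\<^sub>j\<^esup> l\<^sub>j\<^bsup>p\<^esup> / \<Prod>\<^bsub>i\<noteq>j\<^esub> (l\<^sub>j - l\<^sub>i)\<close>. The confluent bialternant formula
  and Lagrange interpolation show that \<open>s\<^sub>\<lambda>(x\<^sub>1, ..., x\<^sub>k, 1, ..., 1) \<Prod>\<^bsub>a<b\<^esub> (x\<^sub>a - x\<^sub>b) \<Prod>\<^sub>a (x\<^sub>a - 1)\<^bsup>N-k\<^esup>\<close>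
  is a constant multiple of the \<open>k \<times> k\<close> determinant of the \<open>A\<^sub>p(x\<^sub>a)\<close>. By Cauchy's formula \<open>A\<^sub>p(exp u)\<close>
  is a circle integral of \<open>exp (uz) z\<^bsup>p\<^esup> / \<Prod>\<^sub>j (z - l\<^sub>j)\<close>; for small \<open>u \<noteq> 0\<close> the circle through the saddle point
  \<open>Z\<close>, where \<open>u = \<Sum>\<^sub>j 1 / (Z - l\<^sub>j)\<close>, gives \<open>A\<^sub>p / A\<^sub>0 = Z\<^bsup>p\<^esup> (1 + O(N\<^bsup>-1/2\<^esup>))\<close>, and \<open>Z / N\<close> converges to the inverse \<open>G(u)\<close>
  of the Cauchy transform of \<open>m\<close>. Hence, off the diagonals and off \<open>x\<^sub>a = 1\<close>, the \<open>k\<close>-variable normalized Schur function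
  divided by the product of the one-variable ones converges, up to constants, to a Vandermonde determinant in the
  \<open>G(log x\<^sub>a)\<close>, that is to \<open>\<Prod>\<^bsub>a<b\<^esub> (1 - (x\<^sub>a - 1) (x\<^sub>b - 1) (x\<^sub>a H'(x\<^sub>a) - x\<^sub>b H'(x\<^sub>b)) / (x\<^sub>a - x\<^sub>b))\<close>. Applied on a torus of
  distinct radii around \<open>1\<close>, the maximum principle extends the convergence to a polydisc, and Cauchy's estimates to the
  logarithmic derivatives; one-variable factors and constants disappear in \<open>\<partial>\<^sub>1\<partial>\<^sub>2 log\<close>.
\<close>

section \<open>Determinants\<close>

text \<open>The point of interest \<open>x = 1\<close> is the worst one for the method: there
  \<open>u = 0\<close>, the saddle \<open>Z\<close> escapes to infinity and the determinant formula
  reads \<open>0 = 0\<close>, as it does on the diagonals. All asymptotics are therefore taken at a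
  fixed distance from these sets, and holomorphy carries them inwards. In exchange the neighbourhood
  may be as small as desired: for small \<open>u\<close> the modulus of \<open>Z\<close> exceeds all
  nodes by a fixed large factor, so the circle about 0 through \<open>Z\<close> encloses them and
  has a single peak, a perturbation of the case where all nodes are 0. Only ratios of amplitudes are
  estimated. Their prefactor, exponential in \<open>N\<close>, does not depend on \<open>p\<close>
  apart from \<open>Z ^ p\<close> and cancels; neither it nor the constants of the determinant
  formula are ever evaluated. After division by \<open>N ^ p\<close> all entries of the determinant
  converge, so a relative error \<open>o(1)\<close> is enough. The measures enter through their
  moments alone: with \<open>y = N / Z\<close> the saddle equation inverts a power series whose
  coefficients are bounded by \<open>A ^ n\<close>, on a disc that does not depend on
  \<open>N\<close>.\<close>

definition ndet :: "nat \<Rightarrow> (nat \<Rightarrow> nat \<Rightarrow> complex) \<Rightarrow> complex" where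
  "ndet n f = Determinant.det (Matrix.mat n n (\<lambda>(i, j). f i j))"

lemma ndet_0 [simp]: "ndet 0 f = 1"
  unfolding ndet_def by (rule det_dim_zero) auto

lemma ndet_cong:
  assumes "\<And>i j. i < n \<Longrightarrow> j < n \<Longrightarrow> f i j = g i j"
  shows "ndet n f = ndet n g"
proof -
  have "Matrix.mat n n (\<lambda>(i, j). f i j) = Matrix.mat n n (\<lambda>(i, j). g i j)"
    by (rule eq_matI) (auto simp: assms)
  thus ?thesis by (simp add: ndet_def)
qed

lemma ndet_rows:
  "ndet n f = (\<Sum>p | p permutes {0..<n}. signof p * (\<Prod>i<n. f i (p i)))"
proof -
  have "p i < n" if "p permutes {0..<n}" "i < n" for p i
    using permutes_in_image[OF that(1), of i] that(2) by auto
  thus ?thesis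
    unfolding ndet_def
    by (subst det_def'[of _ n]) (auto intro!: sum.cong prod.cong simp: atLeast0LessThan)
qed

lemma ndet_cols:
  "ndet n f = (\<Sum>p | p permutes {0..<n}. signof p * (\<Prod>j<n. f (p j) j))"
proof -
  have "p i < n" if "p permutes {0..<n}" "i < n" for p i
    using permutes_in_image[OF that(1), of i] that(2) by auto
  thus ?thesis
    unfolding ndet_def
    by (subst det_col[of _ n]) (auto intro!: sum.cong prod.cong simp: atLeast0LessThan)
qed

lemma ndet_scale_rows: "ndet n (\<lambda>i j. c i * f i j) = (\<Prod>i<n. c i) * ndet n f"
  unfolding ndet_rows by (simp add: prod.distrib sum_distrib_left mult_ac)

lemma ndet_scale_cols: "ndet n (\<lambda>i j. d j * f i j) = (\<Prod>j<n. d j) * ndet n f"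
  unfolding ndet_cols by (simp add: prod.distrib sum_distrib_left mult_ac)

lemma ndet_mult: "ndet n (\<lambda>i j. \<Sum>r<n. f i r * g r j) = ndet n f * ndet n g"
proof -
  have "Matrix.mat n n (\<lambda>(i, j). \<Sum>r<n. f i r * g r j) =
      Matrix.mat n n (\<lambda>(i, j). f i j) * Matrix.mat n n (\<lambda>(i, j). g i j)"
    by (rule eq_matI) (auto simp: scalar_prod_def atLeast0LessThan)
  thus ?thesis
    unfolding ndet_def by (simp add: Determinant.det_mult[of _ n])
qed

lemma ndet_last_row:
  assumes "\<And>j. j < n \<Longrightarrow> f n j = 0"
  shows "ndet (Suc n) f = f n n * ndet n f"
proof -
  let ?A = "Matrix.mat (Suc n) (Suc n) (\<lambda>(i, j). f i j)"
  have "Determinant.det ?A = (\<Sum>j<Suc n. ?A $$ (n, j) * cofactor ?A n j)"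
    by (rule laplace_expansion_row) auto
  also have "\<dots> = f n n * cofactor ?A n n"
    using assms by (simp add: sum.lessThan_Suc)
  also have "cofactor ?A n n = Determinant.det (Matrix.mat n n (\<lambda>(i, j). f i j))"
  proof -
    have "mat_delete ?A n n = Matrix.mat n n (\<lambda>(i, j). f i j)"
      by (rule eq_matI) (auto simp: mat_delete_def)
    thus ?thesis by (simp add: cofactor_def)
  qed
  finally show ?thesis by (simp add: ndet_def)
qed

text \<open>The last rows are peeled off one at a time; the first \<open>k\<close> rows are
  arbitrary. The case \<open>k = 0\<close> is the determinant of an upper triangular matrix.\<close>

lemma ndet_block_triangular:
  assumes "k \<le> n" "\<And>i j. k \<le> i \<Longrightarrow> i < n \<Longrightarrow> j < i \<Longrightarrow> f i j = 0"
  shows "ndet n f = ndet k f * (\<Prod>i=k..<n. f i i)"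
  using assms
proof (induction n)
  case (Suc n)
  show ?case
  proof (cases "k = Suc n")
    case False
    hence "k \<le> n" using Suc.prems by simp
    have "ndet (Suc n) f = f n n * ndet n f"
      using Suc.prems(2) \<open>k \<le> n\<close> by (intro ndet_last_row) auto
    also have "ndet n f = ndet k f * (\<Prod>i=k..<n. f i i)"
      using Suc.prems \<open>k \<le> n\<close> by (intro Suc.IH) auto
    finally show ?thesis using \<open>k \<le> n\<close> by simp
  qed auto
qed auto

lemma ndet_transpose: "ndet n (\<lambda>i j. f j i) = ndet n f"
  unfolding ndet_rows[of n "\<lambda>i j. f j i"] ndet_cols[of n f] by simp

text \<open>Subtracting from each column the next one turns the last row of ones into
  \<open>(0, ..., 0, 1)\<close>. In the branching rule the row of the last variable is normalised to
  ones for this purpose.\<close>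

lemma ndet_column_differences:
  assumes "\<And>j. j \<le> n \<Longrightarrow> f n j = 1"
  shows "ndet (Suc n) f = ndet n (\<lambda>i j. f i j - f i (Suc j))"
proof -
  define g :: "nat \<Rightarrow> nat \<Rightarrow> complex" where
    "g r j = (if r = j then 1 else if r = Suc j then -1 else 0)" for r j
  have det_g: "ndet (Suc n) g = 1"
  proof -
    \<comment> \<open>\<open>g\<close> is lower triangular, while
      \<open>ndet_block_triangular\<close> asks for zeros below the diagonal.\<close>
    have "ndet (Suc n) g = ndet (Suc n) (\<lambda>i j. g j i)" by (rule ndet_transpose[symmetric])
    also have "\<dots> = ndet 0 (\<lambda>i j. g j i) * (\<Prod>i=0..<Suc n. g i i)"
      by (rule ndet_block_triangular) (auto simp: g_def)
    finally show ?thesis by (simp add: g_def)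
  qed
  have prod: "(\<Sum>r<Suc n. f i r * g r j) = (if j = n then f i n else f i j - f i (Suc j))"
    if "j < Suc n" for i j
  proof -
    have "(\<Sum>r<Suc n. f i r * g r j)
        = (\<Sum>r<Suc n. (if r = j then f i r else 0) - (if r = Suc j then f i r else 0))"
      by (intro sum.cong) (auto simp: g_def)
    also have "\<dots> = (\<Sum>r<Suc n. if r = j then f i r else 0) - (\<Sum>r<Suc n. if r = Suc j then f i r else 0)"
      by (rule sum_subtractf)
    also have "\<dots> = (if j = n then f i n else f i j - f i (Suc j))"
      using that by (auto simp del: sum.lessThan_Suc)
    finally show ?thesis .
  qed
  have "ndet (Suc n) f = ndet (Suc n) f * ndet (Suc n) g" by (simp add: det_g)
  also have "\<dots> = ndet (Suc n) (\<lambda>i j. \<Sum>r<Suc n. f i r * g r j)" by (rule ndet_mult[symmetric])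
  also have "\<dots> = ndet (Suc n) (\<lambda>i j. if j = n then f i n else f i j - f i (Suc j))"
    by (intro ndet_cong prod)
  also have "\<dots> = 1 * ndet n (\<lambda>i j. if j = n then f i n else f i j - f i (Suc j))"
    using assms by (subst ndet_last_row) auto
  also have "\<dots> = ndet n (\<lambda>i j. f i j - f i (Suc j))"
    by (simp, intro ndet_cong) auto
  finally show ?thesis .
qed

text \<open>Multilinearity in the columns: column \<open>j\<close> of the summand depends on the
  single value \<open>\<mu> (Suc j)\<close>, so a sum over all interlacing \<open>\<mu>\<close>
  becomes a sum inside each column. Parts are numbered from 1, columns from 0.\<close>

lemma ndet_sum_PiE:
  assumes "\<And>i. i \<in> {1..n} \<Longrightarrow> finite (I i)"
  shows "(\<Sum>\<mu>\<in>PiE {1..n} I. ndet n (\<lambda>a j. g a j (\<mu> (Suc j)))) =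
    ndet n (\<lambda>a j. \<Sum>x\<in>I (Suc j). g a j x)"
proof -
  have "(\<Prod>j<n. \<Sum>x\<in>I (Suc j). g (p j) j x) = (\<Sum>\<mu>\<in>PiE {1..n} I. \<Prod>j<n. g (p j) j (\<mu> (Suc j)))" for p
  proof -
    have "(\<Prod>j<n. \<Sum>x\<in>I (Suc j). g (p j) j x) = (\<Prod>i\<in>{1..n}. \<Sum>x\<in>I i. g (p (i-1)) (i-1) x)"
      by (simp add: prod.atLeast1_atMost_eq)
    also have "\<dots> = (\<Sum>\<mu>\<in>PiE {1..n} I. \<Prod>i\<in>{1..n}. g (p (i-1)) (i-1) (\<mu> i))"
      using assms by (intro prod_sum_PiE) auto
    also have "\<dots> = (\<Sum>\<mu>\<in>PiE {1..n} I. \<Prod>j<n. g (p j) j (\<mu> (Suc j)))"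
      by (simp add: prod.atLeast1_atMost_eq)
    finally show ?thesis .
  qed
  thus ?thesis
    unfolding ndet_cols by (subst sum.swap) (simp add: sum_distrib_left)
qed

text \<open>Amplitudes produce ascending powers, the Vandermonde determinant below has descending
  ones. The sign depends on \<open>n\<close> only and is absorbed in a constant, so its value is not
  recorded.\<close>

lemma ndet_reverse_columns:
  "\<exists>s. s \<noteq> 0 \<and> (\<forall>f. ndet n (\<lambda>i j. f i (n - 1 - j)) = s * ndet n f)"
proof -
  define p where "p i = (if i < n then n - 1 - i else i)" for i
  have "p permutes {0..<n}"
    by (rule bij_imp_permutes, rule bij_betw_byWitness[where f' = p]) (auto simp: p_def)
  have *: "ndet n (\<lambda>i j. f i (n - 1 - j)) = signof p * ndet n f" for f
  proof -
    have "ndet n (\<lambda>i j. f i (n - 1 - j)) = ndet n (\<lambda>i j. f j (n - 1 - i))"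
      by (rule ndet_transpose[symmetric])
    also have "\<dots> = Determinant.det (Matrix.mat n n (\<lambda>(i,j). Matrix.mat n n (\<lambda>(i,j). f j i) $$ (p i, j)))"
      unfolding ndet_def by (rule arg_cong[where f = Determinant.det], rule eq_matI) (auto simp: p_def)
    also have "\<dots> = signof p * Determinant.det (Matrix.mat n n (\<lambda>(i,j). f j i))"
      by (rule det_permute_rows) (use \<open>p permutes _\<close> in auto)
    also have "Determinant.det (Matrix.mat n n (\<lambda>(i,j). f j i)) = ndet n f"
      using ndet_transpose[of n f] by (simp add: ndet_def)
    finally show ?thesis .
  qed
  show ?thesis
  proof (intro exI[of _ "signof p"] conjI allI)
    show "signof p \<noteq> (0 :: complex)" by (simp add: sign_def)
  qed (rule *)
qed

text \<open>Subtracting \<open>x n\<close> times the next column from each column kills the last row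
  except for its final 1 and leaves a factor \<open>x i - x n\<close> in every other row.\<close>

lemma ndet_vandermonde:
  "ndet n (\<lambda>a j. x a ^ (n - 1 - j)) = (\<Prod>b<n. \<Prod>a<b. x a - x b)"
proof (induction n)
  case (Suc n)
  define f where "f a j = (if a = n then 1 else x a ^ (n - j))" for a j
  define g :: "nat \<Rightarrow> nat \<Rightarrow> complex" where
    "g r j = (if r = j then 1 else if r = Suc j then - x n else 0)" for r j
  have det_g: "ndet (Suc n) g = 1"
  proof -
    have "ndet (Suc n) g = ndet (Suc n) (\<lambda>i j. g j i)" by (rule ndet_transpose[symmetric])
    also have "\<dots> = ndet 0 (\<lambda>i j. g j i) * (\<Prod>i=0..<Suc n. g i i)"
      by (rule ndet_block_triangular) (auto simp: g_def)
    finally show ?thesis by (simp add: g_def)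
  qed
  have prod: "(\<Sum>r<Suc n. x i ^ (n - r) * g r j) = (if j = n then 1 else (x i - x n) * x i ^ (n - 1 - j))"
    if "j < Suc n" for i j
  proof -
    have "(\<Sum>r<Suc n. x i ^ (n - r) * g r j)
        = (\<Sum>r<Suc n. (if r = j then x i ^ (n - r) else 0) - (if r = Suc j then x n * x i ^ (n - r) else 0))"
      by (intro sum.cong) (auto simp: g_def)
    also have "\<dots> = (\<Sum>r<Suc n. if r = j then x i ^ (n - r) else 0) -
       (\<Sum>r<Suc n. if r = Suc j then x n * x i ^ (n - r) else 0)"
      by (rule sum_subtractf)
    also have "\<dots> = (if j = n then 1 else (x i - x n) * x i ^ (n - 1 - j))"
    proof (cases "j = n")
      case False
      hence "n - j = Suc (n - 1 - j)" using that by simp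
      thus ?thesis using that False by (auto simp: algebra_simps simp del: sum.lessThan_Suc)
    qed (auto simp del: sum.lessThan_Suc)
    finally show ?thesis .
  qed
  have "ndet (Suc n) (\<lambda>a j. x a ^ (Suc n - 1 - j)) = ndet (Suc n) (\<lambda>a j. x a ^ (n - j)) * ndet (Suc n) g"
    by (simp add: det_g)
  also have "\<dots> = ndet (Suc n) (\<lambda>i j. \<Sum>r<Suc n. x i ^ (n - r) * g r j)" by (rule ndet_mult[symmetric])
  also have "\<dots> = ndet (Suc n) (\<lambda>i j. if j = n then 1 else (x i - x n) * x i ^ (n - 1 - j))"
    by (intro ndet_cong prod)
  also have "\<dots> = 1 * ndet n (\<lambda>i j. if j = n then 1 else (x i - x n) * x i ^ (n - 1 - j))"
    by (subst ndet_last_row) auto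
  also have "\<dots> = ndet n (\<lambda>i j. (x i - x n) * x i ^ (n - 1 - j))"
    by (simp, intro ndet_cong) auto
  also have "\<dots> = (\<Prod>i<n. x i - x n) * ndet n (\<lambda>i j. x i ^ (n - 1 - j))"
    by (rule ndet_scale_rows)
  finally show ?case unfolding Suc.IH by (simp add: mult.commute)
qed auto

section \<open>Branching of semistandard tableaux\<close>

text \<open>Shapes with natural parts, not tied to a signature: \<open>diagram\<close> subtracts the
  last part, which changes when the last row is removed, so it does not fit an induction on the
  number of rows.\<close>

definition ydiag :: "nat \<Rightarrow> (nat \<Rightarrow> nat) \<Rightarrow> (nat \<times> nat) set" where
  "ydiag n \<nu> = {(i, j). 1 \<le> i \<and> i \<le> n \<and> 1 \<le> j \<and> j \<le> \<nu> i}"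

definition tableaux :: "nat \<Rightarrow> (nat \<Rightarrow> nat) \<Rightarrow> (nat \<times> nat \<Rightarrow> nat) set" where
  "tableaux n \<nu> = {T \<in> ydiag n \<nu> \<rightarrow>\<^sub>E {1..n}.
      (\<forall>i j. (i, j) \<in> ydiag n \<nu> \<longrightarrow> (i, Suc j) \<in> ydiag n \<nu> \<longrightarrow> T (i, j) \<le> T (i, Suc j)) \<and>
      (\<forall>i j. (i, j) \<in> ydiag n \<nu> \<longrightarrow> (Suc i, j) \<in> ydiag n \<nu> \<longrightarrow> T (i, j) < T (Suc i, j))}"

definition schur_poly :: "nat \<Rightarrow> (nat \<Rightarrow> nat) \<Rightarrow> (nat \<Rightarrow> complex) \<Rightarrow> complex" where
  "schur_poly n \<nu> y = (\<Sum>T\<in>tableaux n \<nu>. \<Prod>c\<in>ydiag n \<nu>. y (T c))"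

lemma ydiag_eq_Sigma: "ydiag n \<nu> = (SIGMA i:{1..n}. {1..\<nu> i})"
  by (auto simp: ydiag_def)

lemma finite_ydiag [simp]: "finite (ydiag n \<nu>)"
  by (simp add: ydiag_eq_Sigma)

lemma card_ydiag: "card (ydiag n \<nu>) = (\<Sum>i=1..n. \<nu> i)"
  by (simp add: ydiag_eq_Sigma)

lemma finite_tableaux [simp]: "finite (tableaux n \<nu>)"
  by (rule finite_subset[of _ "ydiag n \<nu> \<rightarrow>\<^sub>E {1..n}"]) (auto simp: tableaux_def intro!: finite_PiE)

lemma tableaux_range: "T \<in> tableaux n \<nu> \<Longrightarrow> c \<in> ydiag n \<nu> \<Longrightarrow> T c \<in> {1..n}"
  by (auto simp: tableaux_def)

lemma tableaux_row_mono:
  assumes "T \<in> tableaux n \<nu>" "1 \<le> i" "i \<le> n" "1 \<le> j" "j \<le> j'" "j' \<le> \<nu> i"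
  shows "T (i, j) \<le> T (i, j')"
  using assms(5,6)
proof (induction j' rule: dec_induct)
  case (step j')
  have "T (i, j') \<le> T (i, Suc j')"
    using assms(1-4) step by (auto simp: tableaux_def ydiag_def)
  with step show ?case by simp
qed auto

lemma tableaux_col_strict:
  assumes "T \<in> tableaux n \<nu>" "(i, j) \<in> ydiag n \<nu>" "(Suc i, j) \<in> ydiag n \<nu>"
  shows "T (i, j) < T (Suc i, j)"
  using assms by (auto simp: tableaux_def)

text \<open>Entries increase strictly down a column that begins in row 1. In the branching this
  forces row \<open>n + 1\<close> to carry the letter \<open>n + 1\<close> only.\<close>

lemma tableaux_ge_row:
  assumes T: "T \<in> tableaux n \<nu>"
    and dec: "\<And>i. 1 \<le> i \<Longrightarrow> i < n \<Longrightarrow> \<nu> (Suc i) \<le> \<nu> i"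
    and i: "1 \<le> i" "i \<le> n" "1 \<le> j" "j \<le> \<nu> i"
  shows "i \<le> T (i, j)"
  using i
proof (induction i rule: nat_induct_at_least)
  case base
  thus ?case using tableaux_range[OF T, of "(1, j)"] by (auto simp: ydiag_def)
next
  case (Suc i)
  have "j \<le> \<nu> i" using dec[of i] Suc by simp
  hence "i \<le> T (i, j)" using Suc by simp
  also have "T (i, j) < T (Suc i, j)"
    using Suc \<open>j \<le> \<nu> i\<close> by (intro tableaux_col_strict[OF T]) (auto simp: ydiag_def)
  finally show ?case by simp
qed

lemma tableaux_nonempty:
  assumes "\<And>i. 1 \<le> i \<Longrightarrow> i < n \<Longrightarrow> \<nu> (Suc i) \<le> \<nu> i"
  shows "tableaux n \<nu> \<noteq> {}"
proof -
  have "(\<lambda>c\<in>ydiag n \<nu>. fst c) \<in> tableaux n \<nu>"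
    by (auto simp: tableaux_def ydiag_def)
  thus ?thesis by blast
qed

definition inner_shape :: "nat \<Rightarrow> (nat \<Rightarrow> nat) \<Rightarrow> (nat \<times> nat \<Rightarrow> nat) \<Rightarrow> (nat \<Rightarrow> nat) \<Rightarrow> bool" where
  "inner_shape n \<nu> T \<mu> \<longleftrightarrow> (\<forall>(i, j)\<in>ydiag (Suc n) \<nu>. T (i, j) \<le> n \<longleftrightarrow> i \<le> n \<and> j \<le> \<mu> i)"

text \<open>Rows increase weakly, so the entries at most \<open>n\<close> form an initial segment of
  each row. A cell with another one below it has a smaller entry than that one, hence at most
  \<open>n\<close>: this is the lower interlacing bound \<open>\<nu> (Suc i)\<close>.\<close>

lemma inner_shape_exists:
  assumes T: "T \<in> tableaux (Suc n) \<nu>"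
    and dec: "\<And>i. 1 \<le> i \<Longrightarrow> i \<le> n \<Longrightarrow> \<nu> (Suc i) \<le> \<nu> i"
  shows "\<exists>\<mu>\<in>PiE {1..n} (\<lambda>i. {\<nu> (Suc i)..\<nu> i}). inner_shape n \<nu> T \<mu>"
proof -
  define A where "A i = {j \<in> {1..\<nu> i}. T (i, j) \<le> n}" for i
  define \<mu> where "\<mu> = (\<lambda>i\<in>{1..n}. card (A i))"
  have A_eq: "A i = {1..card (A i)}" if "1 \<le> i" "i \<le> n" for i
  proof (cases "A i = {}")
    case False
    have fin: "finite (A i)" by (simp add: A_def)
    define m where "m = Max (A i)"
    have "m \<in> A i" using False fin by (simp add: m_def)
    have "A i = {1..m}"
    proof
      show "A i \<subseteq> {1..m}" using fin by (auto simp: m_def A_def)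
      show "{1..m} \<subseteq> A i"
      proof
        fix j assume "j \<in> {1..m}"
        hence "T (i, j) \<le> T (i, m)"
          using that \<open>m \<in> A i\<close> by (intro tableaux_row_mono[OF T]) (auto simp: A_def)
        thus "j \<in> A i" using \<open>m \<in> A i\<close> \<open>j \<in> {1..m}\<close> by (auto simp: A_def)
      qed
    qed
    thus ?thesis by simp
  qed simp
  have card_le: "card (A i) \<le> \<nu> i" for i
  proof -
    have "A i \<subseteq> {1..\<nu> i}" by (auto simp: A_def)
    from card_mono[OF _ this] show ?thesis by simp
  qed
  have "\<nu> (Suc i) \<le> card (A i)" if "1 \<le> i" "i \<le> n" for i
  proof -
    have "{1..\<nu> (Suc i)} \<subseteq> A i"
    proof
      fix j assume j: "j \<in> {1..\<nu> (Suc i)}"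
      have "T (i, j) < T (Suc i, j)"
        using j that dec[of i] by (intro tableaux_col_strict[OF T]) (auto simp: ydiag_def)
      moreover have "T (Suc i, j) \<in> {1..Suc n}"
        using j that by (intro tableaux_range[OF T]) (auto simp: ydiag_def)
      ultimately show "j \<in> A i" using j dec[of i] that by (auto simp: A_def)
    qed
    from card_mono[OF _ this] show ?thesis by (auto simp: A_def)
  qed
  hence "\<mu> \<in> PiE {1..n} (\<lambda>i. {\<nu> (Suc i)..\<nu> i})"
    using card_le by (auto simp: \<mu>_def)
  moreover have "T (i, j) \<le> n \<longleftrightarrow> i \<le> n \<and> j \<le> \<mu> i" if ij: "(i, j) \<in> ydiag (Suc n) \<nu>" for i j
  proof (cases "i \<le> n")
    case True
    have "T (i, j) \<le> n \<longleftrightarrow> j \<in> A i" using ij by (auto simp: A_def ydiag_def)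
    also have "\<dots> \<longleftrightarrow> j \<in> {1..card (A i)}" using A_eq[of i] True ij by (auto simp: ydiag_def)
    finally show ?thesis using True ij by (auto simp: \<mu>_def ydiag_def)
  next
    case False
    have "i \<le> T (i, j)" using ij dec by (intro tableaux_ge_row[OF T]) (auto simp: ydiag_def)
    thus ?thesis using False by simp
  qed
  ultimately show ?thesis unfolding inner_shape_def by blast
qed

lemma inner_shape_unique:
  assumes "\<mu> \<in> PiE {1..n} (\<lambda>i. {\<nu> (Suc i)..\<nu> i})" "\<mu>' \<in> PiE {1..n} (\<lambda>i. {\<nu> (Suc i)..\<nu> i})"
    and "inner_shape n \<nu> T \<mu>" "inner_shape n \<nu> T \<mu>'"
  shows "\<mu> = \<mu>'"
proof (rule PiE_ext[OF assms(1,2)])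
  fix i assume i: "i \<in> {1..n}"
  have le: "\<mu> i \<le> \<nu> i" "\<mu>' i \<le> \<nu> i" using assms(1,2) i by (auto simp: PiE_iff)
  have "j \<le> \<mu> i \<longleftrightarrow> j \<le> \<mu>' i" if "1 \<le> j" "j \<le> \<nu> i" for j
  proof -
    have "(i, j) \<in> ydiag (Suc n) \<nu>" using that i by (auto simp: ydiag_def)
    thus ?thesis using assms(3,4) i by (auto simp: inner_shape_def)
  qed
  from this[of "\<mu> i"] this[of "\<mu>' i"] le show "\<mu> i = \<mu>' i"
    by (cases "\<mu> i = 0"; cases "\<mu>' i = 0") auto
qed

text \<open>Removing the letter \<open>n + 1\<close> is a bijection onto the tableaux of shape
  \<open>\<mu>\<close>; its inverse \<open>ext\<close> fills the remaining cells with
  \<open>n + 1\<close>, which yields the power of \<open>y (Suc n)\<close>.\<close>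

lemma sum_tableaux_inner_shape:
  fixes y :: "nat \<Rightarrow> complex"
  assumes \<mu>: "\<mu> \<in> PiE {1..n} (\<lambda>i. {\<nu> (Suc i)..\<nu> i})"
  shows "(\<Sum>T\<in>{T \<in> tableaux (Suc n) \<nu>. inner_shape n \<nu> T \<mu>}. \<Prod>c\<in>ydiag (Suc n) \<nu>. y (T c)) =
    y (Suc n) ^ ((\<Sum>i=1..Suc n. \<nu> i) - (\<Sum>i=1..n. \<mu> i)) * schur_poly n \<mu> y"
proof -
  define D where "D = ydiag (Suc n) \<nu>"
  define E where "E = ydiag n \<mu>"
  have \<mu>i: "\<nu> (Suc i) \<le> \<mu> i" "\<mu> i \<le> \<nu> i" if "1 \<le> i" "i \<le> n" for i
    using \<mu> that by (auto simp: PiE_iff)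
  have ED: "E \<subseteq> D" using \<mu>i(2) by (fastforce simp: E_def D_def ydiag_def)
  have finD: "finite D" by (simp add: D_def)
  have in_E: "T c \<le> n \<longleftrightarrow> c \<in> E" if "inner_shape n \<nu> T \<mu>" "c \<in> D" for T c
    using that by (cases c) (auto simp: inner_shape_def E_def D_def ydiag_def)
  define ext where "ext T = (\<lambda>c\<in>D. if c \<in> E then T c else Suc n)" for T :: "nat \<times> nat \<Rightarrow> nat"
  have card_DE: "card (D - E) = (\<Sum>i=1..Suc n. \<nu> i) - (\<Sum>i=1..n. \<mu> i)"
    using card_Diff_subset[OF finite_subset[OF ED finD] ED] unfolding D_def E_def card_ydiag .
  have weight: "(\<Prod>c\<in>D. y (T c)) = y (Suc n) ^ card (D - E) * (\<Prod>c\<in>E. y (T c))"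
    if T: "T \<in> tableaux (Suc n) \<nu>" and sh: "inner_shape n \<nu> T \<mu>" for T
  proof -
    have "T c = Suc n" if "c \<in> D - E" for c
      using in_E[OF sh, of c] that tableaux_range[OF T, of c] by (auto simp: D_def)
    hence "(\<Prod>c\<in>D - E. y (T c)) = y (Suc n) ^ card (D - E)" by simp
    thus ?thesis using prod.subset_diff[OF ED finD, of "\<lambda>c. y (T c)"] by simp
  qed
  have "(\<Sum>T\<in>{T \<in> tableaux (Suc n) \<nu>. inner_shape n \<nu> T \<mu>}. \<Prod>c\<in>D. y (T c)) =
      (\<Sum>T\<in>tableaux n \<mu>. y (Suc n) ^ card (D - E) * (\<Prod>c\<in>E. y (T c)))"
  proof (rule sum.reindex_bij_witness[where i = ext and j = "\<lambda>T. restrict T E"])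
    fix T assume "T \<in> {T \<in> tableaux (Suc n) \<nu>. inner_shape n \<nu> T \<mu>}"
    hence T: "T \<in> tableaux (Suc n) \<nu>" and sh: "inner_shape n \<nu> T \<mu>" by auto
    show "ext (restrict T E) = T"
    proof
      fix c
      show "ext (restrict T E) c = T c"
      proof (cases "c \<in> D")
        case True
        have "T c \<in> {1..Suc n}" using True by (intro tableaux_range[OF T]) (simp add: D_def)
        thus ?thesis using True in_E[OF sh True] by (auto simp: ext_def)
      next
        case False
        thus ?thesis using T by (cases c) (auto simp: ext_def tableaux_def D_def PiE_iff extensional_def)
      qed
    qed
    have "T c \<in> {1..n}" if "c \<in> E" for c
      using in_E[OF sh, of c] that ED tableaux_range[OF T, of c] by (auto simp: D_def)
    moreover have "T (i, j) \<le> T (i, Suc j)" if "(i, j) \<in> E" "(i, Suc j) \<in> E" for i j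
      using T subsetD[OF ED that(1)] subsetD[OF ED that(2)] by (auto simp: tableaux_def D_def)
    moreover have "T (i, j) < T (Suc i, j)" if "(i, j) \<in> E" "(Suc i, j) \<in> E" for i j
      using T subsetD[OF ED that(1)] subsetD[OF ED that(2)] by (auto simp: tableaux_def D_def)
    ultimately show "restrict T E \<in> tableaux n \<mu>"
      by (auto simp: tableaux_def E_def[symmetric])
    show "y (Suc n) ^ card (D - E) * (\<Prod>c\<in>E. y (restrict T E c)) = (\<Prod>c\<in>D. y (T c))"
      using weight[OF T sh] by simp
  next
    fix T assume T: "T \<in> tableaux n \<mu>"
    have rng: "T c \<in> {1..n}" if "c \<in> E" for c using tableaux_range[OF T, of c] that by (simp add: E_def)
    show "restrict (ext T) E = T"
    proof
      fix c
      show "restrict (ext T) E c = T c"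
        using T ED by (cases c; cases "c \<in> E") (auto simp: ext_def tableaux_def E_def PiE_iff extensional_def)
    qed
    have row: "ext T (i, j) \<le> ext T (i, Suc j)" if "(i, j) \<in> D" "(i, Suc j) \<in> D" for i j
    proof (cases "(i, Suc j) \<in> E")
      case True
      hence "(i, j) \<in> E" using that by (auto simp: E_def D_def ydiag_def)
      thus ?thesis using True that T by (auto simp: ext_def tableaux_def E_def)
    next
      case False
      thus ?thesis using that rng[of "(i, j)"] by (auto simp: ext_def)
    qed
    have col: "ext T (i, j) < ext T (Suc i, j)" if "(i, j) \<in> D" "(Suc i, j) \<in> D" for i j
    proof -
      \<comment> \<open>Interlacing places a cell that has another cell below it inside the smaller
        shape, so two letters \<open>n + 1\<close> never share a column.\<close>
      have E: "(i, j) \<in> E" using that \<mu>i(1)[of i] by (auto simp: E_def D_def ydiag_def)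
      show ?thesis
      proof (cases "(Suc i, j) \<in> E")
        case True
        thus ?thesis using E that T by (auto simp: ext_def tableaux_def E_def)
      next
        case False
        thus ?thesis using E that rng[of "(i, j)"] by (auto simp: ext_def)
      qed
    qed
    have "ext T \<in> D \<rightarrow>\<^sub>E {1..Suc n}" using rng by (fastforce simp: ext_def)
    with row col have "ext T \<in> tableaux (Suc n) \<nu>" by (auto simp: tableaux_def D_def)
    moreover have "inner_shape n \<nu> (ext T) \<mu>"
      unfolding inner_shape_def
    proof (safe, goal_cases)
      case (1 i j)
      thus ?case using rng[of "(i, j)"] by (auto simp: ext_def D_def E_def ydiag_def split: if_splits)
    next
      case (2 i j)
      thus ?case using rng[of "(i, j)"] by (auto simp: ext_def D_def E_def ydiag_def split: if_splits)
    next
      case (3 i j)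
      thus ?case using rng[of "(i, j)"] by (auto simp: ext_def D_def E_def ydiag_def split: if_splits)
    qed
    ultimately show "ext T \<in> {T \<in> tableaux (Suc n) \<nu>. inner_shape n \<nu> T \<mu>}" by simp
  qed
  also have "\<dots> = y (Suc n) ^ card (D - E) * schur_poly n \<mu> y"
    by (simp add: schur_poly_def sum_distrib_left E_def)
  finally show ?thesis by (simp only: card_DE D_def[symmetric])
qed

lemma schur_poly_branching:
  assumes dec: "\<And>i. 1 \<le> i \<Longrightarrow> i \<le> n \<Longrightarrow> \<nu> (Suc i) \<le> \<nu> i"
  shows "schur_poly (Suc n) \<nu> y =
    (\<Sum>\<mu>\<in>PiE {1..n} (\<lambda>i. {\<nu> (Suc i)..\<nu> i}).
      y (Suc n) ^ ((\<Sum>i=1..Suc n. \<nu> i) - (\<Sum>i=1..n. \<mu> i)) * schur_poly n \<mu> y)"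
proof -
  let ?I = "PiE {1..n} (\<lambda>i. {\<nu> (Suc i)..\<nu> i})"
  have "tableaux (Suc n) \<nu> = (\<Union>\<mu>\<in>?I. {T \<in> tableaux (Suc n) \<nu>. inner_shape n \<nu> T \<mu>})"
  proof -
    have "\<exists>\<mu>\<in>?I. inner_shape n \<nu> T \<mu>" if "T \<in> tableaux (Suc n) \<nu>" for T
      using that dec by (rule inner_shape_exists)
    thus ?thesis by blast
  qed
  hence "schur_poly (Suc n) \<nu> y = (\<Sum>T\<in>(\<Union>\<mu>\<in>?I. {T \<in> tableaux (Suc n) \<nu>. inner_shape n \<nu> T \<mu>}).
      \<Prod>c\<in>ydiag (Suc n) \<nu>. y (T c))"
    by (simp add: schur_poly_def)
  also have "\<dots> = (\<Sum>\<mu>\<in>?I. \<Sum>T\<in>{T \<in> tableaux (Suc n) \<nu>. inner_shape n \<nu> T \<mu>}.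
      \<Prod>c\<in>ydiag (Suc n) \<nu>. y (T c))"
  proof (rule sum.UNION_disjoint)
    show "\<forall>\<mu>\<in>?I. \<forall>\<mu>'\<in>?I. \<mu> \<noteq> \<mu>' \<longrightarrow> {T \<in> tableaux (Suc n) \<nu>. inner_shape n \<nu> T \<mu>} \<inter>
        {T \<in> tableaux (Suc n) \<nu>. inner_shape n \<nu> T \<mu>'} = {}"
      using inner_shape_unique by blast
  qed (auto intro!: finite_PiE)
  also have "\<dots> = (\<Sum>\<mu>\<in>?I. y (Suc n) ^ ((\<Sum>i=1..Suc n. \<nu> i) - (\<Sum>i=1..n. \<mu> i)) * schur_poly n \<mu> y)"
    by (intro sum.cong refl sum_tableaux_inner_shape)
  finally show ?thesis .
qed

section \<open>The bialternant formula\<close>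

definition shifted :: "nat \<Rightarrow> (nat \<Rightarrow> nat) \<Rightarrow> nat \<Rightarrow> nat" where
  "shifted n \<nu> j = \<nu> (Suc j) + n - Suc j"

text \<open>For \<open>a \<ge> k\<close> the row of powers of a variable equal to 1 is replaced by
  the Taylor coefficients of \<open>y ^ l\<close> at \<open>y = 1\<close> of order
  \<open>n - 1 - a\<close>: the rows that survive when several variables merge at 1.\<close>

definition schur_row :: "nat \<Rightarrow> (nat \<Rightarrow> complex) \<Rightarrow> nat \<Rightarrow> nat \<Rightarrow> nat \<Rightarrow> complex" where
  "schur_row k y n a l = (if a < k then y (Suc a) ^ l else of_nat (l choose (n - 1 - a)))"

text \<open>The bialternant formula, confluent in the variables \<open>y\<^sub>i = 1\<close>, \<open>i > k\<close>. In the coordinates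
  \<open>l\<^sub>j = \<nu>\<^sub>j + n - j\<close> interlacing means \<open>l\<^sub>j\<^sub>+\<^sub>1 \<le> m\<^sub>j < l\<^sub>j\<close>, so branching takes discrete antiderivatives of
  the rows; those of \<open>(y\<^sub>a/x)\<^sup>l\<close> and of the binomial coefficients have the same form.\<close>

lemma schur_poly_determinant:
  assumes "\<And>i. 1 \<le> i \<Longrightarrow> i < n \<Longrightarrow> \<nu> (Suc i) \<le> \<nu> i"
    and "\<And>i. 1 \<le> i \<Longrightarrow> y i \<noteq> 0" and "\<And>i. k < i \<Longrightarrow> y i = 1"
  shows "schur_poly n \<nu> y * (\<Prod>b<n. \<Prod>a<min b k. y (Suc a) - y (Suc b)) =
    ndet n (\<lambda>a j. schur_row k y n a (shifted n \<nu> j))"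
  using assms(1)
proof (induction n arbitrary: \<nu>)
  case 0
  have "ydiag 0 \<nu> = {}" by (auto simp: ydiag_def)
  thus ?case by (simp add: schur_poly_def tableaux_def)
next
  case (Suc n)
  define x where "x = y (Suc n)"
  have x0: "x \<noteq> 0" using assms(2) by (simp add: x_def)
  define I where "I = (\<lambda>i. {\<nu> (Suc i)..\<nu> i})"
  define l where "l j = shifted (Suc n) \<nu> j" for j
  \<comment> \<open>Division by \<open>x ^ m\<close> makes the last row constant: it is
    \<open>x ^ m / x ^ m\<close> if \<open>n < k\<close>, and otherwise a binomial coefficient with
    lower index 0 while \<open>x = 1\<close>.\<close>
  define \<psi> where "\<psi> a m = schur_row k y (Suc n) a m / x ^ m" for a m
  define d where "d a = (if a < k then y (Suc a) - x else 1)" for a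
  have dec: "\<nu> (Suc i) \<le> \<nu> i" if "1 \<le> i" "i \<le> n" for i using Suc.prems that by simp
  \<comment> \<open>A geometric difference for the rows of powers; Pascal's rule for the binomial
    rows, where \<open>k \<le> a < n\<close> forces \<open>x = 1\<close>.\<close>
  have \<psi>_step: "\<psi> a (Suc m) - \<psi> a m = d a * (schur_row k y n a m / x ^ Suc m)" if "a < n" for a m
  proof (cases "a < k")
    case True
    thus ?thesis using x0 by (simp add: \<psi>_def d_def schur_row_def field_simps)
  next
    case False
    have "n - a = Suc (n - 1 - a)" using that by simp
    moreover have "x = 1" using assms(3)[of "Suc n"] False that by (simp add: x_def)
    ultimately show ?thesis using False by (simp add: \<psi>_def d_def schur_row_def)
  qed
  have \<psi>_last: "\<psi> n m = 1" for m
    using assms(3)[of "Suc n"] x0 by (auto simp: \<psi>_def schur_row_def x_def)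
  \<comment> \<open>The staircases contained in \<open>l\<close> and in
    \<open>shifted n \<mu>\<close> have the same sum, since the extra index \<open>j = n\<close>
    contributes 0; only the sizes of the two shapes remain.\<close>
  have exponents: "(\<Prod>j<Suc n. x ^ l j) / (\<Prod>j<n. x ^ Suc (shifted n \<mu> j)) =
      x ^ ((\<Sum>i=1..Suc n. \<nu> i) - (\<Sum>i=1..n. \<mu> i))" if "\<mu> \<in> PiE {1..n} I" for \<mu>
  proof -
    have "(\<Sum>i=1..n. \<mu> i) \<le> (\<Sum>i=1..n. \<nu> i)"
      using that by (intro sum_mono) (auto simp: I_def PiE_iff)
    hence le: "(\<Sum>i=1..n. \<mu> i) \<le> (\<Sum>i=1..Suc n. \<nu> i)" by simp
    have "(\<Sum>j<Suc n. l j) = (\<Sum>j<Suc n. \<nu> (Suc j) + (n - j))"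
      by (intro sum.cong) (auto simp: l_def shifted_def)
    also have "\<dots> = (\<Sum>j<Suc n. \<nu> (Suc j)) + (\<Sum>j<Suc n. n - j)"
      by (rule sum.distrib)
    also have "\<dots> = (\<Sum>i=1..Suc n. \<nu> i) + (\<Sum>j<n. n - j)"
      by (simp add: sum.atLeast1_atMost_eq del: sum.cl_ivl_Suc)
    finally have 1: "(\<Sum>j<Suc n. l j) = (\<Sum>i=1..Suc n. \<nu> i) + (\<Sum>j<n. n - j)" .
    have "(\<Sum>j<n. Suc (shifted n \<mu> j)) = (\<Sum>j<n. \<mu> (Suc j) + (n - j))"
      by (intro sum.cong) (auto simp: shifted_def)
    also have "\<dots> = (\<Sum>j<n. \<mu> (Suc j)) + (\<Sum>j<n. n - j)"
      by (rule sum.distrib)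
    also have "\<dots> = (\<Sum>i=1..n. \<mu> i) + (\<Sum>j<n. n - j)"
      by (simp add: sum.atLeast1_atMost_eq)
    finally have 2: "(\<Sum>j<n. Suc (shifted n \<mu> j)) = (\<Sum>i=1..n. \<mu> i) + (\<Sum>j<n. n - j)" .
    show ?thesis
      using x0 le unfolding power_sum[symmetric] 1 2 by (simp add: power_diff power_add)
  qed
  have prod_d: "(\<Prod>a<n. d a) = (\<Prod>a<min n k. y (Suc a) - x)"
  proof -
    have "(\<Prod>a<n. d a) = (\<Prod>a<min n k. d a)"
      by (rule prod.mono_neutral_right) (auto simp: d_def)
    thus ?thesis by (simp add: d_def)
  qed
  have "ndet (Suc n) (\<lambda>a j. schur_row k y (Suc n) a (l j)) = ndet (Suc n) (\<lambda>a j. x ^ l j * \<psi> a (l j))"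
    using x0 by (simp add: \<psi>_def)
  also have "\<dots> = (\<Prod>j<Suc n. x ^ l j) * ndet (Suc n) (\<lambda>a j. \<psi> a (l j))"
    by (rule ndet_scale_cols)
  also have "ndet (Suc n) (\<lambda>a j. \<psi> a (l j)) = ndet n (\<lambda>a j. \<psi> a (l j) - \<psi> a (l (Suc j)))"
    by (rule ndet_column_differences) (simp add: \<psi>_last)
  \<comment> \<open>Telescoping: for \<open>t\<close> in \<open>I (Suc j)\<close> the numbers
    \<open>t + n - Suc j\<close> run through \<open>l (Suc j)..<l j\<close>.\<close>
  also have "\<dots> = ndet n (\<lambda>a j. \<Sum>t\<in>I (Suc j). d a * (schur_row k y n a (t + n - Suc j) / x ^ Suc (t + n - Suc j)))"
  proof (rule ndet_cong)
    fix a j assume aj: "a < n" "j < n"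
    define F where "F t = \<psi> a (t + n - j)" for t
    have "(\<Sum>t\<in>I (Suc j). d a * (schur_row k y n a (t + n - Suc j) / x ^ Suc (t + n - Suc j)))
        = (\<Sum>t\<in>I (Suc j). \<psi> a (Suc (t + n - Suc j)) - \<psi> a (t + n - Suc j))"
      using \<psi>_step aj by simp
    also have "\<dots> = (\<Sum>t = \<nu> (Suc (Suc j))..<Suc (\<nu> (Suc j)). \<psi> a (Suc (t + n - Suc j)) - \<psi> a (t + n - Suc j))"
      by (intro sum.cong) (auto simp: I_def)
    also have "\<dots> = (\<Sum>t = \<nu> (Suc (Suc j))..<Suc (\<nu> (Suc j)). (\<lambda>t. \<psi> a (t + n - Suc j)) (Suc t) - (\<lambda>t. \<psi> a (t + n - Suc j)) t)"
      using aj by (intro sum.cong) (auto simp: Suc_diff_Suc Suc_diff_le)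
    also have "\<dots> = \<psi> a (Suc (\<nu> (Suc j)) + n - Suc j) - \<psi> a (\<nu> (Suc (Suc j)) + n - Suc j)"
      by (subst sum_Suc_diff') (use aj dec[of "Suc j"] in auto)
    finally show "\<psi> a (l j) - \<psi> a (l (Suc j)) =
        (\<Sum>t\<in>I (Suc j). d a * (schur_row k y n a (t + n - Suc j) / x ^ Suc (t + n - Suc j)))"
      by (simp add: l_def shifted_def)
  qed
  also have "\<dots> = (\<Sum>\<mu>\<in>PiE {1..n} I. ndet n (\<lambda>a j. d a * (schur_row k y n a (shifted n \<mu> j) / x ^ Suc (shifted n \<mu> j))))"
    unfolding shifted_def by (subst ndet_sum_PiE[symmetric]) (auto simp: I_def)
  also have "\<dots> = (\<Sum>\<mu>\<in>PiE {1..n} I. (\<Prod>a<n. d a) * ((1 / (\<Prod>j<n. x ^ Suc (shifted n \<mu> j))) *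
      ndet n (\<lambda>a j. schur_row k y n a (shifted n \<mu> j))))"
  proof (intro sum.cong refl)
    fix \<mu>
    have "ndet n (\<lambda>a j. schur_row k y n a (shifted n \<mu> j) / x ^ Suc (shifted n \<mu> j)) =
        ndet n (\<lambda>a j. (1 / x ^ Suc (shifted n \<mu> j)) * schur_row k y n a (shifted n \<mu> j))" by simp
    also have "\<dots> = (\<Prod>j<n. 1 / x ^ Suc (shifted n \<mu> j)) * ndet n (\<lambda>a j. schur_row k y n a (shifted n \<mu> j))"
      by (rule ndet_scale_cols)
    also have "(\<Prod>j<n. 1 / x ^ Suc (shifted n \<mu> j)) = 1 / (\<Prod>j<n. x ^ Suc (shifted n \<mu> j))"
      by (simp add: prod_dividef)
    finally show "ndet n (\<lambda>a j. d a * (schur_row k y n a (shifted n \<mu> j) / x ^ Suc (shifted n \<mu> j))) =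
      (\<Prod>a<n. d a) * ((1 / (\<Prod>j<n. x ^ Suc (shifted n \<mu> j))) * ndet n (\<lambda>a j. schur_row k y n a (shifted n \<mu> j)))"
      by (simp only: ndet_scale_rows)
  qed
  also have "(\<Prod>j<Suc n. x ^ l j) * \<dots> = (\<Sum>\<mu>\<in>PiE {1..n} I. (\<Prod>a<n. d a) *
     (((\<Prod>j<Suc n. x ^ l j) / (\<Prod>j<n. x ^ Suc (shifted n \<mu> j))) *
      ndet n (\<lambda>a j. schur_row k y n a (shifted n \<mu> j))))"
    unfolding sum_distrib_left by (intro sum.cong refl) (simp only: times_divide_eq_left times_divide_eq_right mult_1_left mult_ac)
  also have "\<dots> = (\<Sum>\<mu>\<in>PiE {1..n} I. (\<Prod>a<min n k. y (Suc a) - x) *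
     (x ^ ((\<Sum>i=1..Suc n. \<nu> i) - (\<Sum>i=1..n. \<mu> i)) *
      (schur_poly n \<mu> y * (\<Prod>b<n. \<Prod>a<min b k. y (Suc a) - y (Suc b)))))"
  proof (rule sum.cong[OF refl], goal_cases)
    case (1 \<mu>)
    hence \<mu>: "\<mu> \<in> PiE {1..n} I" .
    have IH: "schur_poly n \<mu> y * (\<Prod>b<n. \<Prod>a<min b k. y (Suc a) - y (Suc b)) =
        ndet n (\<lambda>a j. schur_row k y n a (shifted n \<mu> j))"
    proof (rule Suc.IH)
      fix i assume that: "1 \<le> i" "i < n"
      have "\<mu> (Suc i) \<in> I (Suc i)" "\<mu> i \<in> I i" using \<mu> that by (auto simp: PiE_iff)
      thus "\<mu> (Suc i) \<le> \<mu> i" by (simp add: I_def)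
    qed
    show ?case unfolding exponents[OF \<mu>] prod_d IH ..
  qed
  also have "\<dots> = (\<Sum>\<mu>\<in>PiE {1..n} I. x ^ ((\<Sum>i=1..Suc n. \<nu> i) - (\<Sum>i=1..n. \<mu> i)) * schur_poly n \<mu> y) *
      (\<Prod>b<Suc n. \<Prod>a<min b k. y (Suc a) - y (Suc b))"
    unfolding sum_distrib_right by (intro sum.cong refl) (simp add: x_def mult_ac)
  also have "(\<Sum>\<mu>\<in>PiE {1..n} I. x ^ ((\<Sum>i=1..Suc n. \<nu> i) - (\<Sum>i=1..n. \<mu> i)) * schur_poly n \<mu> y) =
      schur_poly (Suc n) \<nu> y"
    unfolding I_def x_def by (rule schur_poly_branching[symmetric]) (use dec in auto)
  finally show ?case by (simp add: l_def)
qed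

section \<open>Reduction to one-variable amplitudes\<close>

definition lcoord :: "nat \<Rightarrow> (nat \<Rightarrow> int) \<Rightarrow> nat \<Rightarrow> int" where
  "lcoord N lam j = lam (Suc j) + int N - int (Suc j)"

definition node_weight :: "nat \<Rightarrow> (nat \<Rightarrow> complex) \<Rightarrow> nat \<Rightarrow> complex" where
  "node_weight N c j = (\<Prod>i\<in>{..<N} - {j}. c j - c i)"

definition amp :: "nat \<Rightarrow> (nat \<Rightarrow> int) \<Rightarrow> nat \<Rightarrow> complex \<Rightarrow> complex" where
  "amp N lam p x = (\<Sum>j<N. x powi lcoord N lam j *
     (of_int (lcoord N lam j) ^ p / node_weight N (\<lambda>j. of_int (lcoord N lam j)) j))"

section \<open>Lagrange interpolation\<close>

lemma prod_linear_monic: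
  fixes a :: "'b \<Rightarrow> 'a :: idom"
  assumes "finite A"
  shows "degree (\<Prod>i\<in>A. [:- a i, 1:]) = card A" "lead_coeff (\<Prod>i\<in>A. [:- a i, 1:]) = 1"
proof -
  show "degree (\<Prod>i\<in>A. [:- a i, 1:]) = card A"
    using assms by (subst degree_prod_eq_sum_degree) auto
  show "lead_coeff (\<Prod>i\<in>A. [:- a i, 1:]) = 1"
    by (simp add: lead_coeff_prod)
qed

lemma lagrange_interpolation:
  fixes c :: "nat \<Rightarrow> complex"
  assumes "inj_on c {..<N}" "degree q < N"
  shows "(\<Sum>j<N. Polynomial.smult (poly q (c j) / node_weight N c j) (\<Prod>i\<in>{..<N} - {j}. [:- c i, 1:])) = q"
    (is "(\<Sum>j<N. ?L j) = q")
proof (rule poly_eqI_degree[where A = "c ` {..<N}"])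
  show "card (c ` {..<N}) > degree q" using assms by (simp add: card_image)
  have "degree (?L j) \<le> N - 1" if "j < N" for j
    using that by (intro order_trans[OF degree_smult_le]) (simp add: prod_linear_monic)
  hence "degree (\<Sum>j<N. ?L j) \<le> N - 1" by (intro degree_sum_le) auto
  thus "card (c ` {..<N}) > degree (\<Sum>j<N. ?L j)" using assms by (simp add: card_image)
  fix x assume "x \<in> c ` {..<N}"
  then obtain r where r: "r < N" "x = c r" by auto
  have "poly (?L j) x = (if j = r then poly q x else 0)" if "j < N" for j
  proof (cases "j = r")
    case True
    have "node_weight N c r \<noteq> 0"
      using assms(1) r by (auto simp: node_weight_def inj_on_def)
    thus ?thesis using True r by (simp add: poly_prod node_weight_def)
  next
    case False
    have "poly (\<Prod>i\<in>{..<N} - {j}. [:- c i, 1:]) x = 0"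
      using r False by (auto simp: poly_prod intro!: bexI[of _ r])
    thus ?thesis using False by simp
  qed
  thus "poly (\<Sum>j<N. ?L j) x = poly q x"
    using r by (simp add: poly_sum)
qed

text \<open>Compare the coefficients of degree \<open>N - 1\<close> in the interpolation formula;
  every basis polynomial is monic of that degree before scaling.\<close>

lemma lagrange_sum:
  fixes c :: "nat \<Rightarrow> complex"
  assumes "inj_on c {..<N}" "degree q < N"
  shows "(\<Sum>j<N. poly q (c j) / node_weight N c j) = coeff q (N - 1)"
proof -
  have "coeff (\<Prod>i\<in>{..<N} - {j}. [:- c i, 1:]) (N - 1) = 1" if "j < N" for j
    using prod_linear_monic[of "{..<N} - {j}" c] that by simp
  hence "(\<Sum>j<N. poly q (c j) / node_weight N c j) =
      coeff (\<Sum>j<N. Polynomial.smult (poly q (c j) / node_weight N c j) (\<Prod>i\<in>{..<N} - {j}. [:- c i, 1:])) (N - 1)"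
    by (simp add: coeff_sum)
  thus ?thesis by (simp add: lagrange_interpolation[OF assms])
qed

section \<open>Signatures, their shapes and their nodes\<close>

lemma diagram_eq_ydiag: "diagram N lam = ydiag N (\<lambda>i. nat (lam i - lam N))"
  by (auto simp: diagram_def ydiag_def)

lemma schur_eq_schur_poly:
  "schur N lam x = (\<Prod>i=1..N. x i) powi lam N * schur_poly N (\<lambda>i. nat (lam i - lam N)) x"
  by (simp add: schur_def schur_poly_def ssyt_def tableaux_def diagram_eq_ydiag)

lemma signature_shape_decreasing:
  assumes "is_signature N lam" "1 \<le> i" "i < N"
  shows "nat (lam (Suc i) - lam N) \<le> nat (lam i - lam N)"
proof -
  have "lam (Suc i) \<le> lam i" using assms by (auto simp: is_signature_def)
  thus ?thesis by (intro nat_mono) simp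
qed

text \<open>At ones every tableau has weight 1, so the value counts a nonempty finite set.\<close>

lemma schur_ones_nonzero:
  assumes "is_signature N lam"
  shows "schur N lam (\<lambda>_. 1) \<noteq> 0"
proof -
  have "tableaux N (\<lambda>i. nat (lam i - lam N)) \<noteq> {}"
    by (rule tableaux_nonempty) (rule signature_shape_decreasing[OF assms])
  thus ?thesis by (simp add: schur_eq_schur_poly schur_poly_def)
qed

lemma shifted_eq_lcoord:
  assumes "is_signature N lam" "j < N"
  shows "int (shifted N (\<lambda>i. nat (lam i - lam N)) j) = lcoord N lam j - lam N"
proof -
  have "lam N \<le> lam (Suc j)" using assms by (auto simp: is_signature_def)
  thus ?thesis using assms by (simp add: shifted_def lcoord_def)
qed

lemma lcoord_inj:
  assumes "is_signature N lam"
  shows "inj_on (\<lambda>j. of_int (lcoord N lam j) :: complex) {..<N}"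
proof (rule linorder_inj_onI)
  fix i j assume "i < j" "i \<in> {..<N}" "j \<in> {..<N}"
  hence "lam (Suc j) \<le> lam (Suc i)" using assms by (auto simp: is_signature_def)
  hence "lcoord N lam i \<noteq> lcoord N lam j" using \<open>i < j\<close> by (simp add: lcoord_def)
  thus "(of_int (lcoord N lam i) :: complex) \<noteq> of_int (lcoord N lam j)" by simp
qed auto

text \<open>The binomial coefficient is a polynomial in \<open>c j\<close> of degree
  \<open>N - 1 - a\<close> with leading coefficient \<open>1 / fact (N - 1 - a)\<close>, which the
  shift by \<open>d\<close> does not affect. Times \<open>c j ^ p\<close> the degree is at most
  \<open>N - 1\<close>, with equality exactly for \<open>p = a\<close>.\<close>

lemma binomial_moments:
  fixes c :: "nat \<Rightarrow> complex"
  assumes "inj_on c {..<N}" "p \<le> a" "a < N" "\<And>j. j < N \<Longrightarrow> of_nat (l j) = c j - d"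
  shows "(\<Sum>j<N. of_nat (l j choose (N - 1 - a)) * (c j ^ p / node_weight N c j)) =
    (if p = a then 1 / fact (N - 1 - a) else 0)"
proof -
  define b where "b = N - 1 - a"
  define r where "r = (\<Prod>i\<in>{..<b}. [:- (d + of_nat i), 1:]) * Polynomial.monom 1 p"
  have r0: "(\<Prod>i\<in>{..<b}. [:- (d + of_nat i), 1:]) \<noteq> 0" by simp
  have deg: "degree r = b + p"
    unfolding r_def by (subst degree_mult_eq[OF r0])
      (simp_all add: prod_linear_monic degree_monom_eq del: minus_add_distrib)
  have lc: "coeff r (b + p) = 1"
    unfolding deg[symmetric] unfolding r_def lead_coeff_mult
    by (subst prod_linear_monic) (simp_all add: degree_monom_eq)
  have poly_r: "of_nat (l j choose b) * c j ^ p = poly (Polynomial.smult (1 / fact b) r) (c j)" if "j < N" for j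
  proof -
    have "(of_nat (l j choose b) :: complex) = (\<Prod>i<b. of_nat (l j) - of_nat i) / fact b"
      by (simp add: binomial_gbinomial gbinomial_prod_rev atLeast0LessThan)
    also have "(\<Prod>i<b. (of_nat (l j) :: complex) - of_nat i) = poly (\<Prod>i\<in>{..<b}. [:- (d + of_nat i), 1:]) (c j)"
    proof -
      have "c j = of_nat (l j) + d" using assms(4)[OF that] by simp
      thus ?thesis by (simp add: poly_prod)
    qed
    finally show ?thesis by (simp add: r_def poly_monom)
  qed
  have "(\<Sum>j<N. of_nat (l j choose b) * (c j ^ p / node_weight N c j)) =
      (\<Sum>j<N. poly (Polynomial.smult (1 / fact b) r) (c j) / node_weight N c j)"
    using poly_r by (intro sum.cong) auto
  also have "\<dots> = coeff (Polynomial.smult (1 / fact b) r) (N - 1)"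
    using assms(2,3) by (intro lagrange_sum assms(1)) (simp add: deg b_def)
  also have "\<dots> = (if p = a then 1 / fact b else 0)"
  proof (cases "p = a")
    case True
    thus ?thesis using lc assms(3) by (simp add: b_def)
  next
    case False
    hence "degree r < N - 1" using deg assms(2,3) by (simp add: b_def)
    thus ?thesis using False by (simp add: coeff_eq_0)
  qed
  finally show ?thesis by (simp add: b_def)
qed

text \<open>Multiplication by the matrix \<open>l\<^sub>j\<^bsup>p\<^esup> / \<Prod>\<^bsub>i\<noteq>j\<^esub> (l\<^sub>j - l\<^sub>i)\<close> makes the block of binomial rows upper triangular.\<close>

lemma schur_determinant_amp:
  assumes sig: "is_signature N lam" and kN: "k \<le> N"
  shows "\<exists>c. c \<noteq> 0 \<and> (\<forall>x. (\<forall>i\<in>{1..k}. x i \<noteq> 0) \<longrightarrow>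
      schur N lam (\<lambda>i. if i \<le> k then x i else 1) * (\<Prod>b<k. \<Prod>a<b. x (Suc a) - x (Suc b)) *
        (\<Prod>a<k. x (Suc a) - 1) ^ (N - k) = c * ndet k (\<lambda>a p. amp N lam p (x (Suc a))))"
proof -
  define \<nu> where "\<nu> = (\<lambda>i. nat (lam i - lam N))"
  define c :: "nat \<Rightarrow> complex" where "c j = of_int (lcoord N lam j)" for j
  define l where "l j = shifted N \<nu> j" for j
  define B where "B j p = c j ^ p / node_weight N c j" for j p
  have inj: "inj_on c {..<N}" unfolding c_def by (rule lcoord_inj[OF sig])
  have l_int: "int (l j) = lcoord N lam j - lam N" if "j < N" for j
    unfolding l_def \<nu>_def using that by (rule shifted_eq_lcoord[OF sig])
  have l_c: "of_nat (l j) = c j - of_int (lam N)" if "j < N" for j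
    using arg_cong[OF l_int[OF that], of "of_int :: int \<Rightarrow> complex"] by (simp add: c_def)
  define F :: "nat \<Rightarrow> complex" where "F k = (\<Prod>a=k..<N. 1 / fact (N - 1 - a))" for k
  have F0: "F k \<noteq> 0" for k by (simp add: F_def)
  have reduce: "ndet N (\<lambda>a j. if a < k then f a j else of_nat (l j choose (N - 1 - a))) * ndet N B =
      ndet k (\<lambda>a p. \<Sum>j<N. f a j * B j p) * F k" if "k \<le> N" for k f
  proof -
    define M where "M a j = (if a < k then f a j else of_nat (l j choose (N - 1 - a)))" for a j
    have low: "(\<Sum>j<N. M a j * B j p) = (if p = a then 1 / fact (N - 1 - a) else 0)"
      if "k \<le> a" "a < N" "p \<le> a" for a p
      using binomial_moments[OF inj \<open>p \<le> a\<close> \<open>a < N\<close> l_c] that by (simp add: M_def B_def)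
    have "ndet N M * ndet N B = ndet N (\<lambda>a p. \<Sum>j<N. M a j * B j p)"
      by (rule ndet_mult[symmetric])
    also have "\<dots> = ndet k (\<lambda>a p. \<Sum>j<N. M a j * B j p) * (\<Prod>a=k..<N. \<Sum>j<N. M a j * B j a)"
      using \<open>k \<le> N\<close> low by (intro ndet_block_triangular) auto
    also have "(\<Prod>a=k..<N. \<Sum>j<N. M a j * B j a) = F k"
      unfolding F_def using low by (intro prod.cong) auto
    also have "ndet k (\<lambda>a p. \<Sum>j<N. M a j * B j p) = ndet k (\<lambda>a p. \<Sum>j<N. f a j * B j p)"
      by (intro ndet_cong) (simp add: M_def)
    finally show ?thesis by (simp add: M_def)
  qed
  \<comment> \<open>With \<open>k = 0\<close> all rows are binomial, and the reduction itself shows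
    that \<open>B\<close> is invertible.\<close>
  have B0: "ndet N B \<noteq> 0" using reduce[of 0 "\<lambda>_ _. 0"] F0[of 0] by auto
  show ?thesis
  proof (intro exI[of _ "F k / ndet N B"] conjI allI impI)
    show "F k / ndet N B \<noteq> 0" using F0 B0 by simp
  next
    fix x :: "nat \<Rightarrow> complex" assume x0: "\<forall>i\<in>{1..k}. x i \<noteq> 0"
    define y where "y = (\<lambda>i. if i \<le> k then x i else 1)"
    \<comment> \<open>As \<open>l j = lcoord N lam j - lam N\<close>, scaling row \<open>a\<close>
      by this power turns the exponent \<open>l j\<close> into \<open>lcoord N lam j\<close>. The
      total scaling is the monomial prefactor of the Schur function, because the variables beyond
      \<open>k\<close> are 1.\<close>
    define s where "s a = (if a < k then y (Suc a) powi lam N else 1)" for a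
    have y0: "y i \<noteq> 0" if "1 \<le> i" for i using x0 that by (simp add: y_def)
    have vand: "(\<Prod>b<N. \<Prod>a<min b k. y (Suc a) - y (Suc b)) =
        (\<Prod>b<k. \<Prod>a<b. x (Suc a) - x (Suc b)) * (\<Prod>a<k. x (Suc a) - 1) ^ (N - k)"
    proof -
      have "(\<Prod>b<N. \<Prod>a<min b k. y (Suc a) - y (Suc b)) =
          (\<Prod>b<k. \<Prod>a<min b k. y (Suc a) - y (Suc b)) * (\<Prod>b=k..<N. \<Prod>a<min b k. y (Suc a) - y (Suc b))"
        using prod.atLeastLessThan_concat[of 0 k N "\<lambda>b. \<Prod>a<min b k. y (Suc a) - y (Suc b)"] kN
        by (simp add: atLeast0LessThan)
      also have "(\<Prod>b<k. \<Prod>a<min b k. y (Suc a) - y (Suc b)) = (\<Prod>b<k. \<Prod>a<b. x (Suc a) - x (Suc b))"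
        by (intro prod.cong) (auto simp: y_def)
      also have "(\<Prod>b=k..<N. \<Prod>a<min b k. y (Suc a) - y (Suc b)) = (\<Prod>b=k..<N. \<Prod>a<k. x (Suc a) - 1)"
        by (intro prod.cong) (auto simp: y_def)
      finally show ?thesis by simp
    qed
    have prod_y: "(\<Prod>i=1..N. y i) powi lam N = (\<Prod>a<N. s a)"
    proof -
      have "(\<Prod>i=1..N. y i) = (\<Prod>a<N. y (Suc a))" by (simp add: prod.atLeast1_atMost_eq)
      also have "\<dots> = (\<Prod>a<k. y (Suc a))"
        using kN by (intro prod.mono_neutral_right) (auto simp: y_def)
      finally have "(\<Prod>i=1..N. y i) powi lam N = (\<Prod>a<k. y (Suc a)) powi lam N" by simp
      also have "\<dots> = (\<Prod>a<k. y (Suc a) powi lam N)"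
        by (induction k) (simp_all add: power_int_mult_distrib)
      also have "\<dots> = (\<Prod>a<k. s a)" by (simp add: s_def)
      also have "\<dots> = (\<Prod>a<N. s a)"
        using kN by (intro prod.mono_neutral_left) (auto simp: s_def)
      finally show ?thesis .
    qed
    have "schur N lam y * (\<Prod>b<N. \<Prod>a<min b k. y (Suc a) - y (Suc b)) * ndet N B =
        (\<Prod>a<N. s a) * (schur_poly N \<nu> y * (\<Prod>b<N. \<Prod>a<min b k. y (Suc a) - y (Suc b))) * ndet N B"
      unfolding schur_eq_schur_poly prod_y \<nu>_def by (simp add: mult_ac)
    also have "schur_poly N \<nu> y * (\<Prod>b<N. \<Prod>a<min b k. y (Suc a) - y (Suc b)) =
        ndet N (\<lambda>a j. schur_row k y N a (l j))"
      unfolding l_def by (rule schur_poly_determinant)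
        (auto simp: \<nu>_def y0 intro!: signature_shape_decreasing[OF sig], simp add: y_def)
    also have "(\<Prod>a<N. s a) * ndet N (\<lambda>a j. schur_row k y N a (l j)) =
        ndet N (\<lambda>a j. s a * schur_row k y N a (l j))"
      by (rule ndet_scale_rows[symmetric])
    also have "\<dots> = ndet N (\<lambda>a j. if a < k then y (Suc a) powi lcoord N lam j
        else of_nat (l j choose (N - 1 - a)))"
    proof (rule ndet_cong)
      fix a j assume "a < N" "j < N"
      have "y (Suc a) powi lam N * y (Suc a) ^ l j = y (Suc a) powi (lam N + int (l j))"
        using y0[of "Suc a"] by (simp add: power_int_add)
      also have "lam N + int (l j) = lcoord N lam j" using l_int[OF \<open>j < N\<close>] by simp
      finally show "s a * schur_row k y N a (l j) = (if a < k then y (Suc a) powi lcoord N lam j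
        else of_nat (l j choose (N - 1 - a)))" by (simp add: s_def schur_row_def)
    qed
    also have "\<dots> * ndet N B = ndet k (\<lambda>a p. \<Sum>j<N. y (Suc a) powi lcoord N lam j * B j p) * F k"
      by (rule reduce[OF kN])
    also have "ndet k (\<lambda>a p. \<Sum>j<N. y (Suc a) powi lcoord N lam j * B j p) =
        ndet k (\<lambda>a p. amp N lam p (x (Suc a)))"
      by (intro ndet_cong) (simp add: amp_def B_def c_def[abs_def] y_def)
    finally show "schur N lam (\<lambda>i. if i \<le> k then x i else 1) * (\<Prod>b<k. \<Prod>a<b. x (Suc a) - x (Suc b)) *
        (\<Prod>a<k. x (Suc a) - 1) ^ (N - k) = F k / ndet N B * ndet k (\<lambda>a p. amp N lam p (x (Suc a)))"
      using B0 unfolding vand unfolding y_def by (simp add: field_simps)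
  qed
qed

section \<open>The Laplace method on the unit circle\<close>

lemma norm_iexp_minus_1: "norm (iexp \<theta> - 1) \<le> \<bar>\<theta>\<bar>"
  using iexp_approx1[of \<theta> 0] by simp

text \<open>From the Taylor bound
  \<open>cos \<theta> - 1 \<le> - \<theta>^2 / 2 + \<theta>^4 / 24\<close> and
  \<open>\<theta>^2 \<le> pi^2 \<le> 10\<close>, since
  \<open>10 / 24 - 1 / 2 = - 1 / 12\<close>.\<close>

lemma cos_le_quadratic:
  fixes \<theta> :: real
  assumes "\<bar>\<theta>\<bar> \<le> pi"
  shows "cos \<theta> - 1 \<le> - \<theta>\<^sup>2 / 12"
proof -
  have "norm (iexp \<theta> - (\<Sum>k\<le>3. (\<i> * of_real \<theta>) ^ k / fact k)) \<le> \<bar>\<theta>\<bar> ^ Suc 3 / fact (Suc 3)"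
    by (rule iexp_approx1)
  moreover have "(\<Sum>k\<le>3. (\<i> * of_real \<theta>) ^ k / fact k) =
      complex_of_real (1 - \<theta>\<^sup>2 / 2) + \<i> * of_real (\<theta> - \<theta> ^ 3 / 6)"
    by (simp add: complex_eq_iff eval_nat_numeral)
  ultimately have "norm (iexp \<theta> - (complex_of_real (1 - \<theta>\<^sup>2 / 2) + \<i> * of_real (\<theta> - \<theta> ^ 3 / 6)))
      \<le> \<theta> ^ 4 / 24"
    by (simp add: fact_numeral)
  hence "\<bar>Re (iexp \<theta> - (complex_of_real (1 - \<theta>\<^sup>2 / 2) + \<i> * of_real (\<theta> - \<theta> ^ 3 / 6)))\<bar> \<le> \<theta> ^ 4 / 24"
    by (rule order_trans[OF abs_Re_le_cmod])
  hence "\<bar>cos \<theta> - (1 - \<theta>\<^sup>2 / 2)\<bar> \<le> \<theta> ^ 4 / 24"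
    unfolding cis_conv_exp[symmetric] by simp
  hence "cos \<theta> - (1 - \<theta>\<^sup>2 / 2) \<le> \<theta> ^ 4 / 24" by linarith
  moreover have "\<theta> ^ 4 \<le> 10 * \<theta>\<^sup>2"
  proof -
    have "\<theta>\<^sup>2 \<le> pi\<^sup>2" using assms by (metis abs_ge_zero power2_abs power_mono)
    also have "pi\<^sup>2 \<le> 10"
    proof -
      have "pi \<le> 3.15" using pi_approx by simp
      hence "pi\<^sup>2 \<le> 3.15\<^sup>2" using pi_gt_zero by (intro power_mono) auto
      thus ?thesis by (simp add: power2_eq_square)
    qed
    finally have "\<theta>\<^sup>2 * \<theta>\<^sup>2 \<le> 10 * \<theta>\<^sup>2" by (intro mult_right_mono) auto
    thus ?thesis by (simp add: power_add[symmetric])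
  qed
  ultimately show ?thesis by simp
qed

text \<open>A logarithm of one factor of the integrand; it has a double zero at \<open>\<theta> = 0\<close>, the saddle point.\<close>

definition phase :: "complex \<Rightarrow> real \<Rightarrow> complex" where
  "phase b \<theta> = (iexp \<theta> - 1) / (1 - b) - \<i> * of_real \<theta>
     - Ln (1 - b * exp (- (\<i> * of_real \<theta>))) + Ln (1 - b)"

lemma exp_phase:
  assumes "norm b < 1"
  shows "exp (phase b \<theta>) = exp ((iexp \<theta> - 1) / (1 - b)) * ((1 - b) / (iexp \<theta> - b))"
proof -
  have n1: "1 - b * exp (- (\<i> * of_real \<theta>)) \<noteq> 0"
  proof
    assume "1 - b * exp (- (\<i> * of_real \<theta>)) = 0"
    hence "norm (b * exp (- (\<i> * of_real \<theta>))) = 1" by (metis norm_one right_minus_eq)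
    thus False using assms by (simp add: norm_mult)
  qed
  have n2: "1 - b \<noteq> 0" using assms by auto
  have eq: "iexp \<theta> - b = iexp \<theta> * (1 - b * exp (- (\<i> * of_real \<theta>)))"
    by (simp add: algebra_simps exp_minus)
  show ?thesis
    unfolding phase_def eq exp_add exp_diff exp_Ln[OF n1] exp_Ln[OF n2] by simp
qed

text \<open>The subtracted function is the phase at \<open>b = 0\<close>. The difference
  \<open>D\<close> vanishes at 0 together with its derivative, and its derivative is at most
  \<open>10 * norm b * |t|\<close>: the numerator is bounded by \<open>5 / 2 * |t|\<close> and each
  of the two factors of the denominator is at least \<open>1 / 2\<close>.\<close>

lemma phase_approx:
  assumes "norm b \<le> 1 / 2"
  shows "norm (phase b \<theta> - (iexp \<theta> - 1 - \<i> * of_real \<theta>)) \<le> 10 * norm b * \<theta>\<^sup>2"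
proof -
  define D where "D t = (iexp t - 1) * (b / (1 - b)) - Ln (1 - b * exp (- (\<i> * of_real t))) + Ln (1 - b)" for t :: real
  define D' where "D' t = \<i> * iexp t * (b / (1 - b)) -
      \<i> * b * exp (- (\<i> * of_real t)) / (1 - b * exp (- (\<i> * of_real t)))" for t :: real
  have b1: "1 - b \<noteq> 0" using assms by auto
  have re: "0 < Re (1 - b * exp (- (\<i> * of_real t)))" "1 / 2 \<le> norm (1 - b * exp (- (\<i> * of_real t)))" for t :: real
  proof -
    have n: "norm (b * exp (- (\<i> * of_real t))) \<le> 1 / 2" using assms by (simp add: norm_mult)
    have "Re (b * exp (- (\<i> * of_real t))) \<le> norm (b * exp (- (\<i> * of_real t)))" by (rule complex_Re_le_cmod)
    thus "0 < Re (1 - b * exp (- (\<i> * of_real t)))" using n unfolding minus_complex.sel one_complex.sel by linarith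
    have "norm (1::complex) - norm (b * exp (- (\<i> * of_real t))) \<le> norm (1 - b * exp (- (\<i> * of_real t)))"
      by (rule norm_triangle_ineq2)
    thus "1 / 2 \<le> norm (1 - b * exp (- (\<i> * of_real t)))" using n by simp
  qed
  have deriv: "(D has_vector_derivative D' t) (at t)" for t
  proof -
    have "1 - b * exp (- (\<i> * of_real t)) \<notin> \<real>\<^sub>\<le>\<^sub>0"
      using re(1)[of t] by (meson complex_nonpos_Reals_iff not_less)
    hence "((\<lambda>z. (exp (\<i> * z) - 1) * (b / (1 - b)) - Ln (1 - b * exp (- (\<i> * z))) + Ln (1 - b))
        has_field_derivative D' t) (at (of_real t))"
      unfolding D'_def using b1 by (auto intro!: derivative_eq_intros simp: divide_inverse mult_ac)
    from has_vector_derivative_real_field[OF this, of UNIV] show ?thesis by (simp add: D_def[abs_def])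
  qed
  have bound: "norm (D' t) \<le> 10 * norm b * \<bar>t\<bar>" for t
  proof -
    define w where "w = iexp t"
    have inv: "exp (- (\<i> * of_real t)) = 1 / w" by (simp add: w_def exp_minus field_simps)
    have w0: "w \<noteq> 0" by (simp add: w_def)
    have nw: "norm w = 1" by (simp add: w_def)
    have w1: "norm (w - 1) \<le> \<bar>t\<bar>" unfolding w_def by (rule norm_iexp_minus_1)
    have ne: "1 - b * (1 / w) \<noteq> 0" using re(2)[of t] unfolding inv by auto
    have "D' t = \<i> * b * ((w - 1 / w - b * (1 - 1 / w)) / ((1 - b) * (1 - b * (1 / w))))"
      unfolding D'_def inv w_def[symmetric] using b1 ne w0 by (simp add: divide_simps) (simp add: algebra_simps)
    hence "norm (D' t) = norm b * (norm (w - 1 / w - b * (1 - 1 / w)) / (norm (1 - b) * norm (1 - b * (1 / w))))"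
      by (simp add: norm_mult norm_divide)
    also have "\<dots> \<le> norm b * (5 / 2 * \<bar>t\<bar> / (1 / 2 * (1 / 2)))"
    proof (intro mult_left_mono frac_le mult_mono)
      have "1 - 1 / w = (w - 1) / w" using w0 by (simp add: field_simps)
      hence n1: "norm (1 - 1 / w) \<le> \<bar>t\<bar>" using w1 nw by (simp add: norm_divide)
      have "norm (w - 1 / w - b * (1 - 1 / w)) = norm ((w - 1) + (1 - 1 / w) - b * (1 - 1 / w))" by simp
      also have "\<dots> \<le> norm (w - 1) + norm (1 - 1 / w) + norm b * norm (1 - 1 / w)"
        by (metis (no_types, lifting) add_right_mono norm_mult norm_triangle_ineq norm_triangle_ineq4 order_trans)
      also have "\<dots> \<le> \<bar>t\<bar> + \<bar>t\<bar> + 1 / 2 * \<bar>t\<bar>"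
        using w1 n1 assms by (intro add_mono mult_mono) auto
      finally show "norm (w - 1 / w - b * (1 - 1 / w)) \<le> 5 / 2 * \<bar>t\<bar>" by simp
      show "1 / 2 \<le> norm (1 - b)" using re(2)[of 0] by simp
      show "1 / 2 \<le> norm (1 - b * (1 / w))" using re(2)[of t] unfolding inv .
    qed auto
    finally show ?thesis by simp
  qed
  have "norm (D \<theta> - D 0) \<le> 10 * norm b * \<bar>\<theta>\<bar> * norm (\<theta> - 0)"
  proof (rule differentiable_bound[where S = "{-\<bar>\<theta>\<bar>..\<bar>\<theta>\<bar>}" and f' = "\<lambda>t h. h *\<^sub>R D' t"])
    fix t assume t: "t \<in> {-\<bar>\<theta>\<bar>..\<bar>\<theta>\<bar>}"
    show "(D has_derivative (\<lambda>h. h *\<^sub>R D' t)) (at t within {-\<bar>\<theta>\<bar>..\<bar>\<theta>\<bar>})"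
      using deriv[of t] unfolding has_vector_derivative_def by (rule has_derivative_at_withinI)
    have "norm (D' t) \<le> 10 * norm b * \<bar>\<theta>\<bar>"
      using t by (intro order_trans[OF bound] mult_left_mono) auto
    thus "onorm (\<lambda>h. h *\<^sub>R D' t) \<le> 10 * norm b * \<bar>\<theta>\<bar>"
      by (intro onorm_bound) (auto simp: mult.commute intro: mult_left_mono)
  qed auto
  moreover have "D 0 = 0" by (simp add: D_def)
  moreover have "D \<theta> = phase b \<theta> - (iexp \<theta> - 1 - \<i> * of_real \<theta>)"
  proof -
    have "(iexp \<theta> - 1) * (b / (1 - b)) =
        (iexp \<theta> - 1) / (1 - b) - (iexp \<theta> - 1)"
      using b1 by (simp add: field_simps)
    thus ?thesis unfolding D_def phase_def by simp
  qed
  ultimately show ?thesis by (simp add: power2_eq_square abs_mult_self_eq mult.assoc)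
qed

lemma phase_quadratic:
  assumes "norm b \<le> \<eta>" "\<eta> \<le> 1 / 2"
  shows "norm (phase b \<theta> + of_real (\<theta>\<^sup>2 / 2)) \<le> 10 * \<eta> * \<theta>\<^sup>2 + \<bar>\<theta>\<bar> ^ 3 / 6"
proof -
  have "norm (iexp \<theta> - (\<Sum>k\<le>2. (\<i> * of_real \<theta>) ^ k / fact k)) \<le> \<bar>\<theta>\<bar> ^ Suc 2 / fact (Suc 2)"
    by (rule iexp_approx1)
  moreover have "(\<Sum>k\<le>2. (\<i> * of_real \<theta>) ^ k / fact k) = 1 + \<i> * of_real \<theta> - of_real (\<theta>\<^sup>2 / 2)"
    by (simp add: complex_eq_iff eval_nat_numeral)
  ultimately have 1: "norm (iexp \<theta> - (1 + \<i> * of_real \<theta> - of_real (\<theta>\<^sup>2 / 2))) \<le> \<bar>\<theta>\<bar> ^ 3 / 6"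
    by (simp add: fact_numeral)
  have "norm (phase b \<theta> - (iexp \<theta> - 1 - \<i> * of_real \<theta>)) \<le> 10 * norm b * \<theta>\<^sup>2"
    using assms by (intro phase_approx) linarith
  also have "\<dots> \<le> 10 * \<eta> * \<theta>\<^sup>2" using assms by (intro mult_right_mono) auto
  finally have 2: "norm (phase b \<theta> - (iexp \<theta> - 1 - \<i> * of_real \<theta>)) \<le> 10 * \<eta> * \<theta>\<^sup>2" .
  have "norm (phase b \<theta> + of_real (\<theta>\<^sup>2 / 2)) =
    norm ((phase b \<theta> - (iexp \<theta> - 1 - \<i> * of_real \<theta>)) +
      (iexp \<theta> - (1 + \<i> * of_real \<theta> - of_real (\<theta>\<^sup>2 / 2))))"
    by (rule arg_cong[where f = norm]) (simp add: algebra_simps)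
  also have "\<dots> \<le> 10 * \<eta> * \<theta>\<^sup>2 + \<bar>\<theta>\<bar> ^ 3 / 6"
    by (intro norm_triangle_le add_mono 1 2)
  finally show ?thesis .
qed

text \<open>The decay rate \<open>1 / 12\<close> at \<open>b = 0\<close> loses
  \<open>10 / 1000\<close> to the perturbation and stays above \<open>1 / 20\<close>.\<close>

lemma Re_phase_le:
  assumes "norm b \<le> 1 / 1000" "\<bar>\<theta>\<bar> \<le> pi"
  shows "Re (phase b \<theta>) \<le> - \<theta>\<^sup>2 / 20"
proof -
  have "norm (phase b \<theta> - (iexp \<theta> - 1 - \<i> * of_real \<theta>)) \<le> 10 * norm b * \<theta>\<^sup>2"
    using assms by (intro phase_approx) auto
  also have "\<dots> \<le> 10 * (1 / 1000) * \<theta>\<^sup>2"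
    using assms by (intro mult_right_mono) auto
  finally have "Re (phase b \<theta> - (iexp \<theta> - 1 - \<i> * of_real \<theta>)) \<le> \<theta>\<^sup>2 / 100"
    using complex_Re_le_cmod[of "phase b \<theta> - (iexp \<theta> - 1 - \<i> * of_real \<theta>)"] by linarith
  hence "Re (phase b \<theta>) - (cos \<theta> - 1) \<le> \<theta>\<^sup>2 / 100"
    unfolding cis_conv_exp[symmetric] by simp
  thus ?thesis using cos_le_quadratic[OF assms(2)] zero_le_power2[of \<theta>] by linarith
qed

text \<open>The mean value inequality on a half-plane, which is convex. It keeps the factor
  \<open>exp (- s)\<close>, so that the comparison of the integrand with the Gaussian remains
  integrable at scale \<open>1 / sqrt N\<close>.\<close>

lemma norm_exp_diff_le:
  assumes "Re a \<le> - s" "Re b \<le> - s"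
  shows "norm (exp a - exp b) \<le> exp (- s) * norm (a - b)"
proof (rule field_differentiable_bound[where S = "{z. Re z \<le> - s}"])
  show "convex {z. Re z \<le> - s}" by (rule convex_halfspace_Re_le)
  show "(exp has_field_derivative exp z) (at z within {z. Re z \<le> - s})" for z
    by (rule has_field_derivative_at_within) (rule DERIV_exp)
qed (use assms in auto)

text \<open>Parametrises the circle by \<open>{0..1}\<close> so that the saddle point lies at the
  interior point \<open>t = 1 / 2\<close>.\<close>

definition angle :: "real \<Rightarrow> real" where "angle t = 2 * pi * t - pi"

lemma abs_angle_le: "t \<in> {0..1} \<Longrightarrow> \<bar>angle t\<bar> \<le> pi"
  by (auto simp: angle_def abs_le_iff mult_le_cancel_left1)

text \<open>Since \<open>exp (- v) \<le> 1 / (1 + v)\<close>, an arctangent bounds the integral by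
  an elementary antiderivative. Here \<open>sqrt n \<le> 8 * c\<close> because
  \<open>64 / 40 \<ge> 1\<close>.\<close>

lemma gauss_angle_integral_le:
  assumes "n > 0"
  shows "integral {0..1} (\<lambda>t. exp (- (n * (angle t)\<^sup>2 / 40))) \<le> 4 / sqrt n"
proof -
  define c where "c = sqrt (n / 40)"
  have c: "c > 0" "c\<^sup>2 = n / 40" using assms by (auto simp: c_def)
  define F where "F t = arctan (c * angle t) / (2 * pi * c)" for t
  have F: "((\<lambda>t. 1 / (1 + (c * angle t)\<^sup>2)) has_integral F 1 - F 0) {0..1}"
  proof (rule fundamental_theorem_of_calculus)
    fix t
    have "((\<lambda>t. arctan (c * angle t)) has_real_derivative inverse (1 + (c * angle t)\<^sup>2) * (2 * pi * c)) (at t)"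
      unfolding angle_def by (auto intro!: derivative_eq_intros)
    note D = DERIV_cdivide[OF this, of "2 * pi * c"]
    have k: "2 * pi * c \<noteq> 0" using c by simp
    have "inverse q * (2 * pi * c) / (2 * pi * c) = 1 / q" for q :: real
      by (metis inverse_eq_divide k nonzero_mult_div_cancel_right)
    hence "(F has_real_derivative 1 / (1 + (c * angle t)\<^sup>2)) (at t)"
      using D unfolding F_def[abs_def] by metis
    thus "(F has_vector_derivative 1 / (1 + (c * angle t)\<^sup>2)) (at t within {0..1})"
      unfolding has_real_derivative_iff_has_vector_derivative by (rule has_vector_derivative_at_within)
  qed (rule zero_le_one)
  have "integral {0..1} (\<lambda>t. exp (- (n * (angle t)\<^sup>2 / 40))) \<le> integral {0..1} (\<lambda>t. 1 / (1 + (c * angle t)\<^sup>2))"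
  proof (rule integral_le)
    show "(\<lambda>t. exp (- (n * (angle t)\<^sup>2 / 40))) integrable_on {0..1}"
      unfolding angle_def by (intro integrable_continuous_real continuous_intros) auto
    show "(\<lambda>t. 1 / (1 + (c * angle t)\<^sup>2)) integrable_on {0..1}" using F by blast
    fix t
    have "1 + (c * angle t)\<^sup>2 \<le> exp ((c * angle t)\<^sup>2)" by (rule exp_ge_add_one_self)
    moreover have "1 + (c * angle t)\<^sup>2 > 0" by (rule add_pos_nonneg) auto
    ultimately have "exp (- ((c * angle t)\<^sup>2)) \<le> 1 / (1 + (c * angle t)\<^sup>2)"
      unfolding exp_minus inverse_eq_divide by (intro divide_left_mono) auto
    moreover have "(c * angle t)\<^sup>2 = n * (angle t)\<^sup>2 / 40" by (simp add: power_mult_distrib c)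
    ultimately show "exp (- (n * (angle t)\<^sup>2 / 40)) \<le> 1 / (1 + (c * angle t)\<^sup>2)"
      by metis
  qed
  also have "\<dots> = F 1 - F 0" using F by (rule integral_unique)
  also have "\<dots> \<le> 1 / (2 * c)"
  proof -
    have "arctan (c * angle 1) - arctan (c * angle 0) \<le> pi"
      using arctan_ubound[of "c * angle 1"] arctan_lbound[of "c * angle 0"] by linarith
    hence "(arctan (c * angle 1) - arctan (c * angle 0)) / (2 * pi * c) \<le> pi / (2 * pi * c)"
      using c by (intro divide_right_mono) auto
    thus ?thesis by (simp add: F_def diff_divide_distrib)
  qed
  also have "\<dots> \<le> 4 / sqrt n"
  proof -
    have "sqrt n \<le> 8 * c"
    proof (rule real_le_lsqrt)
      show "n \<le> (8 * c)\<^sup>2" using assms by (simp add: power_mult_distrib c)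
    qed (use c in auto)
    thus ?thesis using c assms by (simp add: field_simps)
  qed
  finally show ?thesis .
qed

text \<open>For \<open>t\<close> within \<open>h = 1 / (8 * sqrt n)\<close> of \<open>1 / 2\<close>
  the angle is at most \<open>1 / sqrt n\<close>, because \<open>pi < 4\<close>, and the integrand
  is at least \<open>exp (- 1 / 2) \<ge> 1 / 2\<close>; the window has length
  \<open>2 * h\<close>.\<close>

lemma gauss_angle_integral_ge:
  assumes "n \<ge> 1"
  shows "integral {0..1} (\<lambda>t. exp (- (n * (angle t)\<^sup>2 / 2))) \<ge> 1 / (8 * sqrt n)"
proof -
  define h where "h = 1 / (8 * sqrt n)"
  have sn: "sqrt n \<ge> 1" using assms by simp
  have h: "0 < h" "h \<le> 1 / 8" using sn by (auto simp: h_def field_simps)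
  have int: "(\<lambda>t. exp (- (n * (angle t)\<^sup>2 / 2))) integrable_on {a..b}" for a b
    unfolding angle_def by (intro integrable_continuous_real continuous_intros) auto
  have "h = integral {1/2 - h..1/2 + h} (\<lambda>t. 1 / 2 :: real)" using h by simp
  also have "\<dots> \<le> integral {1/2 - h..1/2 + h} (\<lambda>t. exp (- (n * (angle t)\<^sup>2 / 2)))"
  proof (rule integral_le)
    fix t assume t: "t \<in> {1/2 - h..1/2 + h}"
    have "angle t = 2 * pi * (t - 1/2)" by (simp add: angle_def algebra_simps)
    hence "\<bar>angle t\<bar> = 2 * pi * \<bar>t - 1/2\<bar>" by (simp add: abs_mult)
    also have "\<dots> \<le> 2 * pi * h" using t by (intro mult_left_mono) (auto simp: abs_le_iff)
    also have "\<dots> \<le> 1 / sqrt n"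
      using pi_less_4 sn by (simp add: h_def field_simps)
    finally have "\<bar>angle t\<bar>\<^sup>2 \<le> (1 / sqrt n)\<^sup>2" by (intro power_mono) auto
    hence "n * (angle t)\<^sup>2 \<le> 1" using assms by (simp add: power_divide field_simps)
    hence "exp (- (n * (angle t)\<^sup>2 / 2)) \<ge> exp (- (1 / 2))" by simp
    moreover have "exp (- (1 / 2) :: real) \<ge> 1 + (- (1 / 2))" by (rule exp_ge_add_one_self)
    ultimately show "1 / 2 \<le> exp (- (n * (angle t)\<^sup>2 / 2))" by linarith
  qed (use int in auto)
  also have "\<dots> \<le> integral {0..1} (\<lambda>t. exp (- (n * (angle t)\<^sup>2 / 2)))"
    using h by (intro integral_subset_le int) auto
  finally show ?thesis by (simp add: h_def)
qed

text \<open>With \<open>t = sqrt N * |\<theta>|\<close>, this and the next two bounds let one half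
  of the decay \<open>exp (- t^2 / 20)\<close> absorb a power of \<open>t\<close>; the other half,
  \<open>exp (- t^2 / 40)\<close>, remains to be integrated.\<close>

lemma linear_le_exp_square: "t \<le> 40 * exp (t\<^sup>2 / 40)" for t :: real
proof -
  have "t \<le> 40 + t\<^sup>2" using zero_le_power2[of "t - 1/2"] by (simp add: power2_eq_square algebra_simps)
  thus ?thesis using exp_ge_add_one_self[of "t\<^sup>2 / 40"] by linarith
qed

lemma square_le_exp_square: "t\<^sup>2 \<le> 40 * exp (t\<^sup>2 / 40)" for t :: real
  using exp_ge_add_one_self[of "t\<^sup>2 / 40"] by linarith

text \<open>\<open>t^3 \<le> 1 + t^4\<close>, and the quadratic Taylor term of the exponential is
  \<open>t^4 / 3200\<close>.\<close>

lemma cube_le_exp_square: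
  fixes t :: real
  assumes "t \<ge> 0"
  shows "t ^ 3 \<le> 3600 * exp (t\<^sup>2 / 40)"
proof -
  have "t ^ 3 \<le> 1 + t ^ 4"
  proof (cases "t \<le> 1")
    case True
    have "t ^ 3 \<le> 1" using assms True by (rule power_le_one)
    thus ?thesis using zero_le_power[OF assms, of 4] by linarith
  next
    case False
    have "t ^ 3 \<le> t ^ 4" using False by (intro power_increasing) auto
    thus ?thesis by simp
  qed
  moreover have "1 + t\<^sup>2 / 40 + (t\<^sup>2 / 40)\<^sup>2 / 2 \<le> exp (t\<^sup>2 / 40)"
    by (rule exp_lower_Taylor_quadratic) simp
  moreover have "(t\<^sup>2 / 40)\<^sup>2 = t ^ 4 / 1600" by (simp add: power_divide flip: power_mult)
  ultimately show ?thesis using zero_le_power[OF assms, of 4] zero_le_power2[of t] by linarith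
qed

text \<open>The Laplace method: near \<open>\<theta> = 0\<close> the integrand is \<open>exp (- N\<theta>\<^sup>2/2)\<close> up to a small relative error in
  the exponent, so that all the integrals are equal to leading order, which is \<open>1/\<surd>N\<close>.\<close>

definition laplace_integral :: "nat \<Rightarrow> (nat \<Rightarrow> complex) \<Rightarrow> nat \<Rightarrow> complex" where
  "laplace_integral N b p = integral {0..1} (\<lambda>t. iexp (angle t) ^ Suc p *
     (\<Prod>j<N. exp ((iexp (angle t) - 1) / (1 - b j)) *
        ((1 - b j) / (iexp (angle t) - b j))))"

text \<open>All integrals \<open>I p\<close> are compared with \<open>J\<close>, which lacks the
  factor \<open>w ^ Suc p\<close>. Each differs from \<open>J\<close> by \<open>O(1 / N)\<close>, as
  this factor is 1 at the saddle, while \<open>J\<close> is at least of order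
  \<open>1 / sqrt N\<close>; hence the relative error \<open>1 / sqrt N\<close>. The comparison with
  the Gaussian integral \<open>G\<close> serves only to bound \<open>J\<close> from below.\<close>

lemma laplace_integral_ratio:
  assumes N: "10 ^ 10 \<le> N" and b: "\<And>j. j < N \<Longrightarrow> norm (b j) \<le> 1 / 32000"
  shows "laplace_integral N b 0 \<noteq> 0"
    and "norm (laplace_integral N b p / laplace_integral N b 0 - 1) \<le> 6400 * (real p + 2) / sqrt N"
proof -
  define n where "n = real N"
  have n: "n \<ge> 10 ^ 10" using N by (simp add: n_def)
  define s where "s = sqrt n"
  have s: "s \<ge> 10 ^ 5" "s\<^sup>2 = n"
  proof -
    have "(10 ^ 5)\<^sup>2 \<le> n" using n by simp
    thus "s \<ge> 10 ^ 5" unfolding s_def by (rule real_le_rsqrt)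
    show "s\<^sup>2 = n" using n by (simp add: s_def)
  qed
  define S where "S \<theta> = (\<Sum>j<N. phase (b j) \<theta>)" for \<theta>
  define w where "w t = iexp (angle t)" for t
  have b1: "norm (b j) < 1" if "j < N" for j using b[OF that] by simp
  have E: "exp (S (angle t)) = (\<Prod>j<N. exp ((w t - 1) / (1 - b j)) * ((1 - b j) / (w t - b j)))" for t
    using b1 by (simp add: S_def exp_sum exp_phase w_def)
  have w_ne: "w t - b j \<noteq> 0" if "j < N" for t j
  proof
    assume "w t - b j = 0"
    hence "b j = w t" by simp
    thus False using b1[OF that] by (simp add: w_def)
  qed
  have b_ne: "1 - b j \<noteq> 0" if "j < N" for j
    using b1[OF that] by auto
  have cont_w: "continuous_on A w" for A
    unfolding w_def angle_def by (intro continuous_intros)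
  have cont_E: "continuous_on A (\<lambda>t. exp (S (angle t)))" for A
    unfolding E using w_ne b_ne by (intro continuous_intros cont_w) auto
  have cont_gauss: "continuous_on A (\<lambda>t. exp (- (n * (angle t)\<^sup>2 / 40)))"
    "continuous_on A (\<lambda>t. exp (- (n * (angle t)\<^sup>2 / 2)))" for A
    unfolding angle_def by (intro continuous_intros; simp)+
  define I where "I p = integral {0..1} (\<lambda>t. w t ^ Suc p * exp (S (angle t)))" for p
  define J where "J = integral {0..1} (\<lambda>t. exp (S (angle t)))"
  define G where "G = integral {0..1} (\<lambda>t. exp (- (n * (angle t)\<^sup>2 / 2)))"
  have I_eq: "laplace_integral N b p = I p" for p
    by (simp add: laplace_integral_def I_def E w_def)
  have Re_S: "Re (S (angle t)) \<le> - (n * (angle t)\<^sup>2 / 20)" if "t \<in> {0..1}" for t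
  proof -
    have "Re (S (angle t)) = (\<Sum>j<N. Re (phase (b j) (angle t)))" by (simp add: S_def)
    also have "\<dots> \<le> (\<Sum>j<N. - (angle t)\<^sup>2 / 20)"
    proof (rule sum_mono)
      fix j assume "j \<in> {..<N}"
      hence "norm (b j) \<le> 1 / 1000" using b[of j] by simp
      thus "Re (phase (b j) (angle t)) \<le> - (angle t)\<^sup>2 / 20"
        using abs_angle_le[OF that] by (rule Re_phase_le)
    qed
    finally show ?thesis by (simp add: n_def)
  qed
  have gauss_split: "exp (- (n * (angle t)\<^sup>2 / 20)) = exp (- (n * (angle t)\<^sup>2 / 40)) / exp ((s * \<bar>angle t\<bar>)\<^sup>2 / 40)" for t
    unfolding exp_diff[symmetric] by (simp add: power_mult_distrib s)
  have norm_E: "norm (exp (S (angle t))) \<le> exp (- (n * (angle t)\<^sup>2 / 20))" if "t \<in> {0..1}" for t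
    using Re_S[OF that] by simp
  have gauss_int: "integral {0..1} (\<lambda>t. C * exp (- (n * (angle t)\<^sup>2 / 40))) \<le> C * (4 / s)" if "C \<ge> 0" for C
    using gauss_angle_integral_le[of n] n that by (simp add: s_def mult_left_mono del: times_divide_eq_right)
  have I_J: "norm (I p - J) \<le> 160 * (real p + 1) / n" for p
  proof -
    have "I p - J = integral {0..1} (\<lambda>t. w t ^ Suc p * exp (S (angle t)) - exp (S (angle t)))"
      unfolding I_def J_def
      by (rule integral_diff[symmetric]) (intro integrable_continuous_real continuous_intros cont_w cont_E)+
    also have "norm \<dots> \<le> integral {0..1} (\<lambda>t. (40 * (real p + 1) / s) * exp (- (n * (angle t)\<^sup>2 / 40)))"
    proof (rule integral_norm_bound_integral)
      show "(\<lambda>t. w t ^ Suc p * exp (S (angle t)) - exp (S (angle t))) integrable_on {0..1}"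
        by (intro integrable_continuous_real continuous_intros cont_w cont_E)
      show "(\<lambda>t. (40 * (real p + 1) / s) * exp (- (n * (angle t)\<^sup>2 / 40))) integrable_on {0..1}"
        by (intro integrable_continuous_real continuous_intros cont_gauss)
      fix t :: real assume t: "t \<in> {0..1}"
      have "w t ^ Suc p = exp (\<i> * of_real (Suc p * angle t))"
        unfolding w_def exp_of_nat_mult[symmetric] by (simp add: algebra_simps)
      hence "norm (w t ^ Suc p - 1) \<le> \<bar>Suc p * angle t\<bar>"
        using norm_iexp_minus_1[of "Suc p * angle t"] by (simp only:)
      hence wp: "norm (w t ^ Suc p - 1) \<le> (real p + 1) * \<bar>angle t\<bar>" by (simp add: abs_mult add.commute)
      have "norm (w t ^ Suc p * exp (S (angle t)) - exp (S (angle t))) = norm ((w t ^ Suc p - 1) * exp (S (angle t)))"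
        by (simp add: algebra_simps)
      also have "\<dots> \<le> ((real p + 1) * \<bar>angle t\<bar>) * exp (- (n * (angle t)\<^sup>2 / 20))"
        unfolding norm_mult using wp norm_E[OF t] by (intro mult_mono) auto
      also have "\<dots> = ((real p + 1) / s) * ((s * \<bar>angle t\<bar>) / exp ((s * \<bar>angle t\<bar>)\<^sup>2 / 40)) * exp (- (n * (angle t)\<^sup>2 / 40))"
        using s by (simp add: gauss_split)
      also have "\<dots> \<le> ((real p + 1) / s) * 40 * exp (- (n * (angle t)\<^sup>2 / 40))"
        using linear_le_exp_square[of "s * \<bar>angle t\<bar>"] s
        by (intro mult_right_mono mult_left_mono) (auto simp: divide_le_eq)
      finally show "norm (w t ^ Suc p * exp (S (angle t)) - exp (S (angle t))) \<le>
          (40 * (real p + 1) / s) * exp (- (n * (angle t)\<^sup>2 / 40))" by (simp add: mult_ac)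
    qed
    also have "\<dots> \<le> (40 * (real p + 1) / s) * (4 / s)" using s by (intro gauss_int) auto
    also have "\<dots> = 160 * (real p + 1) / n" by (simp add: s(2)[symmetric] power2_eq_square field_simps)
    finally show ?thesis .
  qed
  \<comment> \<open>As the \<open>b j\<close> are small but need not tend to 0, \<open>J / G\<close>
    need not tend to 1. It suffices that the error stays below a fixed fraction of the lower bound
    \<open>1 / (8 * s)\<close> of \<open>G\<close>. The thresholds \<open>1 / 32000\<close> and
    \<open>10 ^ 10\<close> achieve this: \<open>(1 / 80 + 600 / s) * 4 \<le> 3 / 40\<close>, and
    \<open>1 / 8 - 3 / 40 = 1 / 20\<close>.\<close>
  have J_G: "norm (J - of_real G) \<le> (1 / 80 + 600 / s) * (4 / s)"
  proof -
    have "J - of_real G = integral {0..1} (\<lambda>t. exp (S (angle t)) - of_real (exp (- (n * (angle t)\<^sup>2 / 2))))"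
    proof -
      have "of_real G = integral {0..1} (\<lambda>t. complex_of_real (exp (- (n * (angle t)\<^sup>2 / 2))))"
        unfolding G_def
        by (rule integral_linear[OF _ bounded_linear_of_real, unfolded o_def, symmetric])
          (intro integrable_continuous_real cont_gauss)
      thus ?thesis unfolding J_def
        by (simp only:, intro integral_diff[symmetric] integrable_continuous_real continuous_intros cont_E cont_gauss)
    qed
    also have "norm \<dots> \<le> integral {0..1} (\<lambda>t. (1 / 80 + 600 / s) * exp (- (n * (angle t)\<^sup>2 / 40)))"
    proof (rule integral_norm_bound_integral)
      show "(\<lambda>t. exp (S (angle t)) - of_real (exp (- (n * (angle t)\<^sup>2 / 2)))) integrable_on {0..1}"
        by (intro integrable_continuous_real continuous_intros cont_E cont_gauss)
      show "(\<lambda>t. (1 / 80 + 600 / s) * exp (- (n * (angle t)\<^sup>2 / 40))) integrable_on {0..1}"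
        by (intro integrable_continuous_real continuous_intros cont_gauss)
      fix t :: real assume t: "t \<in> {0..1}"
      define \<theta> where "\<theta> = angle t"
      define e where "e = exp ((s * \<bar>\<theta>\<bar>)\<^sup>2 / 40)"
      have e: "e > 0" by (simp add: e_def)
      have "norm (S \<theta> + of_real (n * \<theta>\<^sup>2 / 2)) = norm (\<Sum>j<N. phase (b j) \<theta> + of_real (\<theta>\<^sup>2 / 2))"
        by (simp add: S_def sum.distrib n_def)
      also have "\<dots> \<le> (\<Sum>j<N. 10 * (1 / 32000) * \<theta>\<^sup>2 + \<bar>\<theta>\<bar> ^ 3 / 6)"
        using b by (intro sum_norm_le phase_quadratic) auto
      also have "\<dots> = (s * \<bar>\<theta>\<bar>)\<^sup>2 / 3200 + (s * \<bar>\<theta>\<bar>) ^ 3 / (6 * s)"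
        using s(1) by (simp add: n_def[symmetric] s(2)[symmetric] power_mult_distrib) (simp add: field_simps eval_nat_numeral)
      also have "\<dots> \<le> (40 * e) / 3200 + (3600 * e) / (6 * s)"
        unfolding e_def using s(1) square_le_exp_square[of "s * \<bar>\<theta>\<bar>"] cube_le_exp_square[of "s * \<bar>\<theta>\<bar>"]
        by (intro add_mono divide_right_mono) auto
      also have "\<dots> = (1 / 80 + 600 / s) * e" using s(1) by (simp add: field_simps)
      finally have 1: "norm (S \<theta> - of_real (- (n * \<theta>\<^sup>2 / 2))) \<le> (1 / 80 + 600 / s) * e" by simp
      have "norm (exp (S \<theta>) - exp (of_real (- (n * \<theta>\<^sup>2 / 2)))) \<le>
          exp (- (n * \<theta>\<^sup>2 / 20)) * norm (S \<theta> - of_real (- (n * \<theta>\<^sup>2 / 2)))"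
        using Re_S[OF t] n by (intro norm_exp_diff_le) (auto simp: \<theta>_def)
      also have "\<dots> \<le> exp (- (n * \<theta>\<^sup>2 / 20)) * ((1 / 80 + 600 / s) * e)"
        using 1 by (intro mult_left_mono) auto
      also have "\<dots> = (1 / 80 + 600 / s) * exp (- (n * \<theta>\<^sup>2 / 40))"
        unfolding \<theta>_def gauss_split using e by (simp add: e_def \<theta>_def)
      finally show "norm (exp (S (angle t)) - of_real (exp (- (n * (angle t)\<^sup>2 / 2)))) \<le>
          (1 / 80 + 600 / s) * exp (- (n * (angle t)\<^sup>2 / 40))"
        by (simp only: \<theta>_def exp_of_real)
    qed
    also have "\<dots> \<le> (1 / 80 + 600 / s) * (4 / s)" using s by (intro gauss_int) auto
    finally show ?thesis .
  qed
  have "1 / (8 * s) \<le> G" unfolding G_def s_def using n by (intro gauss_angle_integral_ge) simp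
  moreover have "(1 / 80 + 600 / s) * (4 / s) \<le> (3 / 40) / s"
    using s(1) by (simp add: field_simps)
  moreover have "norm (complex_of_real G) - norm (J - of_real G) \<le> norm J"
    using norm_triangle_ineq3[of J "of_real G"] norm_triangle_sub[of "of_real G" J] by (simp add: norm_minus_commute)
  moreover have "norm (complex_of_real G) \<ge> G" by simp
  ultimately have J_low: "norm J \<ge> 1 / (20 * s)" using J_G by (simp add: field_simps)
  \<comment> \<open>Passing from \<open>J\<close> to \<open>I 0\<close> costs at most half of the
    lower bound \<open>1 / (20 * s)\<close>, as \<open>s \<ge> 6400\<close>.\<close>
  have "160 * (0 + 1) / n \<le> 1 / (40 * s)"
    using s by (simp add: s(2)[symmetric] power2_eq_square field_simps)
  moreover have "norm J - norm (I 0 - J) \<le> norm (I 0)"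
    using norm_triangle_sub[of J "I 0"] by (simp add: norm_minus_commute)
  ultimately have I0: "norm (I 0) \<ge> 1 / (40 * s)" using I_J[of 0] J_low by (simp add: field_simps)
  hence I0_pos: "norm (I 0) > 0" using s(1) by (smt (verit) divide_pos_pos zero_less_power)
  thus "laplace_integral N b 0 \<noteq> 0" unfolding I_eq by simp
  have "norm (I p / I 0 - 1) = norm (I p - I 0) / norm (I 0)"
    using I0_pos by (simp add: norm_divide[symmetric] diff_divide_distrib)
  also have "\<dots> \<le> (160 * (real p + 2) / n) / (1 / (40 * s))"
  proof (rule frac_le)
    have "norm (I p - I 0) \<le> norm (I p - J) + norm (I 0 - J)"
      using norm_triangle_ineq4[of "I p - J" "I 0 - J"] by simp
    also have "\<dots> \<le> 160 * (real p + 1) / n + 160 * (0 + 1) / n"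
      using I_J[of p] I_J[of 0] by simp
    also have "\<dots> = 160 * (real p + 2) / n" by (simp add: add_divide_distrib[symmetric] algebra_simps)
    finally show "norm (I p - I 0) \<le> 160 * (real p + 2) / n" by simp
  qed (use I0 n s in auto)
  also have "\<dots> = 6400 * (real p + 2) / s"
    using s(1) by (simp add: s(2)[symmetric] power2_eq_square field_simps)
  finally show "norm (laplace_integral N b p / laplace_integral N b 0 - 1) \<le> 6400 * (real p + 2) / sqrt N"
    unfolding I_eq s_def n_def .
qed

text \<open>Lagrange interpolation of the constant polynomial 1, divided by the product over all
  nodes.\<close>

lemma node_weight_partial_fractions:
  fixes c :: "nat \<Rightarrow> complex"
  assumes "inj_on c {..<N}" "N > 0" "\<And>j. j < N \<Longrightarrow> z \<noteq> c j"
  shows "(\<Sum>j<N. 1 / node_weight N c j * (1 / (z - c j))) = 1 / (\<Prod>j<N. z - c j)"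
proof -
  have nz: "(\<Prod>j<N. z - c j) \<noteq> 0" using assms(3) by auto
  have "(\<Sum>j<N. 1 / node_weight N c j * (1 / (z - c j))) * (\<Prod>j<N. z - c j) =
      (\<Sum>j<N. 1 / node_weight N c j * (\<Prod>i\<in>{..<N} - {j}. z - c i))"
    unfolding sum_distrib_right
  proof (intro sum.cong refl)
    fix j assume "j \<in> {..<N}"
    hence "(\<Prod>j<N. z - c j) = (z - c j) * (\<Prod>i\<in>{..<N} - {j}. z - c i)"
      by (intro prod.remove) auto
    thus "1 / node_weight N c j * (1 / (z - c j)) * (\<Prod>j<N. z - c j) =
        1 / node_weight N c j * (\<Prod>i\<in>{..<N} - {j}. z - c i)"
      using assms(3) \<open>j \<in> {..<N}\<close> by simp
  qed
  also have "\<dots> = poly (\<Sum>j<N. Polynomial.smult (poly [:1:] (c j) / node_weight N c j)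
      (\<Prod>i\<in>{..<N} - {j}. [:- c i, 1:])) z"
    by (simp add: poly_sum poly_prod)
  also have "\<dots> = 1"
    using assms(1,2) by (subst lagrange_interpolation) auto
  finally show ?thesis using nz by (simp add: field_simps)
qed

text \<open>Cauchy's formula for \<open>circlepath 0 1\<close>. The minus signs come from the
  recentred angle: \<open>iexp (angle t)\<close> is the antipode of the point of the path at time
  \<open>t\<close>.\<close>

lemma has_integral_unit_circle:
  assumes "f holomorphic_on cball 0 1" "norm a < 1"
  shows "((\<lambda>t. f (- iexp (angle t)) * (iexp (angle t) / (iexp (angle t) + a)))
    has_integral f a) {0..1}"
proof -
  have exp_angle: "iexp (angle t) = - exp (2 * of_real pi * \<i> * of_real t)" for t
  proof -
    have "\<i> * of_real (angle t) = 2 * of_real pi * \<i> * of_real t - \<i> * of_real pi"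
      by (simp add: angle_def algebra_simps)
    thus ?thesis by (simp add: exp_diff) 
  qed
  have "((\<lambda>u. f u / (u - a)) has_contour_integral (2 * of_real pi * \<i> * f a)) (circlepath 0 1)"
    using assms by (intro Cauchy_integral_circlepath_simple) auto
  hence "((\<lambda>t. f (circlepath 0 1 t) / (circlepath 0 1 t - a) *
      vector_derivative (circlepath 0 1) (at t within {0..1})) has_integral (2 * of_real pi * \<i> * f a)) {0..1}"
    by (simp add: has_contour_integral_def)
  hence "((\<lambda>t. (1 / (2 * of_real pi * \<i>)) * (f (circlepath 0 1 t) / (circlepath 0 1 t - a) *
      vector_derivative (circlepath 0 1) (at t within {0..1}))) has_integral
      (1 / (2 * of_real pi * \<i>)) * (2 * of_real pi * \<i> * f a)) {0..1}"
    by (rule has_integral_mult_right)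
  hence "((\<lambda>t. (1 / (2 * of_real pi * \<i>)) * (f (circlepath 0 1 t) / (circlepath 0 1 t - a) *
      vector_derivative (circlepath 0 1) (at t within {0..1}))) has_integral f a) {0..1}"
    by simp
  thus ?thesis
  proof (rule has_integral_eq[rotated])
    fix t :: real assume t: "t \<in> {0..1}"
    define w where "w = exp (2 * of_real pi * \<i> * of_real t)"
    have nw: "norm w = 1"
      unfolding w_def norm_exp_eq_Re by simp
    have "w - a \<noteq> 0" using nw assms(2) by auto
    moreover have "- w + a \<noteq> 0" using nw assms(2) by auto
    ultimately have eq: "w / (w - a) = - w / (- w + a)" by (simp add: divide_simps) (simp add: algebra_simps)
    thus "1 / (2 * of_real pi * \<i>) * (f (circlepath 0 1 t) / (circlepath 0 1 t - a) *
        vector_derivative (circlepath 0 1) (at t within {0..1})) =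
      f (- iexp (angle t)) * (iexp (angle t) / (iexp (angle t) + a))"
    proof -
      have vd: "vector_derivative (circlepath 0 1) (at t within {0..1}) = 2 * of_real pi * \<i> * w"
        using t by (simp add: vector_derivative_circlepath01 w_def)
      have cp: "circlepath 0 1 t = w" by (simp add: circlepath w_def)
      have "1 / K * (f w / (w - a) * (K * w)) = f w * (w / (w - a))" if "K \<noteq> 0" for K
        using that by simp
      moreover have "2 * of_real pi * \<i> \<noteq> 0" by simp
      ultimately show ?thesis
        unfolding exp_angle w_def[symmetric] vd cp minus_minus eq[symmetric] by blast
    qed
  qed
qed

text \<open>With \<open>z = Z * w\<close>, Cauchy's formula is applied to each node and partial
  fractions collect the terms into one integrand with denominator
  \<open>\<Prod>j<N. z - c j\<close>. The choice of \<open>u\<close> is the saddle point equation;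
  in the form \<open>u * Z = (\<Sum>j<N. 1 / (1 - c j / Z))\<close> it distributes the exponential
  over the \<open>N\<close> factors, each of which is then the exponential of a
  \<open>phase\<close>.\<close>

lemma amp_laplace_integral:
  fixes c :: "nat \<Rightarrow> complex"
  assumes inj: "inj_on c {..<N}" and N: "N > 0" and c: "\<And>j. j < N \<Longrightarrow> norm (c j) < norm Z"
    and u: "u = (\<Sum>j<N. 1 / (Z - c j))"
  shows "(\<Sum>j<N. exp (u * c j) * (c j ^ p / node_weight N c j)) =
    exp (u * Z) * Z ^ Suc p / (\<Prod>j<N. Z - c j) * laplace_integral N (\<lambda>j. c j / Z) p"
proof -
  have Z: "Z \<noteq> 0" using c[of 0] N by auto
  have Zc: "Z - c j \<noteq> 0" if "j < N" for j using c[OF that] by auto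
  define w where "w t = iexp (angle t)" for t
  have nw: "norm (w t) = 1" for t by (simp add: w_def)
  have w0: "w t \<noteq> 0" for t by (simp add: w_def)
  have Zw: "Z * w t \<noteq> c j" if "j < N" for t j
    using c[OF that] nw[of t] by (metis mult.right_neutral norm_mult order_less_irrefl)
  define f where "f v = exp (u * (- Z * v)) * (- Z * v) ^ p" for v
  have "((\<lambda>t. f (- w t) * (w t / (w t + - c j / Z))) has_integral f (- c j / Z)) {0..1}" if "j < N" for j
    unfolding w_def
  proof (rule has_integral_unit_circle)
    show "f holomorphic_on cball 0 1" unfolding f_def by (intro holomorphic_intros)
    show "norm (- c j / Z) < 1" using c[OF that] Z by (simp add: norm_divide)
  qed
  hence "((\<lambda>t. \<Sum>j<N. 1 / node_weight N c j * (f (- w t) * (w t / (w t + - c j / Z)))) has_integral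
      (\<Sum>j<N. 1 / node_weight N c j * f (- c j / Z))) {0..1}"
    by (intro has_integral_sum has_integral_mult_right) auto
  moreover have "(\<Sum>j<N. 1 / node_weight N c j * (f (- w t) * (w t / (w t + - c j / Z)))) =
      exp (u * Z) * Z ^ Suc p / (\<Prod>j<N. Z - c j) * (w t ^ Suc p *
        (\<Prod>j<N. exp ((w t - 1) / (1 - c j / Z)) * ((1 - c j / Z) / (w t - c j / Z))))" for t
  proof -
    have "(\<Sum>j<N. 1 / node_weight N c j * (f (- w t) * (w t / (w t + - c j / Z)))) =
        f (- w t) * (Z * w t) * (\<Sum>j<N. 1 / node_weight N c j * (1 / (Z * w t - c j)))"
      unfolding sum_distrib_left
    proof (intro sum.cong refl)
      fix j assume "j \<in> {..<N}"
      hence "w t / (w t + - c j / Z) = Z * w t * (1 / (Z * w t - c j))"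
        using Z Zw[of j t] by (simp add: field_simps)
      thus "1 / node_weight N c j * (f (- w t) * (w t / (w t + - c j / Z))) =
          f (- w t) * (Z * w t) * (1 / node_weight N c j * (1 / (Z * w t - c j)))"
        by simp
    qed
    also have "\<dots> = f (- w t) * (Z * w t) / (\<Prod>j<N. Z * w t - c j)"
      using Zw by (subst node_weight_partial_fractions[OF inj N]) auto
    also have "\<dots> = exp (u * Z * w t) * Z ^ Suc p * w t ^ Suc p / (\<Prod>j<N. Z * w t - c j)"
      by (simp add: f_def power_mult_distrib mult_ac)
    also have "exp (u * Z * w t) = exp (u * Z) * (\<Prod>j<N. exp ((w t - 1) / (1 - c j / Z)))"
    proof -
      have "u * Z = (\<Sum>j<N. 1 / (1 - c j / Z))"
        unfolding u sum_distrib_right using Z Zc by (intro sum.cong refl) (auto simp: field_simps)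
      moreover have "(\<Sum>j<N. (w t - 1) / (1 - c j / Z)) = (w t - 1) * (\<Sum>j<N. 1 / (1 - c j / Z))"
        by (simp add: sum_distrib_left)
      ultimately have "u * Z * w t = u * Z + (\<Sum>j<N. (w t - 1) / (1 - c j / Z))"
        by (simp add: algebra_simps)
      thus ?thesis by (simp add: exp_add exp_sum)
    qed
    also have "(\<Prod>j<N. Z * w t - c j) = (\<Prod>j<N. Z - c j) * (\<Prod>j<N. (w t - c j / Z) / (1 - c j / Z))"
      unfolding prod.distrib[symmetric] using Z Zc by (intro prod.cong refl) (auto simp: field_simps)
    finally show ?thesis
      by (simp add: prod.distrib prod_dividef)
  qed
  ultimately have "((\<lambda>t. exp (u * Z) * Z ^ Suc p / (\<Prod>j<N. Z - c j) * (w t ^ Suc p *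
        (\<Prod>j<N. exp ((w t - 1) / (1 - c j / Z)) * ((1 - c j / Z) / (w t - c j / Z))))) has_integral
      (\<Sum>j<N. 1 / node_weight N c j * f (- c j / Z))) {0..1}" by simp
  from integral_unique[OF this]
  have "exp (u * Z) * Z ^ Suc p / (\<Prod>j<N. Z - c j) * laplace_integral N (\<lambda>j. c j / Z) p =
      (\<Sum>j<N. 1 / node_weight N c j * f (- c j / Z))"
    by (simp add: laplace_integral_def w_def)
  also have "\<dots> = (\<Sum>j<N. exp (u * c j) * (c j ^ p / node_weight N c j))"
    using Z by (intro sum.cong refl) (simp add: f_def)
  finally show ?thesis by simp
qed

text \<open>The prefactor \<open>K\<close> is the same for all \<open>p\<close>, so the quotient of
  amplitudes is \<open>Z ^ p\<close> times a quotient of Laplace integrals.\<close>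

lemma amp_ratio:
  assumes sig: "is_signature N lam" and N: "10 ^ 10 \<le> N" and Z: "Z \<noteq> 0"
    and small: "\<And>j. j < N \<Longrightarrow> norm (of_int (lcoord N lam j) / Z) \<le> 1 / 32000"
    and u: "u = (\<Sum>j<N. 1 / (Z - of_int (lcoord N lam j)))"
  shows "amp N lam 0 (exp u) \<noteq> 0"
    and "norm (amp N lam p (exp u) / amp N lam 0 (exp u) / Z ^ p - 1) \<le> 6400 * (real p + 2) / sqrt N"
proof -
  define c :: "nat \<Rightarrow> complex" where "c j = of_int (lcoord N lam j)" for j
  have inj: "inj_on c {..<N}" unfolding c_def by (rule lcoord_inj[OF sig])
  have N0: "N > 0" using N by (cases N) auto
  have lt: "norm (c j) < norm Z" if "j < N" for j
  proof -
    have "norm (c j) \<le> norm Z / 32000" using small[OF that] Z by (simp add: c_def norm_divide field_simps)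
    moreover have "norm Z > 0" using Z by simp
    ultimately show ?thesis by linarith
  qed
  have nz: "(\<Prod>j<N. Z - c j) \<noteq> 0" using lt by auto
  define K where "K = exp (u * Z) * Z / (\<Prod>j<N. Z - c j)"
  have K: "K \<noteq> 0" using nz Z by (simp add: K_def)
  have amp: "amp N lam p (exp u) = K * Z ^ p * laplace_integral N (\<lambda>j. c j / Z) p" for p
  proof -
    have "amp N lam p (exp u) = (\<Sum>j<N. exp (u * c j) * (c j ^ p / node_weight N c j))"
      unfolding amp_def c_def[symmetric] by (simp add: c_def[abs_def] exp_power_int mult.commute)
    also have "\<dots> = exp (u * Z) * Z ^ Suc p / (\<Prod>j<N. Z - c j) * laplace_integral N (\<lambda>j. c j / Z) p"
      by (rule amp_laplace_integral[OF inj N0 lt]) (simp_all add: u c_def)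
    finally show ?thesis by (simp add: K_def)
  qed
  have b: "norm (c j / Z) \<le> 1 / 32000" if "j < N" for j using small[OF that] by (simp add: c_def)
  note L = laplace_integral_ratio[OF N, of "\<lambda>j. c j / Z", OF b]
  show "amp N lam 0 (exp u) \<noteq> 0" unfolding amp using K L(1) by simp
  have "amp N lam p (exp u) / amp N lam 0 (exp u) / Z ^ p =
      laplace_integral N (\<lambda>j. c j / Z) p / laplace_integral N (\<lambda>j. c j / Z) 0"
    unfolding amp using K Z by simp
  thus "norm (amp N lam p (exp u) / amp N lam 0 (exp u) / Z ^ p - 1) \<le> 6400 * (real p + 2) / sqrt N"
    using L(2)[of p] by simp
qed

section \<open>Inversion of moment series\<close>

text \<open>The Cauchy transform in the coordinate \<open>y = 1 / z\<close> at infinity.\<close>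

definition moment_series :: "(nat \<Rightarrow> complex) \<Rightarrow> complex \<Rightarrow> complex" where
  "moment_series \<mu> y = y * (\<Sum>n. \<mu> n * y ^ n)"

text \<open>What is used of a probability measure supported in \<open>{- A..A}\<close>. One
  \<open>A\<close> serves the empirical measures and their limit, so all radii below are independent
  of \<open>N\<close>.\<close>

definition moment_bound :: "real \<Rightarrow> (nat \<Rightarrow> complex) \<Rightarrow> bool" where
  "moment_bound A \<mu> \<longleftrightarrow> 1 \<le> A \<and> \<mu> 0 = 1 \<and> (\<forall>n. norm (\<mu> n) \<le> A ^ n)"

lemma moment_boundD:
  assumes "moment_bound A \<mu>"
  shows "A > 0" "1 \<le> A" "\<mu> 0 = 1" "norm (\<mu> n) \<le> A ^ n"
  using assms unfolding moment_bound_def by auto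

lemma moment_summable:
  assumes "moment_bound A \<mu>" "norm y < 1 / A"
  shows "summable (\<lambda>n. norm (\<mu> n * y ^ n))"
proof (rule summable_comparison_test)
  have A: "A > 0" by (rule moment_boundD(1)[OF assms(1)])
  have "A * norm y < 1" using assms(2) A by (simp add: pos_less_divide_eq mult.commute)
  thus "summable (\<lambda>n. (A * norm y) ^ n)"
    using A by (intro summable_geometric) simp
  show "\<exists>N. \<forall>n\<ge>N. norm (norm (\<mu> n * y ^ n)) \<le> (A * norm y) ^ n"
  proof (intro exI allI impI)
    fix n
    have "norm (\<mu> n) * norm y ^ n \<le> A ^ n * norm y ^ n"
      by (rule mult_right_mono[OF moment_boundD(4)[OF assms(1)]]) simp
    thus "norm (norm (\<mu> n * y ^ n)) \<le> (A * norm y) ^ n"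
      by (simp only: norm_mult norm_power power_mult_distrib real_norm_def abs_mult power_abs abs_norm_cancel)
  qed
qed

lemma moment_series_holomorphic:
  assumes "moment_bound A \<mu>"
  shows "moment_series \<mu> holomorphic_on ball 0 (1 / A)"
proof -
  have "(\<lambda>y. \<Sum>n. \<mu> n * y ^ n) holomorphic_on ball 0 (1 / A)"
  proof (rule power_series_holomorphic)
    fix w :: complex assume "w \<in> ball 0 (1 / A)"
    hence "norm w < 1 / A" by simp
    hence "summable (\<lambda>n. \<mu> n * w ^ n)"
      by (rule summable_norm_cancel[OF moment_summable[OF assms]])
    thus "(\<lambda>n. \<mu> n * (w - 0) ^ n) sums (\<Sum>n. \<mu> n * w ^ n)" by (simp add: summable_sums)
  qed
  thus ?thesis unfolding moment_series_def[abs_def] by (intro holomorphic_intros)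
qed

lemma moment_series_near_id:
  assumes "moment_bound A \<mu>" "norm y \<le> 1 / (2 * A)"
  shows "norm (moment_series \<mu> y - y) \<le> 2 * A * (norm y)\<^sup>2"
proof -
  have A: "A > 0" by (rule moment_boundD(1)[OF assms(1)])
  have lt: "norm y < 1 / A" using assms(2) A by (simp add: field_simps)
  have half: "A * norm y \<le> 1 / 2" using assms(2) A by (simp add: field_simps)
  have sm: "summable (\<lambda>n. \<mu> n * y ^ n)"
    using moment_summable[OF assms(1) lt] by (rule summable_norm_cancel)
  have bd: "norm (\<mu> (Suc n) * y ^ Suc n) \<le> (A * norm y) * (1 / 2) ^ n" for n
  proof -
    have "norm (\<mu> (Suc n) * y ^ Suc n) \<le> A ^ Suc n * norm y ^ Suc n"
      unfolding norm_mult norm_power by (intro mult_right_mono moment_boundD(4)[OF assms(1)]) simp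
    also have "\<dots> = (A * norm y) * (A * norm y) ^ n" by (simp add: power_mult_distrib)
    also have "\<dots> \<le> (A * norm y) * (1 / 2) ^ n"
      using half A by (intro mult_left_mono power_mono) auto
    finally show ?thesis .
  qed
  have "moment_series \<mu> y - y = y * (\<Sum>n. \<mu> (Suc n) * y ^ Suc n)"
    unfolding moment_series_def suminf_split_head[OF sm]
    using moment_boundD(3)[OF assms(1)] by (simp add: algebra_simps)
  also have "norm \<dots> \<le> norm y * (\<Sum>n. (A * norm y) * (1 / 2) ^ n)"
    unfolding norm_mult by (intro mult_left_mono norm_suminf_le bd summable_mult summable_geometric) auto
  also have "(\<Sum>n. (A * norm y) * (1 / 2) ^ n) = A * norm y * 2"
    by (subst suminf_mult) (auto simp: suminf_geometric)
  finally show ?thesis by (simp add: power2_eq_square mult_ac)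
qed

text \<open>A circle of radius \<open>1 / (16 * A)\<close> about a point of the disc stays within
  \<open>1 / (8 * A)\<close>, where the deviation from the identity is at most
  \<open>1 / (32 * A)\<close>; Cauchy's estimate bounds its derivative by the quotient
  \<open>1 / 2\<close>.\<close>

lemma moment_series_lipschitz:
  assumes mb: "moment_bound A \<mu>" and "norm y1 \<le> 1 / (16 * A)" "norm y2 \<le> 1 / (16 * A)"
  shows "norm ((moment_series \<mu> y1 - y1) - (moment_series \<mu> y2 - y2)) \<le> 1 / 2 * norm (y1 - y2)"
proof -
  have A: "A > 0" by (rule moment_boundD(1)[OF mb])
  define h where "h y = moment_series \<mu> y - y" for y :: complex
  have hol: "h holomorphic_on ball 0 (1 / A)"
    unfolding h_def by (intro holomorphic_intros moment_series_holomorphic[OF mb])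
  have r: "1 / (16 * A) > 0" "1 / (8 * A) < 1 / A" "1 / (16 * A) < 1 / A" "1 / (8 * A) \<le> 1 / (2 * A)"
    "1 / (16 * A) + 1 / (16 * A) = 1 / (8 * A)"
    using A by (auto simp: field_simps)
  have "norm (h y1 - h y2) \<le> 1 / 2 * norm (y1 - y2)"
  proof (rule field_differentiable_bound[where S = "cball 0 (1 / (16 * A))" and f' = "deriv h"])
    fix y :: complex assume y: "y \<in> cball 0 (1 / (16 * A))"
    have sub: "cball y (1 / (16 * A)) \<subseteq> cball 0 (1 / (8 * A))"
    proof
      fix x :: complex assume "x \<in> cball y (1 / (16 * A))"
      hence "norm (y - x) \<le> 1 / (16 * A)" by (simp add: dist_norm)
      thus "x \<in> cball 0 (1 / (8 * A))"
        using y r(5) norm_triangle_ineq2[of x y] by (simp add: norm_minus_commute)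
    qed
    have sub2: "cball y (1 / (16 * A)) \<subseteq> ball 0 (1 / A)" using sub r(2) by auto
    show "(h has_field_derivative deriv h y) (at y within cball 0 (1 / (16 * A)))"
      using y r(3) by (intro has_field_derivative_at_within[OF holomorphic_derivI[OF hol]]) auto
    have "norm ((deriv ^^ 1) h y) \<le> fact 1 * (1 / (32 * A)) / (1 / (16 * A)) ^ 1"
    proof (rule Cauchy_inequality)
      show "h holomorphic_on ball y (1 / (16 * A))"
        using sub2 ball_subset_cball by (intro holomorphic_on_subset[OF hol]) blast
      show "continuous_on (cball y (1 / (16 * A))) h"
        by (rule holomorphic_on_imp_continuous_on[OF holomorphic_on_subset[OF hol sub2]])
      fix x assume "norm (y - x) = 1 / (16 * A)"
      hence "x \<in> cball y (1 / (16 * A))" by (simp add: dist_norm)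
      hence x: "norm x \<le> 1 / (8 * A)" using sub by auto
      have "norm (h x) \<le> 2 * A * (norm x)\<^sup>2"
        unfolding h_def using x r(4) by (intro moment_series_near_id[OF mb]) linarith
      also have "\<dots> \<le> 2 * A * (1 / (8 * A))\<^sup>2"
        using x A by (intro mult_left_mono power_mono) auto
      also have "\<dots> = 1 / (32 * A)" using A by (simp add: power2_eq_square field_simps)
      finally show "norm (h x) \<le> 1 / (32 * A)" .
    qed (use r in auto)
    thus "norm (deriv h y) \<le> 1 / 2" using A by simp
  qed (use assms in auto)
  thus ?thesis by (simp add: h_def)
qed

lemma moment_series_expanding:
  assumes "moment_bound A \<mu>" "norm y1 \<le> 1 / (16 * A)" "norm y2 \<le> 1 / (16 * A)"
  shows "norm (y1 - y2) \<le> 2 * norm (moment_series \<mu> y1 - moment_series \<mu> y2)"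
proof -
  have "norm (y1 - y2) - norm (moment_series \<mu> y1 - moment_series \<mu> y2) \<le>
      norm ((y1 - y2) - (moment_series \<mu> y1 - moment_series \<mu> y2))" by (rule norm_triangle_ineq2)
  also have "\<dots> = norm ((moment_series \<mu> y1 - y1) - (moment_series \<mu> y2 - y2))"
    by (subst norm_minus_commute) (simp add: algebra_simps)
  also have "\<dots> \<le> 1 / 2 * norm (y1 - y2)" by (rule moment_series_lipschitz[OF assms])
  finally show ?thesis by simp
qed

lemma moment_series_0 [simp]: "moment_series \<mu> 0 = 0"
  by (simp add: moment_series_def)

text \<open>Meaningful for \<open>\<bar>u\<bar> \<le> 1 / (32 A)\<close> only, where \<open>y\<close> exists.\<close>

definition moment_inverse :: "real \<Rightarrow> (nat \<Rightarrow> complex) \<Rightarrow> complex \<Rightarrow> complex" where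
  "moment_inverse A \<mu> u = (THE y. norm y \<le> 1 / (16 * A) \<and> moment_series \<mu> y = u)"

lemma moment_inverse_unique:
  assumes "moment_bound A \<mu>" "norm y \<le> 1 / (16 * A)" "moment_series \<mu> y = u"
  shows "moment_inverse A \<mu> u = y"
  unfolding moment_inverse_def
proof (rule the_equality)
  fix y' assume "norm y' \<le> 1 / (16 * A) \<and> moment_series \<mu> y' = u"
  thus "y' = y" using moment_series_expanding[OF assms(1), of y' y] assms by simp
qed (use assms in auto)

text \<open>The solution is the fixed point of the contraction
  \<open>h y = u - (moment_series \<mu> y - y)\<close>. It maps the disc of radius
  \<open>1 / (16 * A)\<close> to itself because \<open>norm u\<close> takes up at most one half of
  this radius and the deviation from the identity the other.\<close>

lemma moment_inverse:
  assumes mb: "moment_bound A \<mu>" and u: "norm u \<le> 1 / (32 * A)"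
  shows "norm (moment_inverse A \<mu> u) \<le> 1 / (16 * A)"
    and "moment_series \<mu> (moment_inverse A \<mu> u) = u"
    and "norm (moment_inverse A \<mu> u) \<le> 2 * norm u"
    and "u \<noteq> 0 \<Longrightarrow> moment_inverse A \<mu> u \<noteq> 0"
proof -
  have A: "A > 0" by (rule moment_boundD(1)[OF mb])
  define h where "h y = u - (moment_series \<mu> y - y)" for y
  have lip: "norm ((moment_series \<mu> y - y) - (moment_series \<mu> y' - y')) \<le> 1 / 2 * norm (y - y')"
    if "norm y \<le> 1 / (16 * A)" "norm y' \<le> 1 / (16 * A)" for y y'
    using moment_series_lipschitz[OF mb that] .
  have "\<exists>!y\<in>cball 0 (1 / (16 * A)). h y = y"
  proof (rule Banach_fix[where c = "1 / 2"])
    show "h ` cball 0 (1 / (16 * A)) \<subseteq> cball 0 (1 / (16 * A))"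
    proof safe
      fix y :: complex assume "y \<in> cball 0 (1 / (16 * A))"
      hence y: "norm y \<le> 1 / (16 * A)" by simp
      have "norm (h y) \<le> norm u + norm (moment_series \<mu> y - y)"
        unfolding h_def by (rule norm_triangle_ineq4)
      also have "norm (moment_series \<mu> y - y) \<le> 1 / 2 * norm y"
        using lip[of y 0] y A by simp
      also have "norm u + 1 / 2 * norm y \<le> 1 / (32 * A) + 1 / 2 * (1 / (16 * A))"
        using u y by (intro add_mono mult_left_mono) auto
      also have "\<dots> = 1 / (16 * A)" using A by (simp add: field_simps)
      finally show "h y \<in> cball 0 (1 / (16 * A))" by simp
    qed
    show "dist (h x) (h y) \<le> 1 / 2 * dist x y"
      if "x \<in> cball 0 (1 / (16 * A))" "y \<in> cball 0 (1 / (16 * A))" for x y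
    proof -
      have "dist (h x) (h y) = norm ((moment_series \<mu> y - y) - (moment_series \<mu> x - x))"
        unfolding h_def dist_norm by (rule arg_cong[where f = norm]) simp
      also have "\<dots> \<le> 1 / 2 * norm (y - x)" using that by (intro lip) auto
      finally show ?thesis by (simp add: dist_norm norm_minus_commute)
    qed
    show "cball 0 (1 / (16 * A)) \<noteq> ({} :: complex set)" using A by auto
  qed (auto simp: compact_imp_complete)
  then obtain y where y: "norm y \<le> 1 / (16 * A)" "h y = y" by auto
  hence yu: "moment_series \<mu> y = u" by (simp add: h_def)
  have eq: "moment_inverse A \<mu> u = y" by (rule moment_inverse_unique[OF mb y(1) yu])
  show "norm (moment_inverse A \<mu> u) \<le> 1 / (16 * A)" "moment_series \<mu> (moment_inverse A \<mu> u) = u"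
    using y yu eq by auto
  show "norm (moment_inverse A \<mu> u) \<le> 2 * norm u"
    using moment_series_expanding[OF mb y(1), of 0] A yu eq by simp
  show "moment_inverse A \<mu> u \<noteq> 0" if "u \<noteq> 0" using eq yu that by auto
qed

text \<open>The inverse Cauchy transform \<open>1 / moment_inverse A \<mu> u\<close> has a simple
  pole of residue 1 at \<open>u = 0\<close>; this is what cancels the pole of
  \<open>1 / (z - 1)\<close> in H'.\<close>

lemma moment_inverse_ratio:
  assumes mb: "moment_bound A \<mu>" and u: "norm u \<le> 1 / (32 * A)" "u \<noteq> 0"
  shows "norm (u / moment_inverse A \<mu> u - 1) \<le> 4 * A * norm u"
proof -
  define y where "y = moment_inverse A \<mu> u"
  note y = moment_inverse[OF mb u(1), folded y_def]
  have A: "A > 0" by (rule moment_boundD(1)[OF mb])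
  have y0: "y \<noteq> 0" using y(4) u by simp
  have "norm (u - y) \<le> 2 * A * (norm y)\<^sup>2"
    using moment_series_near_id[OF mb, of y] y(1,2) A by (simp add: field_simps)
  hence "norm (u - y) / norm y \<le> 2 * A * (norm y)\<^sup>2 / norm y" by (intro divide_right_mono) auto
  also have "\<dots> = 2 * A * norm y" using y0 by (simp add: power2_eq_square)
  also have "\<dots> \<le> 2 * A * (2 * norm u)" using y(3) A by (intro mult_left_mono) auto
  finally show ?thesis using y0 unfolding y_def[symmetric]
    by (simp add: norm_divide[symmetric] diff_divide_distrib)
qed

lemma moment_inverse_holomorphic:
  assumes mb: "moment_bound A \<mu>"
  shows "moment_inverse A \<mu> holomorphic_on ball 0 (1 / (32 * A))"
proof -
  have A: "A > 0" by (rule moment_boundD(1)[OF mb])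
  have hol: "moment_series \<mu> holomorphic_on ball 0 (1 / (16 * A))"
    by (rule holomorphic_on_subset[OF moment_series_holomorphic[OF mb]]) (use A in \<open>auto simp: field_simps\<close>)
  have inj: "inj_on (moment_series \<mu>) (ball 0 (1 / (16 * A)))"
  proof (rule inj_onI)
    fix y y' assume "y \<in> ball 0 (1 / (16 * A))" "y' \<in> ball 0 (1 / (16 * A))" "moment_series \<mu> y = moment_series \<mu> y'"
    thus "y = y'" using moment_series_expanding[OF mb, of y y'] by simp
  qed
  obtain g where g: "g holomorphic_on moment_series \<mu> ` ball 0 (1 / (16 * A))"
    "\<And>z. z \<in> ball 0 (1 / (16 * A)) \<Longrightarrow> g (moment_series \<mu> z) = z"
    using holomorphic_has_inverse[OF hol open_ball inj] by metis
  have in_ball: "moment_inverse A \<mu> u \<in> ball 0 (1 / (16 * A))" "moment_series \<mu> (moment_inverse A \<mu> u) = u"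
    if "u \<in> ball 0 (1 / (32 * A))" for u
  proof -
    have u: "norm u < 1 / (32 * A)" using that by simp
    hence "2 * norm u < 1 / (16 * A)" using A by (simp add: field_simps)
    thus "moment_inverse A \<mu> u \<in> ball 0 (1 / (16 * A))"
      using moment_inverse(3)[OF mb, of u] u by simp
    show "moment_series \<mu> (moment_inverse A \<mu> u) = u" using moment_inverse(2)[OF mb, of u] u by simp
  qed
  show ?thesis
  proof (rule holomorphic_transform[OF holomorphic_on_subset[OF g(1)]])
    show "ball 0 (1 / (32 * A)) \<subseteq> moment_series \<mu> ` ball 0 (1 / (16 * A))"
      using in_ball by (metis image_eqI subsetI)
    show "g u = moment_inverse A \<mu> u" if "u \<in> ball 0 (1 / (32 * A))" for u
      using g(2)[OF in_ball(1)[OF that]] in_ball(2)[OF that] by simp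
  qed
qed

text \<open>Tannery's theorem with the majorant \<open>2 * (1 / 16) ^ n\<close> turns convergence of
  each moment into uniform convergence of the series on the disc of radius \<open>\<rho>\<close>,
  and \<open>moment_series_expanding\<close> transfers this to the inverses.\<close>

lemma moment_inverse_uniform_limit:
  assumes mbN: "\<And>N. moment_bound A (\<mu>N N)" and mb: "moment_bound A \<mu>"
    and lim: "\<And>n. (\<lambda>N. \<mu>N N n) \<longlonglongrightarrow> \<mu> n"
  shows "uniform_limit (cball 0 (1 / (32 * A))) (\<lambda>N. moment_inverse A (\<mu>N N)) (moment_inverse A \<mu>) sequentially"
proof -
  have A: "A > 0" by (rule moment_boundD(1)[OF mb])
  define \<rho> where "\<rho> = 1 / (16 * A)"
  have \<rho>: "\<rho> > 0" "\<rho> < 1 / A" "A * \<rho> = 1 / 16" using A by (auto simp: \<rho>_def field_simps)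
  define d where "d N = (\<Sum>n. norm (\<mu>N N n - \<mu> n) * \<rho> ^ n)" for N
  have term_le: "norm (\<mu>N N n - \<mu> n) * \<rho> ^ n \<le> 2 * (1 / 16) ^ n" for N n
  proof -
    have "norm (\<mu>N N n - \<mu> n) \<le> A ^ n + A ^ n"
      by (intro order_trans[OF norm_triangle_ineq4] add_mono moment_boundD(4)[OF mb] moment_boundD(4)[OF mbN])
    hence "norm (\<mu>N N n - \<mu> n) * \<rho> ^ n \<le> (2 * A ^ n) * \<rho> ^ n" using \<rho> by (intro mult_right_mono) auto
    also have "\<dots> = 2 * (A * \<rho>) ^ n" by (simp add: power_mult_distrib)
    finally show ?thesis by (simp add: \<rho>(3))
  qed
  have sm: "summable (\<lambda>n. 2 * (1 / 16 :: real) ^ n)" by (intro summable_mult summable_geometric) auto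
  have smd: "summable (\<lambda>n. norm (\<mu>N N n - \<mu> n) * \<rho> ^ n)" for N
    by (rule summable_comparison_test'[OF sm]) (use term_le \<rho> in auto)
  have d0: "d \<longlonglongrightarrow> (\<Sum>n. 0)"
    unfolding d_def
  proof (rule tannerys_theorem[THEN conjunct2, THEN conjunct2])
    show "((\<lambda>N. norm (\<mu>N N n - \<mu> n) * \<rho> ^ n) \<longlongrightarrow> 0) sequentially" for n
    proof -
      have "(\<lambda>N. norm (\<mu>N N n - \<mu> n)) \<longlonglongrightarrow> 0"
        using lim[of n] by (simp add: LIM_zero tendsto_norm_zero)
      from tendsto_mult_left_zero[OF this] show ?thesis .
    qed
    show "\<forall>\<^sub>F (k, n) in sequentially \<times>\<^sub>F sequentially. norm (norm (\<mu>N n k - \<mu> k) * \<rho> ^ k) \<le> 2 * (1 / 16) ^ k"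
      using term_le \<rho> by (intro always_eventually) (auto simp: abs_mult)
  qed (use sm in auto)
  have close: "norm (moment_series (\<mu>N N) y - moment_series \<mu> y) \<le> d N * \<rho>" if y: "norm y \<le> \<rho>" for N y
  proof -
    have "norm y < 1 / A" using y \<rho> by linarith
    note s1 = summable_norm_cancel[OF moment_summable[OF mbN[of N] this]]
    note s2 = summable_norm_cancel[OF moment_summable[OF mb \<open>norm y < 1 / A\<close>]]
    have "moment_series (\<mu>N N) y - moment_series \<mu> y = y * (\<Sum>n. (\<mu>N N n - \<mu> n) * y ^ n)"
      unfolding moment_series_def right_diff_distrib[symmetric] suminf_diff[OF s1 s2] by (simp add: algebra_simps)
    also have "norm \<dots> \<le> norm y * d N"
      unfolding norm_mult d_def
    proof (intro mult_left_mono norm_suminf_le smd)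
      show "norm ((\<mu>N N n - \<mu> n) * y ^ n) \<le> norm (\<mu>N N n - \<mu> n) * \<rho> ^ n" for n
        unfolding norm_mult norm_power using y by (intro mult_left_mono power_mono) auto
    qed auto
    also have "\<dots> \<le> \<rho> * d N"
      using y smd[of N] \<rho> by (intro mult_right_mono) (auto simp: d_def intro!: suminf_nonneg)
    finally show ?thesis by (simp add: mult.commute)
  qed
  show ?thesis
  proof (rule uniform_limitI)
    fix e :: real assume "e > 0"
    hence "e / (2 * \<rho>) > 0" using \<rho> by simp
    from tendstoD[OF d0 this] have "\<forall>\<^sub>F N in sequentially. norm (d N - 0) < e / (2 * \<rho>)"
      by (simp add: dist_norm)
    thus "\<forall>\<^sub>F N in sequentially. \<forall>u\<in>cball 0 (1 / (32 * A)).
        dist (moment_inverse A (\<mu>N N) u) (moment_inverse A \<mu> u) < e"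
    proof eventually_elim
      case (elim N)
      show ?case
      proof
        fix u :: complex assume "u \<in> cball 0 (1 / (32 * A))"
        hence u: "norm u \<le> 1 / (32 * A)" by simp
        define y where "y = moment_inverse A \<mu> u"
        define y' where "y' = moment_inverse A (\<mu>N N) u"
        note y = moment_inverse[OF mb u, folded y_def]
        note y' = moment_inverse[OF mbN[of N] u, folded y'_def]
        have "norm (y' - y) \<le> 2 * norm (moment_series \<mu> y' - moment_series \<mu> y)"
          by (rule moment_series_expanding[OF mb y'(1) y(1)])
        also have "moment_series \<mu> y = moment_series (\<mu>N N) y'" using y(2) y'(2) by simp
        also have "norm (moment_series \<mu> y' - moment_series (\<mu>N N) y') \<le> d N * \<rho>"
          using close[of y' N] y'(1) by (simp add: \<rho>_def norm_minus_commute)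
        also have "2 * (d N * \<rho>) < e"
        proof -
          have "d N < e / (2 * \<rho>)" using elim abs_ge_self[of "d N"] unfolding real_norm_def diff_zero by linarith
          thus ?thesis using \<rho>(1) by (simp add: pos_less_divide_eq mult_ac)
        qed
        finally show "dist (moment_inverse A (\<mu>N N) u) (moment_inverse A \<mu> u) < e"
          by (simp add: dist_norm y_def y'_def)
      qed
    qed
  qed
qed

section \<open>Separately holomorphic functions on polydiscs\<close>

text \<open>Separate holomorphy is all that the coordinatewise maximum principle and the Cauchy
  estimates below use. Where regularity across variables matters, it comes from an explicit bound,
  not from joint continuity.\<close>

definition sep_hol :: "nat \<Rightarrow> real \<Rightarrow> ((nat \<Rightarrow> complex) \<Rightarrow> complex) \<Rightarrow> bool" where
  "sep_hol k R F \<longleftrightarrow> (\<forall>x\<in>polydisc1 k R. \<forall>i\<in>{1..k}. (\<lambda>z. F (x(i := z))) holomorphic_on ball 1 R)"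

lemma polydisc1_upd: "x \<in> polydisc1 k R \<Longrightarrow> z \<in> ball 1 R \<Longrightarrow> x(i := z) \<in> polydisc1 k R"
  by (auto simp: polydisc1_def dist_norm norm_minus_commute)

lemma polydisc1_mono: "r \<le> R \<Longrightarrow> polydisc1 k r \<subseteq> polydisc1 k R"
  by (auto simp: polydisc1_def)

lemma polydisc1_coord: "x \<in> polydisc1 k R \<Longrightarrow> i \<in> {1..k} \<Longrightarrow> x i \<in> ball 1 R"
  by (auto simp: polydisc1_def dist_norm norm_minus_commute)

lemma sep_holD: "sep_hol k R F \<Longrightarrow> x \<in> polydisc1 k R \<Longrightarrow> i \<in> {1..k} \<Longrightarrow> (\<lambda>z. F (x(i := z))) holomorphic_on ball 1 R"
  by (simp add: sep_hol_def)

lemma sep_hol_subset: "sep_hol k R F \<Longrightarrow> r \<le> R \<Longrightarrow> sep_hol k r F"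
  unfolding sep_hol_def using polydisc1_mono[of r R k] subset_ball[of r R 1]
  by (meson holomorphic_on_subset subsetD)

lemma sep_hol_mult: "sep_hol k R F \<Longrightarrow> sep_hol k R G \<Longrightarrow> sep_hol k R (\<lambda>x. F x * G x)"
  by (auto simp: sep_hol_def intro!: holomorphic_intros)

lemma sep_hol_diff: "sep_hol k R F \<Longrightarrow> sep_hol k R G \<Longrightarrow> sep_hol k R (\<lambda>x. F x - G x)"
  by (auto simp: sep_hol_def intro!: holomorphic_intros)

lemma sep_hol_const: "sep_hol k R (\<lambda>x. c)"
  by (auto simp: sep_hol_def intro!: holomorphic_intros)

lemma sep_hol_prod: "(\<And>a. a \<in> A \<Longrightarrow> sep_hol k R (F a)) \<Longrightarrow> sep_hol k R (\<lambda>x. \<Prod>a\<in>A. F a x)"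
  by (auto simp: sep_hol_def intro!: holomorphic_intros)

lemma sep_hol_divide:
  assumes "sep_hol k R F" "sep_hol k R G" "\<And>x. x \<in> polydisc1 k R \<Longrightarrow> G x \<noteq> 0"
  shows "sep_hol k R (\<lambda>x. F x / G x)"
  using assms polydisc1_upd by (auto simp: sep_hol_def intro!: holomorphic_on_divide)

text \<open>The maximum principle in one variable at a time: induction on the number
  \<open>j\<close> of coordinates that have been released from their circles into the discs.\<close>

lemma sep_hol_bound_torus:
  assumes F: "sep_hol k R F" and \<rho>: "\<And>i. i \<in> {1..k} \<Longrightarrow> 0 < \<rho> i \<and> \<rho> i < R"
    and torus: "\<And>x. (\<And>i. i \<in> {1..k} \<Longrightarrow> norm (x i - 1) = \<rho> i) \<Longrightarrow> norm (F x) \<le> B"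
    and x: "\<And>i. i \<in> {1..k} \<Longrightarrow> norm (x i - 1) \<le> \<rho> i"
  shows "norm (F x) \<le> B"
proof -
  have "norm (F x) \<le> B" if "j \<le> k" "\<And>i. i \<in> {1..k} \<Longrightarrow> norm (x i - 1) \<le> \<rho> i"
    "\<And>i. i \<in> {1..k} \<Longrightarrow> j < i \<Longrightarrow> norm (x i - 1) = \<rho> i" for j x
    using that
  proof (induction j arbitrary: x)
    case 0
    thus ?case by (intro torus) auto
  next
    case (Suc j)
    have j: "Suc j \<in> {1..k}" using Suc.prems by simp
    have xp: "x \<in> polydisc1 k R" using Suc.prems(2) \<rho> by (force simp: polydisc1_def)
    have hol: "(\<lambda>z. F (x(Suc j := z))) holomorphic_on ball 1 R" by (rule sep_holD[OF F xp j])
    have sub: "cball 1 (\<rho> (Suc j)) \<subseteq> (ball 1 R :: complex set)" using \<rho>[OF j] by auto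
    have "norm (F (x(Suc j := x (Suc j)))) \<le> B"
    proof (rule maximum_modulus_frontier[where S = "cball 1 (\<rho> (Suc j))" and f = "\<lambda>z. F (x(Suc j := z))" and \<xi> = "x (Suc j)"])
      show "(\<lambda>z. F (x(Suc j := z))) holomorphic_on interior (cball 1 (\<rho> (Suc j)))"
        using sub by (intro holomorphic_on_subset[OF hol]) auto
      show "continuous_on (closure (cball 1 (\<rho> (Suc j)))) (\<lambda>z. F (x(Suc j := z)))"
        using sub by (intro holomorphic_on_imp_continuous_on holomorphic_on_subset[OF hol]) auto
      show "x (Suc j) \<in> cball 1 (\<rho> (Suc j))"
        using Suc.prems(2)[OF j] by (simp add: dist_norm norm_minus_commute)
      fix z :: complex assume "z \<in> frontier (cball 1 (\<rho> (Suc j)))"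
      hence z: "norm (z - 1) = \<rho> (Suc j)"
        using \<rho>[OF j] by (simp add: dist_norm norm_minus_commute)
      show "norm (F (x(Suc j := z))) \<le> B"
        using Suc.prems z by (intro Suc.IH) auto
    qed auto
    thus ?case by simp
  qed
  from this[of k x] x show ?thesis by auto
qed

section \<open>Partial derivatives and Cauchy estimates\<close>

lemma pd_eq_deriv:
  "pd i F (x(i := z)) = deriv (\<lambda>w. F (x(i := w))) z"
  by (simp add: pd_def)

lemma pd_bound:
  assumes F: "sep_hol k R F" and B: "\<And>x. x \<in> polydisc1 k R \<Longrightarrow> norm (F x) \<le> B"
    and r: "r < R" and x: "x \<in> polydisc1 k r" and i: "i \<in> {1..k}"
  shows "norm (pd i F x) \<le> 2 * B / (R - r)"
proof -
  define s where "s = (R - r) / 2"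
  have s: "0 < s" "r + s < R" using r by (auto simp: s_def field_simps)
  have xR: "x \<in> polydisc1 k R" using x polydisc1_mono[of r R k] r by auto
  have hol: "(\<lambda>z. F (x(i := z))) holomorphic_on ball 1 R" by (rule sep_holD[OF F xR i])
  have sub: "cball (x i) s \<subseteq> ball 1 R"
  proof
    fix z assume "z \<in> cball (x i) s"
    moreover have "dist 1 (x i) < r" using polydisc1_coord[OF x i] by simp
    moreover have "dist 1 z \<le> dist 1 (x i) + dist (x i) z" by (rule dist_triangle)
    ultimately show "z \<in> ball 1 R" using s unfolding mem_ball mem_cball by linarith
  qed
  have "norm ((deriv ^^ 1) (\<lambda>z. F (x(i := z))) (x i)) \<le> fact 1 * B / s ^ 1"
  proof (rule Cauchy_inequality)
    show "(\<lambda>z. F (x(i := z))) holomorphic_on ball (x i) s"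
      using sub ball_subset_cball by (intro holomorphic_on_subset[OF hol]) blast
    show "continuous_on (cball (x i) s) (\<lambda>z. F (x(i := z)))"
      using sub by (intro holomorphic_on_imp_continuous_on holomorphic_on_subset[OF hol])
    fix z assume "norm (x i - z) = s"
    hence "z \<in> cball (x i) s" by (simp add: dist_norm)
    thus "norm (F (x(i := z))) \<le> B" using sub by (intro B polydisc1_upd[OF xR]) auto
  qed (use s in auto)
  hence "norm (pd i F x) \<le> B / s" by (simp add: pd_def)
  also have "B / s = 2 * B / (R - r)" by (simp add: s_def)
  finally show ?thesis .
qed

text \<open>Taylor's formula of first order with the second derivative bounded by Cauchy's estimate.
  The bound depends on \<open>f\<close> through \<open>B\<close> only and is therefore uniform in
  further parameters.\<close>

lemma derivative_difference_quotient_bound: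
  assumes hol: "f holomorphic_on S" and B: "\<And>z. z \<in> S \<Longrightarrow> norm (f z) \<le> B"
    and S: "cball c (2 * s) \<subseteq> S" "open S" and s: "s > 0" and h: "norm h \<le> s" "h \<noteq> 0"
  shows "norm ((f (c + h) - f c) / h - deriv f c) \<le> 2 * B / s\<^sup>2 * norm h"
proof -
  define g where "g n = (deriv ^^ n) f" for n
  have holg: "g n holomorphic_on S" for n
    unfolding g_def by (rule holomorphic_higher_deriv[OF hol S(2)])
  have "cball c s \<subseteq> cball c (2 * s)" using s by (intro subset_cball) simp
  hence sub1: "cball c s \<subseteq> S" using S(1) by (rule order_trans)
  have sub: "cball z s \<subseteq> S" if "z \<in> cball c s" for z
  proof
    fix w assume "w \<in> cball z s"
    hence "dist c w \<le> 2 * s" using that dist_triangle[of c w z] unfolding mem_cball by linarith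
    thus "w \<in> S" using S(1) by auto
  qed
  have "norm (g 0 (c + h) - (\<Sum>i\<le>1. g i c * ((c + h) - c) ^ i / fact i)) \<le>
      (2 * B / s\<^sup>2) * norm ((c + h) - c) ^ Suc 1 / fact 1"
  proof (rule field_Taylor[where S = "cball c s" and f = g and n = 1 and B = "2 * B / s\<^sup>2" and w = c and z = "c + h"])
    show "(g i has_field_derivative g (Suc i) x) (at x within cball c s)" if "x \<in> cball c s" for i x
    proof -
      have "x \<in> S" using that sub1 by auto
      hence "(g i has_field_derivative deriv (g i) x) (at x within cball c s)"
        by (rule holomorphic_derivI[OF holg S(2)])
      moreover have "deriv (g i) = g (Suc i)" by (simp add: g_def)
      ultimately show ?thesis by (simp only:)
    qed
    show "norm (g (Suc 1) x) \<le> 2 * B / s\<^sup>2" if "x \<in> cball c s" for x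
    proof -
      have "norm ((deriv ^^ 2) f x) \<le> fact 2 * B / s ^ 2"
      proof (rule Cauchy_inequality)
        show "f holomorphic_on ball x s"
          using sub[OF that] ball_subset_cball by (intro holomorphic_on_subset[OF hol]) blast
        show "continuous_on (cball x s) f"
          using sub[OF that] by (intro holomorphic_on_imp_continuous_on holomorphic_on_subset[OF hol])
        fix w assume "norm (x - w) = s"
        hence "w \<in> cball x s" by (simp add: dist_norm)
        thus "norm (f w) \<le> B" using sub[OF that] by (intro B) auto
      qed (rule s)
      moreover have "(deriv ^^ 2) f = g (Suc 1)" by (simp add: g_def numeral_2_eq_2)
      ultimately show ?thesis by (simp only: fact_2)
    qed
  qed (use s h in \<open>auto simp: dist_norm\<close>)
  moreover have "g 0 (c + h) - (\<Sum>i\<le>1. g i c * ((c + h) - c) ^ i / fact i) = f (c + h) - f c - deriv f c * h"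
    by (simp add: g_def diff_diff_add)
  moreover have "(2 * B / s\<^sup>2) * norm ((c + h) - c) ^ Suc 1 / fact 1 = (2 * B / s\<^sup>2) * (norm h)\<^sup>2"
    by (simp add: power2_eq_square)
  ultimately have "norm (f (c + h) - f c - deriv f c * h) \<le> (2 * B / s\<^sup>2) * (norm h)\<^sup>2"
    by (simp only:)
  hence "norm (f (c + h) - f c - deriv f c * h) / norm h \<le> (2 * B / s\<^sup>2) * (norm h)\<^sup>2 / norm h"
    by (intro divide_right_mono) auto
  also have "\<dots> = 2 * B / s\<^sup>2 * norm h" using h by (simp add: power2_eq_square)
  also have "norm (f (c + h) - f c - deriv f c * h) / norm h = norm ((f (c + h) - f c) / h - deriv f c)"
    using h by (simp add: norm_divide[symmetric] diff_divide_distrib)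
  finally show ?thesis .
qed

text \<open>For \<open>j\<close> different from \<open>i\<close>, the difference quotients in the
  \<open>i\<close>-th variable are holomorphic in the \<open>j\<close>-th one. The common bound
  \<open>B\<close> makes them converge uniformly to the partial derivative, which is then
  holomorphic too.\<close>

lemma sep_hol_pd:
  assumes F: "sep_hol k R F" and B: "\<And>x. x \<in> polydisc1 k R \<Longrightarrow> norm (F x) \<le> B"
    and r: "r < R" and i: "i \<in> {1..k}"
  shows "sep_hol k r (pd i F)"
  unfolding sep_hol_def
proof (intro ballI)
  fix x j assume x: "x \<in> polydisc1 k r" and j: "j \<in> {1..k}"
  have sub_r: "ball 1 r \<subseteq> (ball 1 R :: complex set)" using r by auto
  have xR: "x \<in> polydisc1 k R" using x polydisc1_mono[of r R k] r by auto
  show "(\<lambda>z. pd i F (x(j := z))) holomorphic_on ball 1 r"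
  proof (cases "j = i")
    case True
    have "deriv (\<lambda>w. F (x(i := w))) holomorphic_on ball 1 R"
      by (rule holomorphic_deriv[OF sep_holD[OF F xR i]]) simp
    hence "(\<lambda>z. pd i F (x(i := z))) holomorphic_on ball 1 R"
      unfolding pd_eq_deriv[abs_def] .
    thus ?thesis using sub_r True holomorphic_on_subset by blast
  next
    case False
    define c where "c = x i"
    define s where "s = (R - r) / 4"
    have s: "s > 0" "r + 2 * s < R" using r by (auto simp: s_def field_simps)
    have c: "dist 1 c < r" using polydisc1_coord[OF x i] by (simp add: c_def)
    have csub: "cball c (2 * s) \<subseteq> ball 1 R"
    proof
      fix z assume "z \<in> cball c (2 * s)"
      moreover have "dist 1 z \<le> dist 1 c + dist c z" by (rule dist_triangle)
      ultimately show "z \<in> ball 1 R" using s c unfolding mem_ball mem_cball by linarith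
    qed
    define h where "h n = complex_of_real (s / real (Suc n))" for n
    have nh: "norm (h n) = s / real (Suc n)" for n
      using s by (simp add: h_def del: of_real_divide of_nat_Suc)
    have h: "norm (h n) \<le> s" "h n \<noteq> 0" for n
    proof -
      have "s / real (Suc n) \<le> s / 1" using s by (intro divide_left_mono) auto
      thus "norm (h n) \<le> s" unfolding nh by simp
      have "s / real (Suc n) \<noteq> 0" using s by simp
      thus "h n \<noteq> 0" unfolding h_def of_real_eq_0_iff .
    qed
    have ch: "c + h n \<in> ball 1 R" for n
      using csub h(1)[of n] s by (intro subsetD[OF csub]) (simp add: dist_norm)
    define f where "f n z = (F (x(j := z, i := c + h n)) - F (x(j := z, i := c))) / h n" for n z
    have upd: "x(j := z, i := w) = x(i := w, j := z)" for z w using False by (simp add: fun_upd_twist)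
    show ?thesis
    proof (rule holomorphic_uniform_sequence[where f = f])
      show "f n holomorphic_on ball 1 r" for n
      proof -
        have "(\<lambda>z. F (x(i := w, j := z))) holomorphic_on ball 1 r" if "w \<in> ball 1 R" for w
          using sub_r by (intro holomorphic_on_subset[OF sep_holD[OF F polydisc1_upd[OF xR that] j]])
        moreover have "c \<in> ball 1 R" using c r by simp
        ultimately show ?thesis
          unfolding f_def upd using ch h by (intro holomorphic_intros) auto
      qed
    next
      have bd: "norm (f n z - pd i F (x(j := z))) \<le> 2 * B / s\<^sup>2 * norm (h n)" if "z \<in> ball 1 r" for n z
      proof -
        have xz: "x(j := z) \<in> polydisc1 k R" using that sub_r by (intro polydisc1_upd[OF xR]) auto
        have "norm ((F (x(j := z, i := c + h n)) - F (x(j := z, i := c))) / h n -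
            deriv (\<lambda>w. F (x(j := z, i := w))) c) \<le> 2 * B / s\<^sup>2 * norm (h n)"
          by (rule derivative_difference_quotient_bound[OF sep_holD[OF F xz i] _ csub _ s(1) h])
            (auto intro!: B polydisc1_upd[OF xz])
        moreover have "pd i F (x(j := z)) = deriv (\<lambda>w. F (x(j := z, i := w))) c"
          using False by (simp add: pd_def c_def)
        ultimately show ?thesis by (simp add: f_def)
      qed
      have lim0: "(\<lambda>n. 2 * B / s\<^sup>2 * norm (h n)) \<longlonglongrightarrow> 0"
      proof -
        have "(\<lambda>n. s * (1 / real (Suc n))) \<longlonglongrightarrow> s * 0"
          using LIMSEQ_inverse_real_of_nat by (intro tendsto_mult_left) (simp add: inverse_eq_divide)
        hence "(\<lambda>n. norm (h n)) \<longlonglongrightarrow> 0" by (simp add: nh)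
        thus ?thesis by (rule tendsto_mult_right_zero)
      qed
      have ul: "uniform_limit (ball 1 r) f (\<lambda>z. pd i F (x(j := z))) sequentially"
      proof (rule uniform_limitI)
        fix e :: real assume "e > 0"
        from order_tendstoD(2)[OF lim0 this]
        show "\<forall>\<^sub>F n in sequentially. \<forall>z\<in>ball 1 r. dist (f n z) (pd i F (x(j := z))) < e"
        proof eventually_elim
          case (elim n)
          show ?case
          proof
            fix z :: complex assume "z \<in> ball 1 r"
            from bd[OF this, of n] elim show "dist (f n z) (pd i F (x(j := z))) < e"
              unfolding dist_norm by linarith
          qed
        qed
      qed
      fix z :: complex assume "z \<in> ball 1 r"
      then obtain d where d: "d > 0" "cball z d \<subseteq> ball 1 r"
        using open_contains_cball[of "ball (1::complex) r"] open_ball by blast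
      thus "\<exists>d>0. cball z d \<subseteq> ball 1 r \<and> uniform_limit (cball z d) f (\<lambda>z. pd i F (x(j := z))) sequentially"
        using uniform_limit_on_subset[OF ul] by blast
    qed simp
  qed
qed

lemma pd_diff:
  assumes "sep_hol k R F" "sep_hol k R G" "x \<in> polydisc1 k R" "i \<in> {1..k}"
  shows "pd i (\<lambda>x. F x - G x) x = pd i F x - pd i G x"
proof -
  have "(\<lambda>z. H (x(i := z))) field_differentiable at (x i)" if "sep_hol k R H" for H
    using sep_holD[OF that assms(3,4)] polydisc1_coord[OF assms(3,4)]
    by (intro holomorphic_on_imp_differentiable_at[where s = "ball 1 R"]) auto
  thus ?thesis unfolding pd_def using assms by (intro deriv_diff) auto
qed

lemma uniform_limit_pd:
  assumes "r < R" and f: "\<forall>\<^sub>F N in sequentially. sep_hol k R (f N)" and g: "sep_hol k R g"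
    and lim: "uniform_limit (polydisc1 k R) f g sequentially" and i: "i \<in> {1..k}"
  shows "uniform_limit (polydisc1 k r) (\<lambda>N. pd i (f N)) (pd i g) sequentially"
proof (rule uniform_limitI)
  fix e :: real assume e: "e > 0"
  define e' where "e' = e * (R - r) / 4"
  have "e' > 0" using e assms(1) by (simp add: e'_def)
  from uniform_limitD[OF lim this] f
  show "\<forall>\<^sub>F N in sequentially. \<forall>x\<in>polydisc1 k r. dist (pd i (f N) x) (pd i g x) < e"
  proof eventually_elim
    case (elim N)
    show ?case
    proof
      fix x assume x: "x \<in> polydisc1 k r"
      have xR: "x \<in> polydisc1 k R" using x polydisc1_mono[of r R k] assms(1) by auto
      have "norm (pd i (\<lambda>x. f N x - g x) x) \<le> 2 * e' / (R - r)"
        using elim(1) by (intro pd_bound[OF sep_hol_diff[OF elim(2) g] _ assms(1) x i])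
          (auto simp: dist_norm intro: less_imp_le)
      also have "\<dots> = e / 2" using assms(1) by (simp add: e'_def field_simps)
      also have "\<dots> < e" using e by simp
      finally show "dist (pd i (f N) x) (pd i g x) < e"
        unfolding dist_norm pd_diff[OF elim(2) g xR i] .
    qed
  qed
qed

lemma uniform_limit_bounded_eventually:
  assumes "uniform_limit S f g sequentially" "\<And>x. x \<in> S \<Longrightarrow> norm (g x) \<le> B"
  shows "\<forall>\<^sub>F N in sequentially. \<forall>x\<in>S. norm (f N x) \<le> B + 1"
proof -
  have "\<forall>\<^sub>F N in sequentially. \<forall>x\<in>S. dist (f N x) (g x) < 1"
    by (rule uniform_limitD[OF assms(1)]) simp
  thus ?thesis
  proof eventually_elim
    case (elim N)
    show ?case
    proof
      fix x assume "x \<in> S"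
      hence "norm (f N x - g x) < 1" "norm (g x) \<le> B" using elim assms(2) by (auto simp: dist_norm)
      thus "norm (f N x) \<le> B + 1" using norm_triangle_sub[of "f N x" "g x"] by linarith
    qed
  qed
qed

text \<open>The lower bound on \<open>g\<close> keeps the quotient \<open>pd 1 f / f\<close> stable
  under uniform limits; the upper bound provides the boundedness that \<open>sep_hol_pd\<close>
  requires, for \<open>g\<close> and eventually for \<open>f N\<close>.\<close>

lemma uniform_limit_log_derivatives:
  assumes R: "0 < R" and f: "\<forall>\<^sub>F N in sequentially. sep_hol k R (f N)" and g: "sep_hol k R g"
    and lim: "uniform_limit (polydisc1 k R) f g sequentially"
    and low: "\<And>x. x \<in> polydisc1 k R \<Longrightarrow> 1 / 2 \<le> norm (g x)"
    and up: "\<And>x. x \<in> polydisc1 k R \<Longrightarrow> norm (g x) \<le> 2"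
    and k: "2 \<le> k"
  shows "\<forall>\<^sub>F N in sequentially. \<forall>x\<in>polydisc1 k R. f N x \<noteq> 0"
    and "uniform_limit (polydisc1 k (R / 4)) (\<lambda>N. logd12 (f N)) (logd12 g) sequentially"
    and "3 \<le> k \<Longrightarrow> uniform_limit (polydisc1 k (R / 4)) (\<lambda>N. logd123 (f N)) (logd123 g) sequentially"
proof -
  \<comment> \<open>The radius shrinks once for each derivative: to \<open>R1\<close> for the first,
    to \<open>R2\<close> for the second, to \<open>R / 4\<close> for the third.\<close>
  define R1 where "R1 = 3 * R / 4"
  define R2 where "R2 = R / 2"
  have RR: "R1 < R" "R2 < R1" "R / 4 < R2" "R2 < R" "R / 4 < R" using R by (auto simp: R1_def R2_def)
  have sub: "polydisc1 k R1 \<subseteq> polydisc1 k R" "polydisc1 k (R / 4) \<subseteq> polydisc1 k R2"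
    using RR by (auto intro!: polydisc1_mono)
  show nz: "\<forall>\<^sub>F N in sequentially. \<forall>x\<in>polydisc1 k R. f N x \<noteq> 0"
    using uniform_limitD[OF lim, of "1 / 2"] low
    by (auto elim!: eventually_mono simp: dist_norm) (metis diff_0 norm_minus_cancel not_le)
  have k1: "1 \<in> {1..k}" "2 \<in> {1..k}" using k by auto
  have bf: "\<forall>\<^sub>F N in sequentially. \<forall>x\<in>polydisc1 k R. norm (f N x) \<le> 2 + 1"
    by (rule uniform_limit_bounded_eventually[OF lim up])
  define q where "q h = (\<lambda>y. pd 1 h y / h y)" for h :: "(nat \<Rightarrow> complex) \<Rightarrow> complex"
  have pg: "norm (pd 1 g x) \<le> 2 * 2 / (R - R1)" if "x \<in> polydisc1 k R1" for x
    by (rule pd_bound[OF g up RR(1) that k1(1)])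
  have q_hol: "sep_hol k R1 (q h)" if "sep_hol k R h" "\<And>x. x \<in> polydisc1 k R \<Longrightarrow> norm (h x) \<le> B"
    "\<And>x. x \<in> polydisc1 k R \<Longrightarrow> h x \<noteq> 0" for h B
    unfolding q_def using that sub RR
    by (intro sep_hol_divide sep_hol_pd[OF that(1,2) RR(1) k1(1)] sep_hol_subset[OF that(1)]) auto
  have g0: "g x \<noteq> 0" if "x \<in> polydisc1 k R" for x using low[OF that] by auto
  have qg: "sep_hol k R1 (q g)" by (rule q_hol[OF g up g0])
  have qf: "\<forall>\<^sub>F N in sequentially. sep_hol k R1 (q (f N))"
    using f bf nz by eventually_elim (rule q_hol[where B = "2 + 1"], auto)
  have q_lim: "uniform_limit (polydisc1 k R1) (\<lambda>N. q (f N)) (q g) sequentially"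
    unfolding q_def
  proof (rule uniform_lim_divide[where b = "1 / 2"])
    show "uniform_limit (polydisc1 k R1) (\<lambda>N. pd 1 (f N)) (pd 1 g) sequentially"
      by (rule uniform_limit_pd[OF RR(1) f g lim k1(1)])
    show "uniform_limit (polydisc1 k R1) f g sequentially"
      by (rule uniform_limit_on_subset[OF lim sub(1)])
    show "bounded (pd 1 g ` polydisc1 k R1)" using pg by (auto simp: bounded_iff)
  qed (use low sub in auto)
  have q_bound: "norm (q g x) \<le> (2 * 2 / (R - R1)) / (1 / 2)" if "x \<in> polydisc1 k R1" for x
    unfolding q_def norm_divide using pg[OF that] low[of x] that sub RR R by (intro frac_le) auto
  have bq: "\<forall>\<^sub>F N in sequentially. \<forall>x\<in>polydisc1 k R1. norm (q (f N) x) \<le> (2 * 2 / (R - R1)) / (1 / 2) + 1"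
    by (rule uniform_limit_bounded_eventually[OF q_lim]) (rule q_bound)
  have l_eq: "logd12 h = pd 2 (q h)" for h by (simp add: logd12_def q_def)
  have lim2: "uniform_limit (polydisc1 k R2) (\<lambda>N. logd12 (f N)) (logd12 g) sequentially"
    unfolding l_eq by (rule uniform_limit_pd[OF RR(2) qf qg q_lim k1(2)])
  thus "uniform_limit (polydisc1 k (R / 4)) (\<lambda>N. logd12 (f N)) (logd12 g) sequentially"
    by (rule uniform_limit_on_subset[OF _ sub(2)])
  assume "3 \<le> k"
  hence k3: "3 \<in> {1..k}" by simp
  have lg: "sep_hol k R2 (logd12 g)"
    unfolding l_eq by (rule sep_hol_pd[OF qg q_bound RR(2) k1(2)])
  have lf: "\<forall>\<^sub>F N in sequentially. sep_hol k R2 (logd12 (f N))"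
    using qf bq
  proof eventually_elim
    case (elim N)
    show ?case unfolding l_eq by (rule sep_hol_pd[OF elim(1) _ RR(2) k1(2)]) (use elim(2) in blast)
  qed
  show "uniform_limit (polydisc1 k (R / 4)) (\<lambda>N. logd123 (f N)) (logd123 g) sequentially"
    unfolding logd123_def by (rule uniform_limit_pd[OF RR(3) lf lg lim2 k3])
qed

text \<open>Both functions have the same candidates for a derivative, so \<open>deriv\<close>
  selects the same value whether or not one exists.\<close>

lemma deriv_add_const: "deriv (\<lambda>z. f z + c) x = deriv f x" for f :: "complex \<Rightarrow> complex"
proof -
  have "((\<lambda>z. f z + c) has_field_derivative D) (at x) \<longleftrightarrow> (f has_field_derivative D) (at x)" for D
  proof
    assume "((\<lambda>z. f z + c) has_field_derivative D) (at x)"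
    from DERIV_diff[OF this DERIV_const[of c]] show "(f has_field_derivative D) (at x)" by simp
  next
    assume "(f has_field_derivative D) (at x)"
    from DERIV_add[OF this DERIV_const[of c]] show "((\<lambda>z. f z + c) has_field_derivative D) (at x)" by simp
  qed
  thus ?thesis by (simp add: deriv_def)
qed

lemma eventually_in_ball: "x \<in> ball c R \<Longrightarrow> \<forall>\<^sub>F z in nhds x. z \<in> ball (c :: complex) R"
  by (rule eventually_nhds_in_open) auto

lemma pd_cong:
  assumes "\<And>y. y \<in> polydisc1 k R \<Longrightarrow> F y = G y" "x \<in> polydisc1 k R" "i \<in> {1..k}"
  shows "pd i F x = pd i G x"
  unfolding pd_def
  by (rule deriv_cong_ev[OF eventually_mono[OF eventually_in_ball[OF polydisc1_coord[OF assms(2,3)]]]])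
    (auto intro!: assms(1) polydisc1_upd[OF assms(2)])

text \<open>In \<open>pd 1 f / f\<close> the factor \<open>u\<close>, constant in the first
  variable, cancels, while \<open>v\<close> leaves the summand \<open>pd 1 v / v\<close>, constant
  in the second variable and killed by \<open>pd 2\<close>.\<close>

lemma logd12_mult_separated:
  assumes g: "sep_hol k R g" and v: "sep_hol k R v"
    and eq: "\<And>x. x \<in> polydisc1 k R \<Longrightarrow> f x = g x * u x * v x"
    and nz: "\<And>x. x \<in> polydisc1 k R \<Longrightarrow> g x \<noteq> 0" "\<And>x. x \<in> polydisc1 k R \<Longrightarrow> u x \<noteq> 0"
      "\<And>x. x \<in> polydisc1 k R \<Longrightarrow> v x \<noteq> 0"
    and ind1: "\<And>x z. u (x(1 := z)) = u x" and ind2: "\<And>x z. v (x(2 := z)) = v x"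
    and k: "2 \<le> k" and x: "x \<in> polydisc1 k R"
  shows "logd12 f x = logd12 g x"
proof -
  have k1: "1 \<in> {1..k}" "2 \<in> {1..k}" using k by auto
  have *: "pd 1 f y / f y = pd 1 g y / g y + pd 1 v y / v y" if y: "y \<in> polydisc1 k R" for y
  proof -
    have diff: "(\<lambda>z. H (y(1 := z))) field_differentiable at (y 1)" if "sep_hol k R H" for H
      using sep_holD[OF that y k1(1)] polydisc1_coord[OF y k1(1)]
      by (intro holomorphic_on_imp_differentiable_at[where s = "ball 1 R"]) auto
    have "pd 1 f y = pd 1 (\<lambda>y. g y * u y * v y) y"
      by (rule pd_cong[OF eq y k1(1)])
    also have "\<dots> = deriv (\<lambda>z. u y * (g (y(1 := z)) * v (y(1 := z)))) (y 1)"
      by (simp add: pd_def ind1[unfolded One_nat_def] mult_ac)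
    also have "\<dots> = u y * deriv (\<lambda>z. g (y(1 := z)) * v (y(1 := z))) (y 1)"
      using diff[OF g] diff[OF v] by (intro deriv_cmult field_differentiable_mult)
    also have "deriv (\<lambda>z. g (y(1 := z)) * v (y(1 := z))) (y 1) = g y * pd 1 v y + pd 1 g y * v y"
      using diff[OF g] diff[OF v] by (subst deriv_mult) (auto simp: pd_def)
    finally show ?thesis using nz[OF y] eq[OF y] by (simp add: field_simps)
  qed
  have ind: "pd 1 v (x(2 := z)) = pd 1 v x" for z
  proof -
    have "x(2 := z, 1 := w) = x(1 := w, 2 := z)" for w by (simp add: fun_upd_twist)
    thus ?thesis by (simp add: pd_def ind2)
  qed
  have "logd12 f x = pd 2 (\<lambda>y. pd 1 g y / g y + pd 1 v y / v y) x"
    unfolding logd12_def by (rule pd_cong[OF * x k1(2)])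
  also have "\<dots> = deriv (\<lambda>z. pd 1 g (x(2 := z)) / g (x(2 := z)) + pd 1 v x / v x) (x 2)"
    unfolding pd_def[of 2] ind ind2 ..
  also have "\<dots> = logd12 g x"
    unfolding deriv_add_const by (simp add: logd12_def pd_def[of 2])
  finally show ?thesis .
qed

section \<open>The function H' and the limiting two-variable factor\<close>

lemma holomorphic_divided_difference:
  assumes "\<phi> holomorphic_on ball 1 r"
  shows "(\<lambda>z. if z = b then deriv \<phi> z else (\<phi> z - \<phi> b) / (z - b)) holomorphic_on ball 1 r"
proof -
  have "(\<lambda>z. if z = b then deriv \<phi> b else (\<phi> z - \<phi> b) / (z - b)) holomorphic_on ball 1 r"
    by (rule pole_lemma_open[OF assms]) simp
  moreover have "(\<lambda>z. if z = b then deriv \<phi> b else (\<phi> z - \<phi> b) / (z - b)) =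
      (\<lambda>z. if z = b then deriv \<phi> z else (\<phi> z - \<phi> b) / (z - b))" by auto
  ultimately show ?thesis by simp
qed

definition ell :: "real measure \<Rightarrow> complex \<Rightarrow> complex \<Rightarrow> complex" where
  "ell m a b = 1 - (a - 1) * (b - 1) * divdiff_H m a b"

lemma limit_fn_eq_ell: "limit_fn m x = ell m (x 1) (x 2)"
  by (simp add: limit_fn_def ell_def)

lemma divdiff_H_commute: "divdiff_H m a b = divdiff_H m b a"
proof (cases "a = b")
  case False
  hence "(a * Hprime m a - b * Hprime m b) / (a - b) = (b * Hprime m b - a * Hprime m a) / (b - a)"
    by (metis minus_diff_eq minus_divide_divide)
  thus ?thesis using False by (simp add: divdiff_H_def)
qed simp

lemma ell_commute: "ell m a b = ell m b a"
  by (simp add: ell_def divdiff_H_commute mult_ac)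

lemma ell_holomorphic:
  assumes "Hprime m holomorphic_on ball 1 r"
  shows "(\<lambda>a. ell m a b) holomorphic_on ball 1 r"
proof -
  have "(\<lambda>z. z * Hprime m z) holomorphic_on ball 1 r" using assms by (intro holomorphic_intros)
  from holomorphic_divided_difference[OF this, of b]
  have "(\<lambda>a. divdiff_H m a b) holomorphic_on ball 1 r" by (simp add: divdiff_H_def cong: if_cong)
  thus ?thesis unfolding ell_def by (intro holomorphic_intros)
qed

text \<open>The divided difference is bounded by the supremum of the derivative. The estimate later
  provides a polydisc on which no factor \<open>ell\<close> vanishes.\<close>

lemma ell_near_1:
  assumes hol: "Hprime m holomorphic_on ball 1 r" and r: "r > 0"
  obtains M where "M \<ge> 0" "\<And>a b. a \<in> ball 1 (r / 2) \<Longrightarrow> b \<in> ball 1 (r / 2) \<Longrightarrow>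
    norm (ell m a b - 1) \<le> norm (a - 1) * norm (b - 1) * M"
proof -
  define \<phi> where "\<phi> z = z * Hprime m z" for z
  have hol\<phi>: "\<phi> holomorphic_on ball 1 r" unfolding \<phi>_def using hol by (intro holomorphic_intros)
  have sub: "cball 1 (r / 2) \<subseteq> (ball 1 r :: complex set)" using r by auto
  have "continuous_on (cball 1 (r / 2)) (deriv \<phi>)"
    using sub by (intro holomorphic_on_imp_continuous_on holomorphic_on_subset[OF holomorphic_deriv[OF hol\<phi>]]) auto
  hence "bounded (deriv \<phi> ` cball 1 (r / 2))"
    by (intro compact_imp_bounded compact_continuous_image) auto
  then obtain M where "\<forall>y\<in>deriv \<phi> ` cball 1 (r / 2). norm y \<le> M"
    unfolding bounded_iff by blast
  hence M: "norm (deriv \<phi> z) \<le> M" if "z \<in> cball 1 (r / 2)" for z using that by blast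
  have M0: "M \<ge> 0" using M[of 1] r norm_ge_zero[of "deriv \<phi> 1"] by (simp del: norm_ge_zero)
  have dd: "norm (divdiff_H m a b) \<le> M" if "a \<in> ball 1 (r / 2)" "b \<in> ball 1 (r / 2)" for a b
  proof (cases "a = b")
    case True
    have "a \<in> cball 1 (r / 2)" using that by simp
    from M[OF this] show ?thesis using True by (simp add: divdiff_H_def \<phi>_def[abs_def])
  next
    case False
    have "norm (\<phi> a - \<phi> b) \<le> M * norm (a - b)"
    proof (rule field_differentiable_bound[where S = "cball 1 (r / 2)" and f' = "deriv \<phi>"])
      show "(\<phi> has_field_derivative deriv \<phi> z) (at z within cball 1 (r / 2))" if "z \<in> cball 1 (r / 2)" for z
        using that sub by (intro holomorphic_derivI[OF hol\<phi>]) auto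
    qed (use that M in auto)
    thus ?thesis using False by (simp add: divdiff_H_def \<phi>_def norm_divide pos_divide_le_eq)
  qed
  show ?thesis
  proof (rule that[OF M0])
    fix a b :: complex assume ab: "a \<in> ball 1 (r / 2)" "b \<in> ball 1 (r / 2)"
    have "norm (ell m a b - 1) = norm (a - 1) * norm (b - 1) * norm (divdiff_H m a b)"
      by (simp add: ell_def norm_mult)
    also have "\<dots> \<le> norm (a - 1) * norm (b - 1) * M"
      using dd[OF ab] by (intro mult_left_mono) auto
    finally show "norm (ell m a b - 1) \<le> norm (a - 1) * norm (b - 1) * M" .
  qed
qed

lemma Ln_ball:
  assumes "\<delta> > 0"
  obtains r where "0 < r" "r \<le> 1 / 2" "\<And>z. z \<in> ball 1 r \<Longrightarrow> Ln z \<in> ball 0 \<delta>"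
proof -
  have "isCont Ln 1" by (rule continuous_at_Ln) simp
  hence "\<exists>d>0. \<forall>x. dist x 1 < d \<longrightarrow> dist (Ln x) (Ln 1) < \<delta>"
    using assms unfolding continuous_at_eps_delta by blast
  then obtain d where d: "d > 0" "\<And>x. dist x 1 < d \<Longrightarrow> dist (Ln x) (Ln 1) < \<delta>" by blast
  show ?thesis
    by (rule that[of "min d (1 / 2)"]) (use d in \<open>auto simp: dist_commute\<close>)
qed

lemma near_1_props:
  assumes "z \<in> ball 1 r" "r \<le> 1 / 2"
  shows "z \<noteq> 0" "z \<notin> \<real>\<^sub>\<le>\<^sub>0" "z \<noteq> 1 \<Longrightarrow> Ln z \<noteq> 0" "exp (Ln z) = z"
proof -
  have "norm (1 - z) < 1 / 2" using assms by (auto simp: dist_norm)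
  hence "Re (1 - z) < 1 / 2" using complex_Re_le_cmod[of "1 - z"] by linarith
  hence re: "Re z > 0" by simp
  thus z0: "z \<noteq> 0" by auto
  show "z \<notin> \<real>\<^sub>\<le>\<^sub>0" using re by (meson complex_nonpos_Reals_iff not_less)
  show "exp (Ln z) = z" using z0 by simp
  thus "Ln z \<noteq> 0" if "z \<noteq> 1" using that by auto
qed

text \<open>\<open>Hprime\<close> is a choice, so two things are needed. A witness exists:
  \<open>G w = inverse (Y w)\<close>, with a removable singularity of \<open>h\<close> at 1. And any
  chosen \<open>h\<close>, with its own radii and its own branch \<open>G\<close>, has this form
  near 1, since a branch that tends to infinity eventually lies where the solution of
  \<open>moment_series \<mu> y = u\<close> is unique.\<close>

lemma Hprime_near_1:
  assumes mb: "moment_bound A \<mu>"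
    and ct: "\<And>z. norm z > A \<Longrightarrow> cauchy_tr m z = moment_series \<mu> (1 / z)"
  obtains r where "0 < r" "r \<le> 1 / 2" "Hprime m holomorphic_on ball 1 r"
    "\<And>z. z \<in> ball 1 r \<Longrightarrow> Ln z \<in> ball 0 (1 / (32 * A))"
    "\<And>z. z \<in> ball 1 r \<Longrightarrow> z \<noteq> 1 \<Longrightarrow> z * Hprime m z = 1 / moment_inverse A \<mu> (Ln z) - z / (z - 1)"
proof -
  define Y where "Y = moment_inverse A \<mu>"
  define \<delta> where "\<delta> = 1 / (32 * A)"
  have A: "A > 0" by (rule moment_boundD(1)[OF mb])
  have \<delta>: "\<delta> > 0" using A by (simp add: \<delta>_def)
  note Y = moment_inverse[OF mb, folded Y_def \<delta>_def]
  define Q where "Q h r s G \<longleftrightarrow> filterlim G at_infinity (at 0) \<and>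
      (\<forall>w\<in>ball 0 s - {0}. cauchy_tr m (G w) = w) \<and> h holomorphic_on ball 1 r \<and>
      (\<forall>z\<in>ball 1 r - {1}. Ln z \<in> ball 0 s \<and> h z = G (Ln z) / z - 1 / (z - 1))"
    for h :: "complex \<Rightarrow> complex" and r s :: real and G :: "complex \<Rightarrow> complex"
  have Hprime_eq: "Hprime m = (SOME h. \<exists>r>0. \<exists>s>0. \<exists>G. Q h r s G)"
    by (simp add: Hprime_def Q_def)
  have "\<exists>h. \<exists>r>0. \<exists>s>0. \<exists>G. Q h r s G"
  proof -
    obtain r where r: "0 < r" "r \<le> 1 / 2" "\<And>z. z \<in> ball 1 r \<Longrightarrow> Ln z \<in> ball 0 \<delta>"
      using Ln_ball[OF \<delta>] by blast
    define G where "G w = inverse (Y w)" for w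
    have ev_\<delta>: "\<forall>\<^sub>F w in at 0. norm w \<le> \<delta> \<and> w \<noteq> (0::complex)"
      unfolding eventually_at using \<delta> by (intro exI[of _ \<delta>]) auto
    have Y_lim: "(Y \<longlongrightarrow> 0) (at 0)"
    proof (rule tendsto_0_le[where K = 2])
      show "((\<lambda>w. w) \<longlongrightarrow> 0) (at (0::complex))" by (rule tendsto_ident_at)
      show "\<forall>\<^sub>F w in at 0. norm (Y w) \<le> norm w * 2"
        using ev_\<delta> by eventually_elim (use Y(3) in \<open>simp add: mult.commute\<close>)
    qed
    have Y_filter: "filterlim Y (at 0) (at 0)"
      unfolding filterlim_at using Y_lim ev_\<delta> Y(4) by (auto elim: eventually_mono)
    have G_lim: "filterlim G at_infinity (at 0)"
      unfolding G_def by (rule filterlim_compose[OF filterlim_inverse_at_infinity Y_filter])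
    have G_ct: "cauchy_tr m (G w) = w" if "w \<in> ball 0 \<delta> - {0}" for w
    proof -
      have w: "norm w \<le> \<delta>" "w \<noteq> 0" using that by auto
      have Y0: "Y w \<noteq> 0" by (rule Y(4)[OF w])
      have "norm (Y w) < 1 / A"
      proof -
        have "norm (Y w) \<le> 1 / (16 * A)" by (rule Y(1)[OF w(1)])
        also have "\<dots> < 1 / A" using A by (simp add: field_simps)
        finally show ?thesis .
      qed
      hence "norm (G w) > A" using A Y0 unfolding G_def norm_inverse
        by (simp add: field_simps)
      hence "cauchy_tr m (G w) = moment_series \<mu> (1 / G w)" by (rule ct)
      also have "\<dots> = w" using Y(2)[OF w(1)] by (simp add: G_def divide_inverse)
      finally show ?thesis .
    qed
    define f where "f z = G (Ln z) / z - 1 / (z - 1)" for z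
    \<comment> \<open>Riemann's criterion: \<open>(z - 1) * f z\<close> tends to 0, because
      \<open>(z - 1) / Ln z\<close> and \<open>w / Y w\<close> both tend to 1.\<close>
    have "\<exists>g. g holomorphic_on ball 1 r \<and> (\<forall>z \<in> ball 1 r - {1}. g z = f z)"
    proof (subst holomorphic_on_extend_lim)
      have "Y holomorphic_on ball 0 \<delta>"
        unfolding Y_def \<delta>_def by (rule moment_inverse_holomorphic[OF mb])
      hence "Y \<circ> Ln holomorphic_on ball 1 r - {1}"
        by (rule holomorphic_on_compose_gen[rotated])
          (use r near_1_props(2)[OF _ r(2)] in \<open>auto intro!: holomorphic_intros\<close>)
      hence YL: "(\<lambda>z. Y (Ln z)) holomorphic_on ball 1 r - {1}" by (simp add: o_def)
      have "Y (Ln z) \<noteq> 0" if "z \<in> ball 1 r - {1}" for z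
        using r(3)[of z] near_1_props(3)[of z r] that r(2) by (intro Y(4)) auto
      thus "f holomorphic_on ball 1 r - {1}"
        unfolding f_def G_def using YL near_1_props(1)[OF _ r(2)] by (intro holomorphic_intros) auto
      show "((\<lambda>z. (z - 1) * f z) \<longlongrightarrow> 0) (at 1)"
      proof -
        have Ln_filter: "filterlim Ln (at 0) (at (1::complex))"
          unfolding filterlim_at
        proof
          have "isCont Ln (1::complex)" by (rule continuous_at_Ln) simp
          thus "(Ln \<longlongrightarrow> 0) (at (1::complex))" by (simp add: isCont_def)
          show "\<forall>\<^sub>F z in at 1. Ln z \<in> UNIV \<and> Ln z \<noteq> (0::complex)"
            unfolding eventually_at using r(1) near_1_props(3)[OF _ r(2)]
            by (intro exI[of _ r]) (auto simp: dist_commute)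
        qed
        have w_lim: "((\<lambda>w. w / Y w) \<longlongrightarrow> 1) (at 0)"
        proof (rule LIM_zero_cancel, rule tendsto_0_le[where K = "4 * A"])
          show "((\<lambda>w. w) \<longlongrightarrow> 0) (at (0::complex))" by (rule tendsto_ident_at)
          show "\<forall>\<^sub>F w in at 0. norm (w / Y w - 1) \<le> norm w * (4 * A)"
            using ev_\<delta>
          proof eventually_elim
            case (elim w)
            from moment_inverse_ratio[OF mb, of w] elim show ?case
              by (simp add: Y_def \<delta>_def mult_ac)
          qed
        qed
        have L_lim: "((\<lambda>z. (z - 1) / Ln z) \<longlongrightarrow> 1) (at 1)"
        proof -
          have "(Ln has_field_derivative inverse 1) (at (1::complex))" by (rule has_field_derivative_Ln) simp
          hence "((\<lambda>z. (Ln z - Ln 1) / (z - 1)) \<longlongrightarrow> 1) (at (1::complex))"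
            by (simp add: has_field_derivative_iff)
          hence "((\<lambda>z. inverse (Ln z / (z - 1))) \<longlongrightarrow> inverse 1) (at (1::complex))"
            by (intro tendsto_inverse) auto
          thus ?thesis by (simp add: inverse_eq_divide)
        qed
        have "((\<lambda>z. ((z - 1) / Ln z) * (Ln z / Y (Ln z)) / z - 1) \<longlongrightarrow> 1 * 1 / 1 - 1) (at 1)"
          by (intro tendsto_intros L_lim filterlim_compose[OF w_lim Ln_filter]) auto
        hence lim: "((\<lambda>z. ((z - 1) / Ln z) * (Ln z / Y (Ln z)) / z - 1) \<longlongrightarrow> 0) (at 1)" by simp
        show ?thesis
        proof (rule Lim_transform_eventually[OF lim])
          show "\<forall>\<^sub>F z in at 1. ((z - 1) / Ln z) * (Ln z / Y (Ln z)) / z - 1 = (z - 1) * f z"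
            unfolding eventually_at
          proof (intro exI[of _ r] conjI ballI impI)
            fix z :: complex assume z: "z \<noteq> 1 \<and> dist z 1 < r"
            hence "Ln z \<noteq> 0" using near_1_props(3)[of z r] r(2) by (simp add: dist_commute)
            hence "((z - 1) / Ln z) * (Ln z / Y (Ln z)) = (z - 1) * inverse (Y (Ln z))"
              by (simp add: divide_inverse)
            moreover have "z - 1 \<noteq> 0" using z by simp
            ultimately show "((z - 1) / Ln z) * (Ln z / Y (Ln z)) / z - 1 = (z - 1) * f z"
              unfolding f_def G_def right_diff_distrib by simp
          qed (rule r)
        qed
      qed
    qed (use r in auto)
    then obtain g where g: "g holomorphic_on ball 1 r" "\<forall>z \<in> ball 1 r - {1}. g z = f z" by blast
    have "Q g r \<delta> G"
      unfolding Q_def using G_lim G_ct g r(3) by (auto simp: f_def)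
    thus ?thesis using r \<delta> by blast
  qed
  \<comment> \<open>From here on \<open>r\<close>, \<open>s\<close> and \<open>G\<close> belong to
    the chosen function. The bound \<open>16 * A\<close> on \<open>G\<close> places
    \<open>1 / G\<close> in the disc in which \<open>moment_inverse\<close> is unique.\<close>
  from someI_ex[OF this, folded Hprime_eq]
  obtain r s G where rs: "0 < r" "0 < s" and Q: "Q (Hprime m) r s G" by blast
  have "\<forall>\<^sub>F w in at 0. 16 * A \<le> norm (G w)"
    using Q A unfolding Q_def filterlim_at_infinity[OF order_refl] by auto
  then obtain s' where s': "s' > 0" "\<And>w. w \<noteq> 0 \<Longrightarrow> dist w 0 < s' \<Longrightarrow> 16 * A \<le> norm (G w)"
    unfolding eventually_at by auto
  define t where "t = min (min s s') \<delta>"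
  have t: "t > 0" "t \<le> s" "t \<le> s'" "t \<le> \<delta>" using rs s' \<delta> by (auto simp: t_def)
  obtain r' where r': "0 < r'" "r' \<le> 1 / 2" "\<And>z. z \<in> ball 1 r' \<Longrightarrow> Ln z \<in> ball 0 t"
    using Ln_ball[OF t(1)] by blast
  show ?thesis
  proof (rule that[of "min r r'"])
    show "0 < min r r'" "min r r' \<le> 1 / 2" using rs r' by auto
    have "Hprime m holomorphic_on ball 1 r" using Q by (simp add: Q_def)
    thus "Hprime m holomorphic_on ball 1 (min r r')" by (rule holomorphic_on_subset) auto
    fix z :: complex assume z: "z \<in> ball 1 (min r r')"
    have Lz: "Ln z \<in> ball 0 t" using z by (intro r'(3)) auto
    thus "Ln z \<in> ball 0 (1 / (32 * A))" using t by (simp add: \<delta>_def[symmetric])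
    assume z1: "z \<noteq> 1"
    have zr': "z \<in> ball 1 r'" using z by auto
    have z0: "z \<noteq> 0" by (rule near_1_props(1)[OF zr' r'(2)])
    have L0: "Ln z \<noteq> 0" by (rule near_1_props(3)[OF zr' r'(2) z1])
    have h: "Hprime m z = G (Ln z) / z - 1 / (z - 1)"
      using Q z z1 by (auto simp: Q_def)
    have G16: "16 * A \<le> norm (G (Ln z))" using Lz t L0 by (intro s'(2)) auto
    hence Gpos: "norm (G (Ln z)) > 0" using A by linarith
    have Gct: "cauchy_tr m (G (Ln z)) = Ln z" using Q Lz t L0 by (auto simp: Q_def)
    have "moment_inverse A \<mu> (Ln z) = 1 / G (Ln z)"
    proof (rule moment_inverse_unique[OF mb])
      have "norm (G (Ln z)) > A" using G16 A by linarith
      from ct[OF this] Gct show "moment_series \<mu> (1 / G (Ln z)) = Ln z" by simp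
      have "1 / norm (G (Ln z)) \<le> 1 / (16 * A)" using G16 A Gpos by (intro divide_left_mono mult_pos_pos) auto
      thus "norm (1 / G (Ln z)) \<le> 1 / (16 * A)" by (simp add: norm_divide)
    qed
    thus "z * Hprime m z = 1 / moment_inverse A \<mu> (Ln z) - z / (z - 1)"
      unfolding h using z0 by (simp add: right_diff_distrib)
  qed
qed

text \<open>The poles contribute
  \<open>a / (a - 1) - b / (b - 1) = (b - a) / ((a - 1) * (b - 1))\<close> to the difference, and
  this cancels the leading 1 of \<open>ell\<close>. What remains is a ratio of differences, the form
  in which a Vandermonde determinant produces it.\<close>

lemma ell_off_diagonal:
  assumes "a * Hprime m a = g a - a / (a - 1)" "b * Hprime m b = g b - b / (b - 1)"
    and "a \<noteq> 1" "b \<noteq> 1" "a \<noteq> b"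
  shows "ell m a b = (a - 1) * (b - 1) * (g b - g a) / (a - b)"
proof -
  have nz: "a - 1 \<noteq> 0" "b - 1 \<noteq> 0" "a - b \<noteq> 0" using assms by auto
  have "a / (a - 1) - b / (b - 1) = (b - a) / ((a - 1) * (b - 1))"
    using nz(1,2) by (simp add: diff_frac_eq) (simp add: algebra_simps)
  hence "a * Hprime m a - b * Hprime m b = (g a - g b) - (b - a) / ((a - 1) * (b - 1))"
    unfolding assms(1,2) by (simp add: algebra_simps)
  hence "ell m a b = 1 - (a - 1) * (b - 1) * (((g a - g b) - (b - a) / ((a - 1) * (b - 1))) / (a - b))"
    using assms(5) by (simp add: ell_def divdiff_H_def)
  also have "\<dots> = 1 - ((a - 1) * (b - 1) * (g a - g b) - (b - a)) / (a - b)"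
  proof -
    have *: "P * ((X - D / P) / E) = (P * X - D) / E" if "P \<noteq> 0" for P X D E :: complex
      using that by (simp add: right_diff_distrib)
    have "(a - 1) * (b - 1) \<noteq> 0" using nz(1,2) by simp
    from *[OF this] show ?thesis by (simp only:)
  qed
  also have "\<dots> = (a - 1) * (b - 1) * (g b - g a) / (a - b)"
    using nz(3) by (simp add: field_simps)
  finally show ?thesis .
qed

section \<open>Moments of the empirical measures\<close>

text \<open>One-sided limits bound \<open>f\<close> in a punctured neighbourhood of every point, and
  a convergent subsequence of points with unbounded values contradicts this. The value at the limit
  point itself is unrelated to the one-sided limits, hence
  \<open>max B \<bar>f l\<bar>\<close>.\<close>

lemma piecewise_continuous01_bounded:
  assumes "piecewise_continuous01 f"
  shows "\<exists>M. \<forall>x\<in>{0..1}. \<bar>f x\<bar> \<le> M"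
proof (rule ccontr)
  assume unb: "\<not> ?thesis"
  have lim_bd: "\<exists>B. \<forall>\<^sub>F y in F. \<bar>f y\<bar> \<le> B" if "(f \<longlongrightarrow> l) F" for l F
  proof -
    have "\<forall>\<^sub>F y in F. dist (f y) l < 1" using that by (rule tendstoD) simp
    hence "\<forall>\<^sub>F y in F. \<bar>f y\<bar> \<le> \<bar>l\<bar> + 1"
      by (rule eventually_mono) (auto simp: dist_real_def)
    thus ?thesis by blast
  qed
  obtain S where S: "\<And>x. x \<in> {0..1} - S \<Longrightarrow> continuous (at x within {0..1}) f"
    "\<And>x. x \<in> S \<inter> {0<..1} \<Longrightarrow> \<exists>l. (f \<longlongrightarrow> l) (at_left x)"
    "\<And>x. x \<in> S \<inter> {0..<1} \<Longrightarrow> \<exists>l. (f \<longlongrightarrow> l) (at_right x)"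
    using assms unfolding piecewise_continuous01_def by blast
  have local: "\<exists>B. \<forall>\<^sub>F y in at x within {0..1}. \<bar>f y\<bar> \<le> B" if x: "x \<in> {0..1}" for x
  proof (cases "x \<in> S")
    case False
    hence "(f \<longlongrightarrow> f x) (at x within {0..1})" using S(1)[of x] x by (simp add: continuous_within)
    thus ?thesis by (rule lim_bd)
  next
    case True
    have left: "\<exists>B. \<forall>\<^sub>F y in at_left x. \<bar>f y\<bar> \<le> B" if "x \<noteq> 0"
    proof -
      have "x \<in> S \<inter> {0<..1}" using True x that by simp
      from S(2)[OF this] show ?thesis using lim_bd by blast
    qed
    have right: "\<exists>B. \<forall>\<^sub>F y in at_right x. \<bar>f y\<bar> \<le> B" if "x \<noteq> 1"
    proof -
      have "x \<in> S \<inter> {0..<1}" using True x that by simp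
      from S(3)[OF this] show ?thesis using lim_bd by blast
    qed
    consider "x = 0" | "x = 1" | "0 < x" "x < 1" using x by force
    thus ?thesis
    proof cases
      case 1
      thus ?thesis using right by (simp add: at_within_Icc_at_right)
    next
      case 2
      thus ?thesis using left by (simp add: at_within_Icc_at_left)
    next
      case 3
      obtain B B' where "\<forall>\<^sub>F y in at_left x. \<bar>f y\<bar> \<le> B" "\<forall>\<^sub>F y in at_right x. \<bar>f y\<bar> \<le> B'"
        using left right 3 by auto
      hence "\<forall>\<^sub>F y in at_left x. \<bar>f y\<bar> \<le> max B B'" "\<forall>\<^sub>F y in at_right x. \<bar>f y\<bar> \<le> max B B'"
        by (auto elim!: eventually_mono)
      hence "\<forall>\<^sub>F y in at x. \<bar>f y\<bar> \<le> max B B'" by (simp add: eventually_at_split)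
      thus ?thesis using 3 by (auto simp: at_within_Icc_at)
    qed
  qed
  have "\<exists>x\<in>{0..1}. \<bar>f x\<bar> > real n" for n using unb by (meson not_le)
  then obtain X where X: "\<And>n. X n \<in> {0..1}" "\<And>n. \<bar>f (X n)\<bar> > real n" by metis
  have "compact {0..1::real}" by simp
  then obtain l r where l: "l \<in> {0..1}" "strict_mono r" "(X \<circ> r) \<longlonglongrightarrow> l"
    using X(1) unfolding compact_def by meson
  obtain B where "\<forall>\<^sub>F y in at l within {0..1}. \<bar>f y\<bar> \<le> B" using local[OF l(1)] by blast
  then obtain d where d: "d > 0" "\<And>y. y \<in> {0..1} \<Longrightarrow> y \<noteq> l \<Longrightarrow> dist y l < d \<Longrightarrow> \<bar>f y\<bar> \<le> B"
    unfolding eventually_at by auto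
  have "\<forall>\<^sub>F n in sequentially. dist (X (r n)) l < d"
    using tendstoD[OF l(3) d(1)] by simp
  moreover have "\<forall>\<^sub>F n in sequentially. max B \<bar>f l\<bar> \<le> real n"
    by (rule eventually_ge_at_top[THEN filterlim_real_sequentially[unfolded filterlim_iff, rule_format]])
  ultimately have "\<forall>\<^sub>F n in sequentially. False"
  proof eventually_elim
    case (elim n)
    have "\<bar>f (X (r n))\<bar> \<le> max B \<bar>f l\<bar>"
      using d(2)[of "X (r n)"] X(1)[of "r n"] elim(1) by (cases "X (r n) = l") auto
    moreover have "n \<le> r n" by (rule seq_suble[OF l(2)])
    moreover have "\<bar>f (X (r n))\<bar> > real (r n)" by (rule X(2))
    ultimately show False using elim(2) by linarith
  qed
  thus False by simp
qed

lemma regular_lcoord_bound: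
  assumes "regular_seq lam"
  shows "\<exists>A\<ge>1. \<forall>N j. j < N \<longrightarrow> \<bar>real_of_int (lcoord N (lam N) j)\<bar> \<le> A * real N"
proof -
  obtain f C where f: "piecewise_continuous01 f"
    and C: "\<And>N j. 1 \<le> j \<Longrightarrow> j \<le> N \<Longrightarrow> \<bar>real_of_int (lam N j) / real N - f (real j / real N)\<bar> < C"
    using assms unfolding regular_seq_def by blast
  obtain M where M: "\<And>x. x \<in> {0..1} \<Longrightarrow> \<bar>f x\<bar> \<le> M" using piecewise_continuous01_bounded[OF f] by blast
  show ?thesis
  proof (intro exI[of _ "\<bar>C\<bar> + \<bar>M\<bar> + 1"] conjI allI impI)
    fix N j :: nat assume j: "j < N"
    have N: "real N > 0" using j by simp
    have "\<bar>real_of_int (lam N (Suc j)) / real N - f (real (Suc j) / real N)\<bar> < C" using j by (intro C) auto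
    moreover have "\<bar>f (real (Suc j) / real N)\<bar> \<le> M" using j by (intro M) (auto simp: field_simps)
    ultimately have "\<bar>real_of_int (lam N (Suc j)) / real N\<bar> \<le> \<bar>C\<bar> + \<bar>M\<bar>" by linarith
    hence "\<bar>real_of_int (lam N (Suc j))\<bar> \<le> (\<bar>C\<bar> + \<bar>M\<bar>) * real N"
      using N by (simp add: abs_divide pos_divide_le_eq)
    moreover have "real_of_int (lcoord N (lam N) j) = real_of_int (lam N (Suc j)) + (real N - real (Suc j))"
      by (simp add: lcoord_def)
    ultimately show "\<bar>real_of_int (lcoord N (lam N) j)\<bar> \<le> (\<bar>C\<bar> + \<bar>M\<bar> + 1) * real N"
      using j by (simp add: distrib_right)
  qed simp
qed

section \<open>Empirical points, moments and the Cauchy transform\<close>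

definition emp_point :: "nat \<Rightarrow> (nat \<Rightarrow> int) \<Rightarrow> nat \<Rightarrow> real" where
  "emp_point N lam j = real_of_int (lcoord N lam j) / real N"

definition emp_moment :: "nat \<Rightarrow> (nat \<Rightarrow> int) \<Rightarrow> nat \<Rightarrow> complex" where
  "emp_moment N lam n = of_real ((\<Sum>j<N. emp_point N lam j ^ n) / real N)"

lemma emp_moment_bound:
  assumes "N > 0" "A \<ge> 1" "\<And>j. j < N \<Longrightarrow> \<bar>emp_point N lam j\<bar> \<le> A"
  shows "moment_bound A (emp_moment N lam)"
  unfolding moment_bound_def
proof (intro conjI allI)
  fix n
  have "\<bar>\<Sum>j<N. emp_point N lam j ^ n\<bar> \<le> (\<Sum>j<N. \<bar>emp_point N lam j ^ n\<bar>)" by (rule sum_abs)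
  also have "\<dots> \<le> (\<Sum>j<N. A ^ n)"
    unfolding power_abs using assms(3) by (intro sum_mono power_mono) auto
  finally have "\<bar>\<Sum>j<N. emp_point N lam j ^ n\<bar> / real N \<le> A ^ n"
    using assms(1) by (simp add: pos_divide_le_eq mult.commute)
  thus "norm (emp_moment N lam n) \<le> A ^ n"
    unfolding emp_moment_def norm_of_real abs_divide by simp
qed (use assms in \<open>auto simp: emp_moment_def\<close>)

lemma moment_series_emp_moment:
  assumes "N > 0" "A \<ge> 1" "\<And>j. j < N \<Longrightarrow> \<bar>emp_point N lam j\<bar> \<le> A" "norm y < 1 / A"
  shows "moment_series (emp_moment N lam) y = (\<Sum>j<N. y / (1 - of_real (emp_point N lam j) * y)) / of_nat N"
proof -
  have lt: "norm (of_real (emp_point N lam j) * y) < 1" if "j < N" for j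
  proof -
    have "norm (of_real (emp_point N lam j) * y) \<le> A * norm y"
      using assms(3)[OF that] by (simp add: norm_mult mult_right_mono)
    also have "\<dots> < 1" using assms(2,4) by (simp add: pos_less_divide_eq mult.commute)
    finally show ?thesis .
  qed
  have "(\<lambda>n. (\<Sum>j<N. (of_real (emp_point N lam j) * y) ^ n) / of_nat N) sums
      ((\<Sum>j<N. 1 / (1 - of_real (emp_point N lam j) * y)) / of_nat N)"
    by (intro sums_divide sums_sum geometric_sums lt) simp
  moreover have "(\<Sum>j<N. (of_real (emp_point N lam j) * y) ^ n) / of_nat N = emp_moment N lam n * y ^ n" for n
    by (simp add: emp_moment_def power_mult_distrib sum_distrib_right[symmetric])
  ultimately have "(\<Sum>n. emp_moment N lam n * y ^ n) = (\<Sum>j<N. 1 / (1 - of_real (emp_point N lam j) * y)) / of_nat N"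
    by (simp add: sums_iff)
  thus ?thesis by (simp add: moment_series_def sum_distrib_left)
qed

lemma integral_emp_measure:
  assumes "N > 0" "f \<in> borel_measurable borel"
  shows "integral\<^sup>L (emp_measure N lam) f = (\<Sum>j<N. f (emp_point N lam j)) / real N"
proof -
  have "integral\<^sup>L (emp_measure N lam) f =
      integral\<^sup>L (uniform_count_measure {1..N}) (\<lambda>i. f ((real_of_int (lam i) + real N - real i) / real N))"
    unfolding emp_measure_def
    by (rule integral_distr) (auto simp: assms uniform_count_measure_def)
  also have "\<dots> = (\<Sum>i=1..N. f ((real_of_int (lam i) + real N - real i) / real N)) / real N"
    by (simp add: integral_uniform_count_measure)
  also have "(\<Sum>i=1..N. f ((real_of_int (lam i) + real N - real i) / real N)) = (\<Sum>j<N. f (emp_point N lam j))"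
    by (simp add: sum.atLeast1_atMost_eq emp_point_def lcoord_def)
  finally show ?thesis .
qed

lemma real_distribution_emp_measure:
  assumes "N > 0"
  shows "real_distribution (emp_measure N lam)"
proof -
  interpret prob_space "uniform_count_measure {1..N}"
    using assms by (intro prob_space_uniform_count_measure) auto
  show ?thesis unfolding emp_measure_def
    by (rule real_distribution_distr) (auto simp: uniform_count_measure_def)
qed

lemma compact_support_bounded:
  assumes "real_distribution m" "\<exists>K. compact K \<and> measure m K = 1"
  obtains A where "A \<ge> 1" "AE x in m. \<bar>x\<bar> \<le> A"
proof -
  interpret real_distribution m by fact
  obtain K where K: "compact K" "measure m K = 1" using assms(2) by blast
  have "bounded K" by (rule compact_imp_bounded[OF K(1)])
  then obtain B where B: "\<And>x. x \<in> K \<Longrightarrow> \<bar>x\<bar> \<le> B" by (auto simp: bounded_iff)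
  have "K \<in> events" using compact_imp_closed[OF K(1)] by auto
  hence "AE x in m. x \<in> K" using K(2) by (simp add: prob_eq_1)
  hence "AE x in m. \<bar>x\<bar> \<le> max 1 B" by (rule AE_mp) (use B in \<open>auto intro!: AE_I2 simp: le_max_iff_disj\<close>)
  thus ?thesis by (intro that[of "max 1 B"]) auto
qed

definition moments :: "real measure \<Rightarrow> nat \<Rightarrow> complex" where
  "moments m n = of_real (LINT x|m. x ^ n)"

lemma moments_bound:
  assumes "real_distribution m" "A \<ge> 1" "AE x in m. \<bar>x\<bar> \<le> A"
  shows "integrable m (\<lambda>x. x ^ n)" "moment_bound A (moments m)"
proof -
  interpret real_distribution m by fact
  have p1: "prob UNIV = 1" using prob_space by simp
  have AEn: "AE x in m. norm (x ^ n) \<le> A ^ n" for n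
    using assms(3) by eventually_elim (simp add: power_abs power_mono)
  show int: "integrable m (\<lambda>x. x ^ n)" for n
    by (rule integrable_const_bound[OF AEn]) simp
  show "moment_bound A (moments m)"
    unfolding moment_bound_def
  proof (intro conjI allI)
    fix n
    have "norm (LINT x|m. x ^ n) \<le> (LINT x|m. norm (x ^ n))" by (rule integral_norm_bound)
    also have "\<dots> \<le> (LINT x|m. A ^ n)"
      using int[of n] AEn[of n] by (intro integral_mono_AE integrable_norm) auto
    also have "\<dots> = A ^ n" by (simp add: p1)
    finally show "norm (moments m n) \<le> A ^ n" by (simp add: moments_def)
  qed (use assms(2) in \<open>auto simp: moments_def p1\<close>)
qed

text \<open>Geometric expansion of \<open>1 / (z - x)\<close>, integrated term by term under the
  summable majorant \<open>norm y * (A * norm y) ^ n\<close>.\<close>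

lemma cauchy_tr_moments:
  assumes "real_distribution m" "A \<ge> 1" "AE x in m. \<bar>x\<bar> \<le> A" "norm z > A"
  shows "cauchy_tr m z = moment_series (moments m) (1 / z)"
proof -
  interpret real_distribution m by fact
  define y where "y = 1 / z"
  have p1: "prob UNIV = 1" using prob_space by simp
  have z0: "z \<noteq> 0" using assms by auto
  have q: "0 \<le> A * norm y" "A * norm y < 1"
    using assms z0 by (auto simp: y_def norm_divide field_simps)
  have intc: "integrable m (\<lambda>x. complex_of_real (x ^ n) * y ^ Suc n)" for n
    by (intro integrable_mult_left integrable_of_real moments_bound(1)[OF assms(1-3)])
  have norm_le: "AE x in m. norm (complex_of_real (x ^ n) * y ^ Suc n) \<le> norm y * (A * norm y) ^ n" for n
    using assms(3)
  proof eventually_elim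
    case (elim x)
    have "norm (complex_of_real (x ^ n) * y ^ Suc n) = norm y * (\<bar>x\<bar> * norm y) ^ n"
      by (simp add: norm_mult norm_power power_mult_distrib mult_ac)
    also have "\<dots> \<le> norm y * (A * norm y) ^ n"
      using elim by (intro mult_left_mono power_mono mult_right_mono) auto
    finally show ?case .
  qed
  have sg: "summable (\<lambda>n. norm y * (A * norm y) ^ n)"
    using q by (intro summable_mult summable_geometric) auto
  have "(\<lambda>n. LINT x|m. complex_of_real (x ^ n) * y ^ Suc n) sums
      (LINT x|m. (\<Sum>n. complex_of_real (x ^ n) * y ^ Suc n))"
  proof (rule sums_integral[OF intc])
    have "AE x in m. \<forall>n. norm (complex_of_real (x ^ n) * y ^ Suc n) \<le> norm y * (A * norm y) ^ n"
      using norm_le by (simp add: AE_all_countable)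
    thus "AE x in m. summable (\<lambda>n. norm (complex_of_real (x ^ n) * y ^ Suc n))"
    proof eventually_elim
      case (elim x)
      show ?case by (rule summable_comparison_test'[OF sg]) (use elim in simp)
    qed
    show "summable (\<lambda>n. LINT x|m. norm (complex_of_real (x ^ n) * y ^ Suc n))"
    proof (rule summable_comparison_test'[OF sg])
      fix n
      have "(LINT x|m. norm (complex_of_real (x ^ n) * y ^ Suc n)) \<le> (LINT x|m. norm y * (A * norm y) ^ n)"
        using norm_le[of n] by (intro integral_mono_AE integrable_norm intc) auto
      thus "norm (LINT x|m. norm (complex_of_real (x ^ n) * y ^ Suc n)) \<le> norm y * (A * norm y) ^ n"
        by (simp add: p1)
    qed
  qed
  moreover have "(LINT x|m. complex_of_real (x ^ n) * y ^ Suc n) = y * (moments m n * y ^ n)" for n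
    by (simp add: moments_def del: of_real_power)
  moreover have "(LINT x|m. (\<Sum>n. complex_of_real (x ^ n) * y ^ Suc n)) = cauchy_tr m z"
    unfolding cauchy_tr_def
  proof (rule integral_cong_AE)
    show "AE x in m. (\<Sum>n. complex_of_real (x ^ n) * y ^ Suc n) = 1 / (z - complex_of_real x)"
      using assms(3)
    proof eventually_elim
      case (elim x)
      have "norm (complex_of_real x * y) \<le> A * norm y"
        using elim by (simp add: norm_mult mult_right_mono)
      hence lt: "norm (complex_of_real x * y) < 1" using q by simp
      have "(\<lambda>n. y * (complex_of_real x * y) ^ n) sums (y * (1 / (1 - complex_of_real x * y)))"
        by (intro sums_mult geometric_sums lt)
      hence "(\<Sum>n. complex_of_real (x ^ n) * y ^ Suc n) = y * (1 / (1 - complex_of_real x * y))"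
        by (simp add: sums_iff power_mult_distrib mult_ac)
      also have "\<dots> = 1 / (z - complex_of_real x)" using z0 by (simp add: y_def field_simps)
      finally show ?case .
    qed
  qed measurable
  ultimately have "(\<lambda>n. y * (moments m n * y ^ n)) sums cauchy_tr m z" by (simp only:)
  moreover have "summable (\<lambda>n. moments m n * y ^ n)"
    by (rule summable_norm_cancel[OF moment_summable[OF moments_bound(2)[OF assms(1-3)]]])
      (use q assms(2) in \<open>simp add: pos_less_divide_eq mult.commute\<close>)
  hence "(\<lambda>n. y * (moments m n * y ^ n)) sums (y * (\<Sum>n. moments m n * y ^ n))"
    by (intro sums_mult summable_sums)
  ultimately show ?thesis by (simp add: moment_series_def y_def sums_unique2)
qed

lemma emp_moment_tendsto:
  assumes m: "real_distribution m" and A: "A \<ge> 1" "AE x in m. \<bar>x\<bar> \<le> A"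
    and bd: "\<And>N j. j < N \<Longrightarrow> \<bar>emp_point N (lam N) j\<bar> \<le> A"
    and conv: "weak_conv_m (\<lambda>N. emp_measure N (lam N)) m"
  shows "(\<lambda>N. emp_moment N (lam N) n) \<longlonglongrightarrow> moments m n"
proof -
  \<comment> \<open>Weak convergence tests bounded continuous functions. The clamped power is one,
    and it equals \<open>x ^ n\<close> on \<open>{- A..A}\<close>, where all the measures
    live.\<close>
  define c where "c x = (max (- A) (min A x)) ^ n" for x
  have c_id: "c x = x ^ n" if "\<bar>x\<bar> \<le> A" for x
    using that by (auto simp: c_def abs_le_iff max_def min_def)
  have c_cont: "isCont c x" for x unfolding c_def by (intro continuous_intros)
  have c_meas: "c \<in> borel_measurable borel"
    using c_cont by (intro borel_measurable_continuous_onI) (simp add: continuous_at_imp_continuous_on)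
  have c_bd: "norm (c x) \<le> A ^ n" for x
    unfolding c_def norm_power using A(1) by (intro power_mono) auto
  interpret m: real_distribution m by fact
  \<comment> \<open>For \<open>N = 0\<close> there are no points and no probability measure;
    shifting the index leaves the limit unchanged.\<close>
  have "weak_conv_m (\<lambda>N. emp_measure (Suc N) (lam (Suc N))) m"
    using conv unfolding weak_conv_m_def weak_conv_def by (auto intro: LIMSEQ_Suc)
  hence "(\<lambda>N. integral\<^sup>L (emp_measure (Suc N) (lam (Suc N))) c) \<longlonglongrightarrow> integral\<^sup>L m c"
    by (intro weak_conv_imp_integral_bdd_continuous_conv[OF _ m _ c_cont c_bd] real_distribution_emp_measure) auto
  moreover have "integral\<^sup>L (emp_measure (Suc N) (lam (Suc N))) c =
      (\<Sum>j<Suc N. emp_point (Suc N) (lam (Suc N)) j ^ n) / real (Suc N)" for N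
    using bd c_id by (subst integral_emp_measure[OF _ c_meas]) (auto intro!: sum.cong arg_cong2[where f = "(/)"])
  moreover have "integral\<^sup>L m c = (LINT x|m. x ^ n)"
  proof (rule integral_cong_AE)
    show "AE x in m. c x = x ^ n" using A(2) by eventually_elim (rule c_id)
  qed (use c_meas in auto)
  ultimately have "(\<lambda>N. (\<Sum>j<Suc N. emp_point (Suc N) (lam (Suc N)) j ^ n) / real (Suc N)) \<longlonglongrightarrow> (LINT x|m. x ^ n)"
    by (simp only:)
  hence "(\<lambda>N. (\<Sum>j<N. emp_point N (lam N) j ^ n) / real N) \<longlonglongrightarrow> (LINT x|m. x ^ n)"
    by (rule LIMSEQ_imp_Suc)
  thus ?thesis unfolding emp_moment_def moments_def by (rule tendsto_of_real)
qed

section \<open>Uniform convergence of the Schur function ratios\<close>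

text \<open>The two conclusions are proved together, since multiplying uniform limits requires
  bounded limit functions at every step of the induction.\<close>

lemma uniform_limit_prod_bounded:
  fixes f :: "'i \<Rightarrow> nat \<Rightarrow> 'a \<Rightarrow> complex"
  assumes "finite I" "\<And>i. i \<in> I \<Longrightarrow> uniform_limit S (f i) (g i) sequentially"
    and "\<And>i. i \<in> I \<Longrightarrow> bounded (g i ` S)"
  shows "uniform_limit S (\<lambda>N x. \<Prod>i\<in>I. f i N x) (\<lambda>x. \<Prod>i\<in>I. g i x) sequentially"
    and "bounded ((\<lambda>x. \<Prod>i\<in>I. g i x) ` S)"
proof -
  have "uniform_limit S (\<lambda>N x. \<Prod>i\<in>I. f i N x) (\<lambda>x. \<Prod>i\<in>I. g i x) sequentially \<and>
      bounded ((\<lambda>x. \<Prod>i\<in>I. g i x) ` S)"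
    using assms
  proof (induction I rule: finite_induct)
    case empty
    show ?case by (auto simp: bounded_iff intro: uniform_limit_const)
  next
    case (insert i I)
    have IH: "uniform_limit S (\<lambda>N x. \<Prod>i\<in>I. f i N x) (\<lambda>x. \<Prod>i\<in>I. g i x) sequentially"
      "bounded ((\<lambda>x. \<Prod>i\<in>I. g i x) ` S)"
      using insert.IH insert.prems by auto
    have bi: "bounded (g i ` S)" using insert.prems by auto
    have "uniform_limit S (\<lambda>N x. f i N x * (\<Prod>i\<in>I. f i N x)) (\<lambda>x. g i x * (\<Prod>i\<in>I. g i x)) sequentially"
      using insert.prems IH bi by (intro uniform_lim_mult) auto
    moreover have "bounded ((\<lambda>x. g i x * (\<Prod>i\<in>I. g i x)) ` S)"
    proof -
      obtain B1 where B1: "\<And>x. x \<in> S \<Longrightarrow> norm (g i x) \<le> B1" using bi by (auto simp: bounded_iff)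
      obtain B2 where B2: "\<And>x. x \<in> S \<Longrightarrow> norm (\<Prod>i\<in>I. g i x) \<le> B2" using IH(2) by (auto simp: bounded_iff)
      have "norm (g i x * (\<Prod>i\<in>I. g i x)) \<le> B1 * B2" if "x \<in> S" for x
        unfolding norm_mult using B1[OF that] B2[OF that]
        by (intro mult_mono) (auto intro: order_trans[OF norm_ge_zero])
      thus ?thesis unfolding bounded_iff by blast
    qed
    ultimately show ?case using insert.hyps by simp
  qed
  thus "uniform_limit S (\<lambda>N x. \<Prod>i\<in>I. f i N x) (\<lambda>x. \<Prod>i\<in>I. g i x) sequentially"
    "bounded ((\<lambda>x. \<Prod>i\<in>I. g i x) ` S)" by auto
qed

lemma uniform_limit_sum_finite:
  fixes f :: "'i \<Rightarrow> nat \<Rightarrow> 'a \<Rightarrow> complex"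
  assumes "finite I" "\<And>i. i \<in> I \<Longrightarrow> uniform_limit S (f i) (g i) sequentially"
  shows "uniform_limit S (\<lambda>N x. \<Sum>i\<in>I. f i N x) (\<lambda>x. \<Sum>i\<in>I. g i x) sequentially"
  using assms
  by (induction I rule: finite_induct) (auto intro: uniform_limit_const uniform_limit_add)

lemma uniform_limit_ndet:
  assumes lim: "\<And>a p. a < k \<Longrightarrow> p < k \<Longrightarrow> uniform_limit S (\<lambda>N x. f N x a p) (\<lambda>x. g x a p) sequentially"
    and bd: "\<And>a p. a < k \<Longrightarrow> p < k \<Longrightarrow> bounded ((\<lambda>x. g x a p) ` S)"
  shows "uniform_limit S (\<lambda>N x. ndet k (f N x)) (\<lambda>x. ndet k (g x)) sequentially"
  unfolding ndet_rows
proof (rule uniform_limit_sum_finite)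
  fix \<pi> :: "nat \<Rightarrow> nat" assume "\<pi> \<in> {\<pi>. \<pi> permutes {0..<k}}"
  hence lt: "\<pi> i < k" if "i < k" for i using permutes_in_image[of \<pi> "{0..<k}" i] that by auto
  have "uniform_limit S (\<lambda>N x. \<Prod>i<k. f N x i (\<pi> i)) (\<lambda>x. \<Prod>i<k. g x i (\<pi> i)) sequentially"
    "bounded ((\<lambda>x. \<Prod>i<k. g x i (\<pi> i)) ` S)"
    using lim bd lt uniform_limit_prod_bounded[where I = "{..<k}" and S = S and f = "\<lambda>i N x. f N x i (\<pi> i)"
        and g = "\<lambda>i x. g x i (\<pi> i)"] by auto
  thus "uniform_limit S (\<lambda>N x. of_int (sign \<pi>) * (\<Prod>i<k. f N x i (\<pi> i)))
      (\<lambda>x. of_int (sign \<pi>) * (\<Prod>i<k. g x i (\<pi> i))) sequentially"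
    by (intro uniform_lim_mult uniform_limit_const) (auto simp: bounded_iff)
qed (simp add: finite_permutations)

lemma norm_schur_sep_hol:
  assumes "R \<le> 1 / 2"
  shows "sep_hol k R (norm_schur N lam k)"
  unfolding sep_hol_def
proof (intro ballI)
  fix x i assume x: "x \<in> polydisc1 k R" and i: "i \<in> {1..k}"
  define v where "v z j = (if j \<le> k then (x(i := z)) j else 1)" for z j
  have hol_v: "(\<lambda>z. v z j) holomorphic_on ball 1 R" for j
    by (cases "j \<le> k"; cases "j = i") (auto simp: v_def intro!: holomorphic_intros)
  have nz: "v z j \<noteq> 0" if "z \<in> ball 1 R" "1 \<le> j" for z j
  proof (cases "j \<le> k")
    case True
    hence "v z j \<in> ball 1 R"
      using polydisc1_coord[OF polydisc1_upd[OF x that(1), of i], of j] that by (simp add: v_def)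
    thus ?thesis using near_1_props(1) assms by blast
  qed (simp add: v_def)
  have "(\<lambda>z. schur N lam (v z)) holomorphic_on ball 1 R"
    unfolding schur_def
    using nz by (intro holomorphic_intros holomorphic_on_power_int hol_v) auto
  hence "(\<lambda>z. schur N lam (v z) / schur N lam (\<lambda>_. 1)) holomorphic_on ball 1 R"
    unfolding divide_inverse by (intro holomorphic_intros)
  thus "(\<lambda>z. norm_schur N lam k (x(i := z))) holomorphic_on ball 1 R"
    by (simp add: norm_schur_def v_def[abs_def])
qed

text \<open>Each of the \<open>k\<close> indices occurs in \<open>k - 1\<close> pairs. This is the
  exponent left over when \<open>(x - 1) ^ (N - 1)\<close> meets
  \<open>(x - 1) ^ (N - k)\<close>.\<close>

lemma prod_pairs_power:
  fixes t :: "nat \<Rightarrow> 'a :: comm_monoid_mult"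
  shows "(\<Prod>b<k. \<Prod>a<b. t a * t b) = (\<Prod>a<k. t a) ^ (k - 1)"
proof (induction k)
  case (Suc k)
  define T where "T = (\<Prod>a<k. t a)"
  have T: "T ^ (k - 1) * T = T ^ k"
    by (cases k) (simp_all add: T_def mult.commute)
  have "(\<Prod>b<Suc k. \<Prod>a<b. t a * t b) = T ^ (k - 1) * (T * t k ^ k)"
    unfolding prod.lessThan_Suc Suc.IH T_def by (simp add: prod.distrib)
  also have "\<dots> = (T ^ (k - 1) * T) * t k ^ k" by (simp only: mult.assoc)
  also have "\<dots> = (T * t k) ^ k" unfolding T by (simp only: power_mult_distrib)
  finally show ?case by (simp add: T_def)
qed simp

lemma norm_schur_1:
  assumes "is_signature N lam" "1 \<le> N"
  shows "\<exists>c. c \<noteq> 0 \<and> (\<forall>z. z \<noteq> 0 \<longrightarrow>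
    norm_schur N lam 1 (\<lambda>_. z) * (z - 1) ^ (N - 1) = c * amp N lam 0 z)"
proof -
  obtain c where c: "c \<noteq> 0" "\<forall>x. (\<forall>i\<in>{1..1}. x i \<noteq> 0) \<longrightarrow>
      schur N lam (\<lambda>i. if i \<le> 1 then x i else 1) * (\<Prod>b<1. \<Prod>a<b. x (Suc a) - x (Suc b)) *
        (\<Prod>a<1. x (Suc a) - 1) ^ (N - 1) = c * ndet 1 (\<lambda>a p. amp N lam p (x (Suc a)))"
    using schur_determinant_amp[OF assms] by (elim exE conjE)
  have nd: "ndet 1 f = f 0 0" for f using ndet_last_row[of 0 f] by simp
  note D = schur_ones_nonzero[OF assms(1)]
  show ?thesis
  proof (intro exI[of _ "c / schur N lam (\<lambda>_. 1)"] conjI allI impI)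
    show "c / schur N lam (\<lambda>_. 1) \<noteq> 0" using c(1) D by simp
    fix z :: complex assume z: "z \<noteq> 0"
    have "schur N lam (\<lambda>i. if i \<le> 1 then z else 1) * (z - 1) ^ (N - 1) = c * amp N lam 0 z"
      using c(2)[rule_format, of "\<lambda>_. z"] z by (simp add: nd[unfolded One_nat_def])
    hence "schur N lam (\<lambda>i. if i \<le> 1 then z else 1) * (z - 1) ^ (N - 1) / schur N lam (\<lambda>_. 1) =
        c * amp N lam 0 z / schur N lam (\<lambda>_. 1)" by (simp only:)
    thus "norm_schur N lam 1 (\<lambda>_. z) * (z - 1) ^ (N - 1) = c / schur N lam (\<lambda>_. 1) * amp N lam 0 z"
      unfolding norm_schur_def by (simp only: times_divide_eq_left)
  qed
qed

text \<open>The determinant formula for \<open>k\<close> variables is divided by its instances for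
  one variable: the amplitudes with \<open>p = 0\<close> scale the rows, \<open>N ^ p\<close> scales
  the columns, and the surplus powers of \<open>x - 1\<close> are distributed over the pairs.
  \<open>C\<close> depends on \<open>N\<close> but not on \<open>x\<close>.\<close>

lemma norm_schur_ratio:
  assumes sig: "is_signature N lam" and k: "1 \<le> k" "k \<le> N"
  shows "\<exists>C. C \<noteq> 0 \<and> (\<forall>x. (\<forall>i\<in>{1..k}. x i \<noteq> 0 \<and> x i \<noteq> 1 \<and> amp N lam 0 (x i) \<noteq> 0) \<longrightarrow>
    (\<forall>b<k. \<forall>a<b. x (Suc a) \<noteq> x (Suc b)) \<longrightarrow>
    norm_schur N lam k x / (\<Prod>a<k. norm_schur N lam 1 (\<lambda>_. x (Suc a))) =
    C * (ndet k (\<lambda>a p. amp N lam p (x (Suc a)) / amp N lam 0 (x (Suc a)) / of_nat N ^ p) *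
      (\<Prod>b<k. \<Prod>a<b. (x (Suc a) - 1) * (x (Suc b) - 1) / (x (Suc a) - x (Suc b)))))"
proof -
  have N: "1 \<le> N" using k by simp
  obtain c where c: "c \<noteq> 0" "\<forall>x. (\<forall>i\<in>{1..k}. x i \<noteq> 0) \<longrightarrow>
      schur N lam (\<lambda>i. if i \<le> k then x i else 1) * (\<Prod>b<k. \<Prod>a<b. x (Suc a) - x (Suc b)) *
        (\<Prod>a<k. x (Suc a) - 1) ^ (N - k) = c * ndet k (\<lambda>a p. amp N lam p (x (Suc a)))"
    using schur_determinant_amp[OF sig k(2)] by (elim exE conjE)
  obtain c1 where c1: "c1 \<noteq> 0" "\<forall>z. z \<noteq> 0 \<longrightarrow>
      norm_schur N lam 1 (\<lambda>_. z) * (z - 1) ^ (N - 1) = c1 * amp N lam 0 z"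
    using norm_schur_1[OF sig N] by (elim exE conjE)
  define D where "D = schur N lam (\<lambda>_. 1)"
  have D: "D \<noteq> 0" unfolding D_def by (rule schur_ones_nonzero[OF sig])
  define F :: complex where "F = (\<Prod>p<k. of_nat N ^ p)"
  have F: "F \<noteq> 0" using N by (simp add: F_def)
  show ?thesis
  proof (intro exI[of _ "c * F / (D * c1 ^ k)"] conjI allI impI)
    show "c * F / (D * c1 ^ k) \<noteq> 0" using c(1) c1(1) D F by simp
    fix x :: "nat \<Rightarrow> complex"
    assume x: "\<forall>i\<in>{1..k}. x i \<noteq> 0 \<and> x i \<noteq> 1 \<and> amp N lam 0 (x i) \<noteq> 0"
      and dist: "\<forall>b<k. \<forall>a<b. x (Suc a) \<noteq> x (Suc b)"
    define P where "P = (\<Prod>a<k. x (Suc a) - 1)"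
    define V where "V = (\<Prod>b<k. \<Prod>a<b. x (Suc a) - x (Suc b))"
    define M where "M = (\<Prod>a<k. amp N lam 0 (x (Suc a)))"
    define d where "d = ndet k (\<lambda>a p. amp N lam p (x (Suc a)))"
    define U where "U = norm_schur N lam k x"
    have xS: "x (Suc a) \<noteq> 0 \<and> x (Suc a) \<noteq> 1 \<and> amp N lam 0 (x (Suc a)) \<noteq> 0" if "a < k" for a
      using x that by simp
    have P: "P \<noteq> 0" and M: "M \<noteq> 0" using xS by (auto simp: P_def M_def)
    have V: "V \<noteq> 0" using dist by (auto simp: V_def)
    have S: "U = c * d / (D * V * P ^ (N - k))"
    proof -
      have "schur N lam (\<lambda>i. if i \<le> k then x i else 1) * V * P ^ (N - k) = c * d"
        unfolding V_def P_def d_def by (rule c(2)[rule_format]) (use x in auto)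
      moreover have "schur N lam (\<lambda>i. if i \<le> k then x i else 1) = U * D"
        using D by (simp add: U_def norm_schur_def D_def)
      ultimately have "U * (D * V * P ^ (N - k)) = c * d" by (simp only: mult.assoc)
      thus ?thesis using V P D by (intro eq_divide_imp) auto
    qed
    have s1: "(\<Prod>a<k. norm_schur N lam 1 (\<lambda>_. x (Suc a))) = c1 ^ k * M / P ^ (N - 1)"
    proof (rule eq_divide_imp)
      have "(\<Prod>a<k. norm_schur N lam 1 (\<lambda>_. x (Suc a))) * P ^ (N - 1) =
          (\<Prod>a<k. norm_schur N lam 1 (\<lambda>_. x (Suc a)) * (x (Suc a) - 1) ^ (N - 1))"
        unfolding P_def prod.distrib prod_power_distrib ..
      also have "\<dots> = (\<Prod>a<k. c1 * amp N lam 0 (x (Suc a)))"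
        using xS by (intro prod.cong refl c1(2)[rule_format]) auto
      also have "\<dots> = c1 ^ k * M" unfolding prod.distrib M_def by simp
      finally show "(\<Prod>a<k. norm_schur N lam 1 (\<lambda>_. x (Suc a))) * P ^ (N - 1) = c1 ^ k * M" .
    qed (use P in simp)
    have ndet_eq: "ndet k (\<lambda>a p. amp N lam p (x (Suc a)) / amp N lam 0 (x (Suc a)) / of_nat N ^ p) = d / (M * F)"
    proof -
      have "ndet k (\<lambda>a p. amp N lam p (x (Suc a)) / amp N lam 0 (x (Suc a)) / of_nat N ^ p) =
          ndet k (\<lambda>a p. (1 / amp N lam 0 (x (Suc a))) * ((1 / of_nat N ^ p) * amp N lam p (x (Suc a))))"
        by simp
      also have "\<dots> = (\<Prod>a<k. 1 / amp N lam 0 (x (Suc a))) * ((\<Prod>p<k. 1 / of_nat N ^ p) * d)"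
        unfolding d_def by (simp only: ndet_scale_rows ndet_scale_cols)
      also have "\<dots> = d / (M * F)" unfolding M_def F_def prod_dividef by simp
      finally show ?thesis .
    qed
    have pp: "(\<Prod>b<k. \<Prod>a<b. (x (Suc a) - 1) * (x (Suc b) - 1) / (x (Suc a) - x (Suc b))) = P ^ (k - 1) / V"
      unfolding V_def P_def prod_pairs_power[symmetric] prod_dividef ..
    have "N - 1 = (k - 1) + (N - k)" using k by simp
    hence PN: "P ^ (N - 1) = P ^ (k - 1) * P ^ (N - k)" by (simp only: power_add)
    define Q where "Q = P ^ (k - 1)"
    define Q' where "Q' = P ^ (N - k)"
    define e where "e = c1 ^ k"
    have nz: "Q \<noteq> 0" "Q' \<noteq> 0" "e \<noteq> 0" using P c1(1) by (auto simp: Q_def Q'_def e_def)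
    show "norm_schur N lam k x / (\<Prod>a<k. norm_schur N lam 1 (\<lambda>_. x (Suc a))) =
      c * F / (D * c1 ^ k) * (ndet k (\<lambda>a p. amp N lam p (x (Suc a)) / amp N lam 0 (x (Suc a)) / of_nat N ^ p) *
      (\<Prod>b<k. \<Prod>a<b. (x (Suc a) - 1) * (x (Suc b) - 1) / (x (Suc a) - x (Suc b))))"
      unfolding U_def[symmetric] S s1 ndet_eq pp PN Q_def[symmetric] Q'_def[symmetric] e_def[symmetric]
      using M V D F nz by simp
  qed
qed

text \<open>The dictionary between the two settings is \<open>Z = N / y\<close>: the saddle equation
  for \<open>Z\<close> becomes \<open>moment_series (emp_moment N lam) y = u\<close>.\<close>

lemma amp_ratio_emp:
  assumes sig: "is_signature N lam" and N: "10 ^ 10 \<le> N" and A: "A \<ge> 1"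
    and bd: "\<And>j. j < N \<Longrightarrow> \<bar>emp_point N lam j\<bar> \<le> A"
    and u: "u \<noteq> 0" "norm u \<le> 1 / (64000 * A)"
  defines "y \<equiv> moment_inverse A (emp_moment N lam) u"
  shows "amp N lam 0 (exp u) \<noteq> 0"
    and "norm (amp N lam p (exp u) / amp N lam 0 (exp u) / of_nat N ^ p * y ^ p - 1) \<le> 6400 * (real p + 2) / sqrt N"
proof -
  have N0: "N > 0" using N by (cases N) auto
  have A0: "A > 0" using A by simp
  have u': "norm u \<le> 1 / (32 * A)"
  proof -
    have "1 / (64000 * A) \<le> 1 / (32 * A)" using A0 by (simp add: field_simps)
    thus ?thesis using u(2) by linarith
  qed
  have mb: "moment_bound A (emp_moment N lam)"
    by (rule emp_moment_bound[OF N0 A]) (rule bd)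
  note y = moment_inverse[OF mb u', folded y_def]
  have y0: "y \<noteq> 0" by (rule y(4)[OF u(1)])
  define Z where "Z = of_nat N / y"
  have Z0: "Z \<noteq> 0" using N0 y0 by (simp add: Z_def)
  \<comment> \<open>This explains \<open>64000\<close>: with \<open>norm y \<le> 2 * norm u\<close>
    it yields the bound \<open>1 / 32000\<close> that the Laplace method asks for.\<close>
  have Ay: "A * norm y \<le> 1 / 32000"
  proof -
    have "A * norm y \<le> A * (2 * (1 / (64000 * A)))"
      using y(3) u(2) A0 by (intro mult_left_mono) auto
    also have "\<dots> = 1 / 32000" using A0 by simp
    finally show ?thesis .
  qed
  have pt: "of_int (lcoord N lam j) / Z = of_real (emp_point N lam j) * y" for j
    by (simp add: Z_def emp_point_def)
  have small: "norm (of_int (lcoord N lam j) / Z) \<le> 1 / 32000" if "j < N" for j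
  proof -
    have "norm (of_int (lcoord N lam j) / Z) = \<bar>emp_point N lam j\<bar> * norm y"
      unfolding pt norm_mult by simp
    also have "\<dots> \<le> A * norm y" using bd[OF that] by (intro mult_right_mono) auto
    finally show ?thesis using Ay by simp
  qed
  have "u = moment_series (emp_moment N lam) y" using y(2) by simp
  also have "\<dots> = (\<Sum>j<N. y / (1 - of_real (emp_point N lam j) * y)) / of_nat N"
  proof (rule moment_series_emp_moment[OF N0 A])
    show "\<bar>emp_point N lam j\<bar> \<le> A" if "j < N" for j using that by (rule bd)
    have "norm y \<le> 1 / (16 * A)" by (rule y(1))
    also have "\<dots> < 1 / A" using A0 by (simp add: field_simps)
    finally show "norm y < 1 / A" .
  qed
  also have "\<dots> = (\<Sum>j<N. 1 / (Z - of_int (lcoord N lam j)))"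
    unfolding sum_divide_distrib
  proof (intro sum.cong refl)
    fix j assume "j \<in> {..<N}"
    have "1 - of_real (emp_point N lam j) * y = (Z - of_int (lcoord N lam j)) / Z"
      unfolding pt[symmetric] using Z0 by (simp add: diff_divide_distrib)
    thus "y / (1 - of_real (emp_point N lam j) * y) / of_nat N = 1 / (Z - of_int (lcoord N lam j))"
      using y0 N0 by (simp add: Z_def)
  qed
  finally have u_eq: "u = (\<Sum>j<N. 1 / (Z - of_int (lcoord N lam j)))" .
  show "amp N lam 0 (exp u) \<noteq> 0"
    by (rule amp_ratio(1)[OF sig N Z0 _ u_eq]) (rule small)
  have ar: "norm (amp N lam p (exp u) / amp N lam 0 (exp u) / Z ^ p - 1) \<le> 6400 * (real p + 2) / sqrt N"
    by (rule amp_ratio(2)[OF sig N Z0 _ u_eq]) (rule small)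
  have "amp N lam p (exp u) / amp N lam 0 (exp u) / of_nat N ^ p * y ^ p =
      amp N lam p (exp u) / amp N lam 0 (exp u) / Z ^ p"
    by (simp add: Z_def power_divide)
  thus "norm (amp N lam p (exp u) / amp N lam 0 (exp u) / of_nat N ^ p * y ^ p - 1) \<le> 6400 * (real p + 2) / sqrt N"
    using ar by (simp only:)
qed

text \<open>A lower bound on \<open>y\<close>, which keeps the scaled saddle point
  \<open>1 / y\<close> bounded as long as \<open>u\<close> stays away from 0.\<close>

lemma norm_le_moment_inverse:
  assumes "moment_bound A \<mu>" "norm u \<le> 1 / (32 * A)"
  shows "norm u \<le> 2 * norm (moment_inverse A \<mu> u)"
proof -
  define y where "y = moment_inverse A \<mu> u"
  note y = moment_inverse[OF assms, folded y_def]
  have A: "A > 0" by (rule moment_boundD(1)[OF assms(1)])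
  have "norm (u - y) \<le> 2 * A * (norm y)\<^sup>2"
    using moment_series_near_id[OF assms(1), of y] y(1,2) A by (simp add: field_simps)
  also have "\<dots> = 2 * (A * norm y) * norm y" by (simp add: power2_eq_square)
  also have "\<dots> \<le> 2 * (1 / 16) * norm y"
    using y(1) A by (intro mult_right_mono mult_left_mono) (auto simp: field_simps)
  finally show ?thesis using norm_triangle_sub[of u y] norm_ge_zero[of y]
    unfolding y_def[symmetric] by linarith
qed

lemma amp_ratio_uniform_limit:
  assumes sig: "\<And>N. is_signature N (lam N)" and A: "A \<ge> 1"
    and bd: "\<And>N j. j < N \<Longrightarrow> \<bar>emp_point N (lam N) j\<bar> \<le> A"
    and mb: "moment_bound A \<mu>" and lim: "\<And>n. (\<lambda>N. emp_moment N (lam N) n) \<longlonglongrightarrow> \<mu> n"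
    and E: "\<And>z. z \<in> E \<Longrightarrow> Ln z \<in> ball 0 (1 / (64000 * A)) \<and> exp (Ln z) = z \<and> c \<le> norm (z - 1)" and c: "c > 0"
  shows "uniform_limit E (\<lambda>N z. amp N (lam N) p z / amp N (lam N) 0 z / of_nat N ^ p)
      (\<lambda>z. (1 / moment_inverse A \<mu> (Ln z)) ^ p) sequentially"
    and "bounded ((\<lambda>z. (1 / moment_inverse A \<mu> (Ln z)) ^ p) ` E)"
proof -
  define Y where "Y N = moment_inverse A (emp_moment N (lam N))" for N
  define Y0 where "Y0 = moment_inverse A \<mu>"
  \<comment> \<open>Here \<open>c \<le> norm (z - 1) \<le> exp 1 * norm (Ln z)\<close>, as the real
    part of \<open>Ln z\<close> is at most 1, and \<open>norm (Ln z)\<close> is at most twice the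
    norm of the inverse.\<close>
  define c' where "c' = c / (2 * exp 1)"
  have c': "c' > 0" using c by (simp add: c'_def)
  have A0: "A > 0" using A by simp
  have small: "1 / (64000 * A) \<le> 1 / (32 * A)" "1 / (64000 * A) \<le> 1"
    using A by (simp_all add: field_simps)
  have mbN: "moment_bound A (emp_moment N (lam N))" if "N > 0" for N
    by (rule emp_moment_bound[OF that A]) (rule bd)
  have Ln_norm: "norm (Ln z) \<le> 1 / (64000 * A)" if "z \<in> E" for z
    using E[OF that] by simp
  have Ln_low: "c \<le> exp 1 * norm (Ln z)" if "z \<in> E" for z
  proof -
    have "norm (exp (Ln z) - exp 0) \<le> exp (- (- 1)) * norm (Ln z - 0)"
      using complex_Re_le_cmod[of "Ln z"] Ln_norm[OF that] small
      by (intro norm_exp_diff_le) auto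
    thus ?thesis using E[OF that] by simp
  qed
  have low: "c' \<le> norm (moment_inverse A \<nu> (Ln z))" if "z \<in> E" "moment_bound A \<nu>" for z \<nu>
  proof -
    have "norm (Ln z) \<le> 2 * norm (moment_inverse A \<nu> (Ln z))"
      using Ln_norm[OF that(1)] small by (intro norm_le_moment_inverse[OF that(2)]) linarith
    hence "exp 1 * norm (Ln z) \<le> exp 1 * (2 * norm (moment_inverse A \<nu> (Ln z)))" by (intro mult_left_mono) auto
    hence "c \<le> exp 1 * (2 * norm (moment_inverse A \<nu> (Ln z)))" using Ln_low[OF that(1)] by linarith
    also have "\<dots> = norm (moment_inverse A \<nu> (Ln z)) * (2 * exp 1)" by simp
    finally have "c \<le> norm (moment_inverse A \<nu> (Ln z)) * (2 * exp 1)" .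
    thus ?thesis by (simp add: c'_def pos_divide_le_eq)
  qed
  have limY: "uniform_limit E (\<lambda>N z. Y N (Ln z)) (\<lambda>z. Y0 (Ln z)) sequentially"
  proof -
    \<comment> \<open>The shift avoids \<open>N = 0\<close>, where the empirical moment of order 0
      is 0 instead of 1.\<close>
    have "uniform_limit (cball 0 (1 / (32 * A))) (\<lambda>N. moment_inverse A (emp_moment (Suc N) (lam (Suc N)))) Y0 sequentially"
      unfolding Y0_def by (rule moment_inverse_uniform_limit[OF _ mb]) (auto intro: LIMSEQ_Suc lim mbN)
    hence "uniform_limit (cball 0 (1 / (32 * A))) Y Y0 sequentially"
      unfolding Y_def by (rule filterlim_sequentially_Suc[THEN iffD1])
    thus ?thesis
    proof (rule uniform_limit_compose')
      show "Ln \<in> E \<rightarrow> cball 0 (1 / (32 * A))" using Ln_norm small(1) by force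
    qed
  qed
  have bd1: "norm (1 / Y0 (Ln z)) \<le> 1 / c'" if "z \<in> E" for z
    using low[OF that mb] c' by (simp add: norm_divide Y0_def frac_le)
  have lim1: "uniform_limit E (\<lambda>N z. 1 / Y N (Ln z)) (\<lambda>z. 1 / Y0 (Ln z)) sequentially"
    by (rule uniform_lim_divide[OF uniform_limit_const limY, where b = c'])
      (use low[OF _ mb] c' in \<open>simp_all add: Y0_def image_constant_conv\<close>)
  have bd1': "bounded ((\<lambda>z. 1 / Y0 (Ln z)) ` E)" unfolding bounded_iff using bd1 by blast
  have limp: "uniform_limit E (\<lambda>N z. (1 / Y N (Ln z)) ^ p) (\<lambda>z. (1 / Y0 (Ln z)) ^ p) sequentially"
    and bdp: "bounded ((\<lambda>z. (1 / Y0 (Ln z)) ^ p) ` E)"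
    using uniform_limit_prod_bounded[where I = "{..<p}" and S = E and f = "\<lambda>_ N z. 1 / Y N (Ln z)"
        and g = "\<lambda>_ z. 1 / Y0 (Ln z)"] lim1 bd1' by simp_all
  show "bounded ((\<lambda>z. (1 / moment_inverse A \<mu> (Ln z)) ^ p) ` E)" using bdp by (simp add: Y0_def)
  define \<rho> where "\<rho> N z = amp N (lam N) p z / amp N (lam N) 0 z / of_nat N ^ p * Y N (Ln z) ^ p" for N z
  have "uniform_limit E \<rho> (\<lambda>_. 1) sequentially"
  proof (rule uniform_limitI)
    fix e :: real assume e: "e > 0"
    have "(\<lambda>N. 6400 * (real p + 2) / sqrt (real N)) \<longlonglongrightarrow> 0"
      by (rule tendsto_divide_0[OF tendsto_const filterlim_at_top_imp_at_infinity[OF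
            filterlim_compose[OF sqrt_at_top filterlim_real_sequentially]]])
    from order_tendstoD(2)[OF this e] eventually_ge_at_top[of "10 ^ 10 :: nat"]
    show "\<forall>\<^sub>F N in sequentially. \<forall>z\<in>E. dist (\<rho> N z) 1 < e"
    proof eventually_elim
      case (elim N)
      show ?case
      proof
        fix z assume z: "z \<in> E"
        have "Ln z \<noteq> 0" using Ln_low[OF z] c by auto
        hence "norm (amp N (lam N) p (exp (Ln z)) / amp N (lam N) 0 (exp (Ln z)) / of_nat N ^ p *
            moment_inverse A (emp_moment N (lam N)) (Ln z) ^ p - 1) \<le> 6400 * (real p + 2) / sqrt (real N)"
          by (intro amp_ratio_emp(2)[OF sig elim(2) A]) (use bd Ln_norm[OF z] in auto)
        hence "norm (\<rho> N z - 1) \<le> 6400 * (real p + 2) / sqrt (real N)"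
          using E[OF z] by (simp only: \<rho>_def Y_def)
        with elim(1) show "dist (\<rho> N z) 1 < e" unfolding dist_norm by linarith
      qed
    qed
  qed
  hence "uniform_limit E (\<lambda>N z. \<rho> N z * (1 / Y N (Ln z)) ^ p) (\<lambda>z. 1 * (1 / Y0 (Ln z)) ^ p) sequentially"
    by (rule uniform_lim_mult[OF _ limp _ bdp]) (auto simp: bounded_iff)
  hence *: "uniform_limit E (\<lambda>N z. \<rho> N z * (1 / Y N (Ln z)) ^ p) (\<lambda>z. (1 / Y0 (Ln z)) ^ p) sequentially" by simp
  have ev: "\<forall>\<^sub>F N in sequentially. \<forall>z\<in>E. \<rho> N z * (1 / Y N (Ln z)) ^ p =
      amp N (lam N) p z / amp N (lam N) 0 z / of_nat N ^ p"
    using eventually_gt_at_top[of 0]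
  proof eventually_elim
    case (elim N)
    show ?case
    proof
      fix z assume z: "z \<in> E"
      have "Y N (Ln z) \<noteq> 0" using low[OF z mbN[OF elim]] c' unfolding Y_def by auto
      thus "\<rho> N z * (1 / Y N (Ln z)) ^ p = amp N (lam N) p z / amp N (lam N) 0 z / of_nat N ^ p"
        by (simp add: \<rho>_def power_divide)
    qed
  qed
  show "uniform_limit E (\<lambda>N z. amp N (lam N) p z / amp N (lam N) 0 z / of_nat N ^ p)
      (\<lambda>z. (1 / moment_inverse A \<mu> (Ln z)) ^ p) sequentially"
    using uniform_limit_cong[OF ev, of "\<lambda>z. (1 / Y0 (Ln z)) ^ p" "\<lambda>z. (1 / Y0 (Ln z)) ^ p"] *
    unfolding Y0_def by blast
qed

lemma bounded_sum_finite:
  fixes g :: "'i \<Rightarrow> 'a \<Rightarrow> complex"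
  assumes "finite I" "\<And>i. i \<in> I \<Longrightarrow> bounded (g i ` S)"
  shows "bounded ((\<lambda>x. \<Sum>i\<in>I. g i x) ` S)"
proof -
  have "\<forall>i\<in>I. \<exists>B. \<forall>x\<in>S. norm (g i x) \<le> B" using assms(2) by (auto simp: bounded_iff)
  then obtain B where B: "\<And>i x. i \<in> I \<Longrightarrow> x \<in> S \<Longrightarrow> norm (g i x) \<le> B i" by metis
  have "norm (\<Sum>i\<in>I. g i x) \<le> (\<Sum>i\<in>I. B i)" if "x \<in> S" for x
    using B that by (intro sum_norm_le) auto
  thus ?thesis unfolding bounded_iff by blast
qed

lemma bounded_ndet:
  assumes bd: "\<And>a p. a < k \<Longrightarrow> p < k \<Longrightarrow> bounded ((\<lambda>x. g x a p) ` S)"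
  shows "bounded ((\<lambda>x. ndet k (g x)) ` S)"
  unfolding ndet_rows
proof (rule bounded_sum_finite)
  fix \<pi> :: "nat \<Rightarrow> nat" assume "\<pi> \<in> {\<pi>. \<pi> permutes {0..<k}}"
  hence lt: "\<pi> i < k" if "i < k" for i using permutes_in_image[of \<pi> "{0..<k}" i] that by auto
  have "bounded ((\<lambda>x. \<Prod>i<k. g x i (\<pi> i)) ` S)"
    using bd lt by (intro uniform_limit_prod_bounded(2)[where f = "\<lambda>i _ x. g x i (\<pi> i)"] uniform_limit_const) auto
  then obtain B where B: "\<And>x. x \<in> S \<Longrightarrow> norm (\<Prod>i<k. g x i (\<pi> i)) \<le> B" unfolding bounded_iff by auto
  have "norm (of_int (sign \<pi>) * (\<Prod>i<k. g x i (\<pi> i))) \<le> B" if "x \<in> S" for x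
    using B[OF that] by (simp add: norm_mult sign_def)
  thus "bounded ((\<lambda>x. of_int (sign \<pi>) * (\<Prod>i<k. g x i (\<pi> i))) ` S)" unfolding bounded_iff by blast
qed (simp add: finite_permutations)

text \<open>Positive radii keep the coordinates away from 1, and distinct radii keep them apart:
  \<open>norm (x (Suc a) - x (Suc b))\<close> is at least the difference of the radii. Thus every
  denominator of \<open>norm_schur_ratio\<close> is bounded below on the torus.\<close>

lemma schur_ratio_uniform_limit_torus:
  assumes sig: "\<And>N. is_signature N (lam N)" and A: "A \<ge> 1"
    and bd: "\<And>N j. j < N \<Longrightarrow> \<bar>emp_point N (lam N) j\<bar> \<le> A"
    and mb: "moment_bound A \<mu>" and lim: "\<And>n. (\<lambda>N. emp_moment N (lam N) n) \<longlonglongrightarrow> \<mu> n"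
    and r: "r \<le> 1 / 2" "\<And>z. z \<in> ball 1 r \<Longrightarrow> Ln z \<in> ball 0 (1 / (64000 * A))"
    and H: "\<And>z. z \<in> ball 1 r \<Longrightarrow> z \<noteq> 1 \<Longrightarrow>
      z * Hprime m z = 1 / moment_inverse A \<mu> (Ln z) - z / (z - 1)"
    and \<rho>: "\<And>i. i \<in> {1..k} \<Longrightarrow> 0 < \<rho> i \<and> \<rho> i < r" "inj_on \<rho> {1..k}" and k: "1 \<le> k"
  shows "\<exists>C. (\<forall>N. C N \<noteq> 0) \<and> uniform_limit {x. \<forall>i\<in>{1..k}. norm (x i - 1) = \<rho> i}
    (\<lambda>N x. C N * (norm_schur N (lam N) k x / (\<Prod>a<k. norm_schur N (lam N) 1 (\<lambda>_. x (Suc a)))))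
    (\<lambda>x. \<Prod>b<k. \<Prod>a<b. ell m (x (Suc a)) (x (Suc b))) sequentially"
proof -
  define T where "T = {x. \<forall>i\<in>{1..k}. norm (x i - (1::complex)) = \<rho> i}"
  define g where "g z = 1 / moment_inverse A \<mu> (Ln z)" for z
  define e where "e N p z = amp N (lam N) p z / amp N (lam N) 0 z / of_nat N ^ p" for N p z
  define qq where "qq x = (\<Prod>b<k. \<Prod>a<b. (x (Suc a) - 1) * (x (Suc b) - 1) / (x (Suc a) - x (Suc b)))"
    for x :: "nat \<Rightarrow> complex"
  define c where "c = Min (\<rho> ` {1..k})"
  define E where "E = {z :: complex. z \<in> ball 1 r \<and> c \<le> norm (z - 1)}"
  have c: "c > 0" using k \<rho>(1) by (auto simp: c_def)
  have TE: "x (Suc a) \<in> E" if "x \<in> T" "a < k" for x a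
  proof -
    have i: "Suc a \<in> {1..k}" using that by simp
    have "norm (x (Suc a) - 1) = \<rho> (Suc a)" using that i unfolding T_def by blast
    moreover have "c \<le> \<rho> (Suc a)" using i by (auto simp: c_def)
    ultimately show ?thesis using \<rho>(1)[OF i] by (simp add: E_def dist_norm norm_minus_commute)
  qed
  have T_dist: "x (Suc a) \<noteq> x (Suc b)" "norm (x (Suc a) - x (Suc b)) \<ge> \<bar>\<rho> (Suc a) - \<rho> (Suc b)\<bar>"
    "\<bar>\<rho> (Suc a) - \<rho> (Suc b)\<bar> > 0"
    if "x \<in> T" "a < b" "b < k" for x a b
  proof -
    have i: "Suc a \<in> {1..k}" "Suc b \<in> {1..k}" using that by auto
    hence eq: "norm (x (Suc a) - 1) = \<rho> (Suc a)" "norm (x (Suc b) - 1) = \<rho> (Suc b)"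
      using that unfolding T_def by blast+
    show ne: "\<bar>\<rho> (Suc a) - \<rho> (Suc b)\<bar> > 0" using inj_onD[OF \<rho>(2) _ i] that by force
    have "\<bar>norm (x (Suc a) - 1) - norm (x (Suc b) - 1)\<bar> \<le> norm ((x (Suc a) - 1) - (x (Suc b) - 1))"
      by (rule norm_triangle_ineq3)
    thus "norm (x (Suc a) - x (Suc b)) \<ge> \<bar>\<rho> (Suc a) - \<rho> (Suc b)\<bar>" by (simp add: eq)
    thus "x (Suc a) \<noteq> x (Suc b)" using ne by auto
  qed
  have E: "Ln z \<in> ball 0 (1 / (64000 * A)) \<and> exp (Ln z) = z \<and> c \<le> norm (z - 1)"
    "z \<noteq> 0" "z \<noteq> 1" "Ln z \<noteq> 0" if "z \<in> E" for z
  proof -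
    have z: "z \<in> ball 1 r" "c \<le> norm (z - 1)" using that by (auto simp: E_def)
    note np = near_1_props[OF z(1) r(1)]
    show "z \<noteq> 1" using z(2) c by auto
    thus "Ln z \<noteq> 0" by (rule np(3))
    show "z \<noteq> 0" by (rule np(1))
    show "Ln z \<in> ball 0 (1 / (64000 * A)) \<and> exp (Ln z) = z \<and> c \<le> norm (z - 1)"
      using r(2)[OF z(1)] np(4) z(2) by blast
  qed
  have lim_e: "uniform_limit E (\<lambda>N z. e N p z) (\<lambda>z. g z ^ p) sequentially"
    and bd_g: "bounded ((\<lambda>z. g z ^ p) ` E)" for p
    unfolding e_def g_def
    using amp_ratio_uniform_limit[OF sig A _ mb lim E(1) c, where E = E and p = p] bd by blast+
  have lim_nd: "uniform_limit T (\<lambda>N x. ndet k (\<lambda>a p. e N p (x (Suc a))))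
      (\<lambda>x. ndet k (\<lambda>a p. g (x (Suc a)) ^ p)) sequentially"
    and bd_nd: "bounded ((\<lambda>x. ndet k (\<lambda>a p. g (x (Suc a)) ^ p)) ` T)"
  proof -
    have 1: "uniform_limit T (\<lambda>N x. e N p (x (Suc a))) (\<lambda>x. g (x (Suc a)) ^ p) sequentially" if "a < k" for a p
      by (rule uniform_limit_compose'[OF lim_e]) (use TE that in auto)
    have 2: "bounded ((\<lambda>x. g (x (Suc a)) ^ p) ` T)" if "a < k" for a p
      by (rule bounded_subset[OF bd_g[of p]]) (use TE that in auto)
    show "uniform_limit T (\<lambda>N x. ndet k (\<lambda>a p. e N p (x (Suc a))))
      (\<lambda>x. ndet k (\<lambda>a p. g (x (Suc a)) ^ p)) sequentially"
      by (rule uniform_limit_ndet) (use 1 2 in auto)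
    show "bounded ((\<lambda>x. ndet k (\<lambda>a p. g (x (Suc a)) ^ p)) ` T)"
      by (rule bounded_ndet) (use 2 in auto)
  qed
  have bd_qq: "bounded (qq ` T)"
  proof -
    have "norm (qq x) \<le> (\<Prod>b<k. \<Prod>a<b. 1 / \<bar>\<rho> (Suc a) - \<rho> (Suc b)\<bar>)" if x: "x \<in> T" for x
      unfolding qq_def prod_norm[symmetric]
    proof (intro prod_mono conjI norm_ge_zero prod_nonneg)
      fix b a assume "b \<in> {..<k}" "a \<in> {..<b}"
      hence ab: "a < b" "b < k" by auto
      have le1: "norm (x (Suc i) - 1) \<le> 1" if "i < k" for i
        using TE[OF x that] r(1) by (auto simp: E_def dist_norm norm_minus_commute)
      have "norm (x (Suc a) - 1) * norm (x (Suc b) - 1) \<le> 1 * 1"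
        using le1 ab by (intro mult_mono) auto
      thus "norm ((x (Suc a) - 1) * (x (Suc b) - 1) / (x (Suc a) - x (Suc b))) \<le> 1 / \<bar>\<rho> (Suc a) - \<rho> (Suc b)\<bar>"
        unfolding norm_divide norm_mult using T_dist[OF x ab] by (intro frac_le) auto
    qed
    thus ?thesis unfolding bounded_iff by blast
  qed
  obtain s :: complex where s: "s \<noteq> 0" "\<forall>f. ndet k (\<lambda>i j. f i (k - 1 - j)) = s * ndet k f"
    using ndet_reverse_columns[of k] by (elim exE conjE)
  \<comment> \<open>One sign for each pair: \<open>ell\<close> contains \<open>g b - g a\<close>,
    the Vandermonde determinant \<open>g a - g b\<close>.\<close>
  define sg :: complex where "sg = (\<Prod>b<k. \<Prod>a<b. - 1)"
  have sg: "sg \<noteq> 0" by (simp add: sg_def)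
  define Q where "Q N C \<longleftrightarrow> (\<forall>x. (\<forall>i\<in>{1..k}. x i \<noteq> 0 \<and> x i \<noteq> 1 \<and> amp N (lam N) 0 (x i) \<noteq> 0) \<longrightarrow>
    (\<forall>b<k. \<forall>a<b. x (Suc a) \<noteq> x (Suc b)) \<longrightarrow>
    norm_schur N (lam N) k x / (\<Prod>a<k. norm_schur N (lam N) 1 (\<lambda>_. x (Suc a))) =
    C * (ndet k (\<lambda>a p. e N p (x (Suc a))) * qq x))" for N C
  \<comment> \<open>For \<open>N < k\<close> the formula says nothing; the value 1 makes
    \<open>C\<close> a sequence without zeros.\<close>
  have "\<exists>C. C \<noteq> 0 \<and> (k \<le> N \<longrightarrow> Q N C)" for N
  proof (cases "k \<le> N")
    case True
    show ?thesis
      using norm_schur_ratio[OF sig k True] True unfolding Q_def e_def qq_def by (elim exE conjE) (intro exI conjI impI)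
  next
    case False
    thus ?thesis by (intro exI[of _ 1]) simp
  qed
  hence "\<exists>C. \<forall>N. C N \<noteq> 0 \<and> (k \<le> N \<longrightarrow> Q N (C N))" by (intro choice allI)
  then obtain C where C: "\<And>N. C N \<noteq> 0" "\<And>N. k \<le> N \<Longrightarrow> Q N (C N)" by blast
  have lim_scaled: "uniform_limit T (\<lambda>N x. (s * sg) * (ndet k (\<lambda>a p. e N p (x (Suc a))) * qq x))
      (\<lambda>x. (s * sg) * (ndet k (\<lambda>a p. g (x (Suc a)) ^ p) * qq x)) sequentially"
  proof -
    have 1: "uniform_limit T (\<lambda>N x. ndet k (\<lambda>a p. e N p (x (Suc a))) * qq x)
      (\<lambda>x. ndet k (\<lambda>a p. g (x (Suc a)) ^ p) * qq x) sequentially"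
      by (rule uniform_lim_mult[OF lim_nd uniform_limit_const bd_nd bd_qq])
    show ?thesis by (rule bounded_linear.uniform_limit[OF bounded_linear_mult_right 1])
  qed
  have ev: "\<forall>\<^sub>F N in sequentially. \<forall>x\<in>T. (s * sg) * (ndet k (\<lambda>a p. e N p (x (Suc a))) * qq x) =
      ((s * sg) / C N) * (norm_schur N (lam N) k x / (\<Prod>a<k. norm_schur N (lam N) 1 (\<lambda>_. x (Suc a))))"
    using eventually_ge_at_top[of k] eventually_ge_at_top[of "10 ^ 10 :: nat"]
  proof eventually_elim
    case (elim N)
    show ?case
    proof
      fix x assume x: "x \<in> T"
      have "x i \<noteq> 0 \<and> x i \<noteq> 1 \<and> amp N (lam N) 0 (x i) \<noteq> 0" if "i \<in> {1..k}" for i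
      proof -
        have i: "i - 1 < k" "Suc (i - 1) = i" using that by auto
        have z: "x i \<in> E" using TE[OF x i(1)] unfolding i(2) .
        have "amp N (lam N) 0 (exp (Ln (x i))) \<noteq> 0"
          using E(1,4)[OF z] bd by (intro amp_ratio_emp(1)[OF sig elim(2) A]) auto
        thus ?thesis using E[OF z] by simp
      qed
      hence "norm_schur N (lam N) k x / (\<Prod>a<k. norm_schur N (lam N) 1 (\<lambda>_. x (Suc a))) =
          C N * (ndet k (\<lambda>a p. e N p (x (Suc a))) * qq x)"
        using T_dist(1)[OF x] by (intro C(2)[OF elim(1), unfolded Q_def, rule_format]) auto
      thus "(s * sg) * (ndet k (\<lambda>a p. e N p (x (Suc a))) * qq x) =
        ((s * sg) / C N) * (norm_schur N (lam N) k x / (\<Prod>a<k. norm_schur N (lam N) 1 (\<lambda>_. x (Suc a))))"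
        using C(1)[of N] by simp
    qed
  qed
  have sign: "p * q * (v - u) / w = - 1 * ((u - v) * (p * q / w))" for p q u v w :: complex
    by (simp add: divide_inverse algebra_simps)
  have eq: "(s * sg) * (ndet k (\<lambda>a p. g (x (Suc a)) ^ p) * qq x) =
      (\<Prod>b<k. \<Prod>a<b. ell m (x (Suc a)) (x (Suc b)))" if x: "x \<in> T" for x
  proof -
    have "s * ndet k (\<lambda>a p. g (x (Suc a)) ^ p) = (\<Prod>b<k. \<Prod>a<b. g (x (Suc a)) - g (x (Suc b)))"
      using s(2)[rule_format, of "\<lambda>a p. g (x (Suc a)) ^ p"] ndet_vandermonde[of k "\<lambda>a. g (x (Suc a))"] by simp
    hence "(s * sg) * (ndet k (\<lambda>a p. g (x (Suc a)) ^ p) * qq x) =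
        sg * ((\<Prod>b<k. \<Prod>a<b. g (x (Suc a)) - g (x (Suc b))) * qq x)"
      by (simp add: mult_ac)
    also have "\<dots> = (\<Prod>b<k. \<Prod>a<b. - 1 * ((g (x (Suc a)) - g (x (Suc b))) *
        ((x (Suc a) - 1) * (x (Suc b) - 1) / (x (Suc a) - x (Suc b)))))"
      unfolding sg_def qq_def prod.distrib ..
    also have "\<dots> = (\<Prod>b<k. \<Prod>a<b. ell m (x (Suc a)) (x (Suc b)))"
    proof (intro prod.cong refl)
      fix b a assume "b \<in> {..<k}" "a \<in> {..<b}"
      hence ab: "a < b" "b < k" by auto
      have za: "x (Suc a) \<in> E" and zb: "x (Suc b) \<in> E" using TE[OF x] ab by auto
      have Hz: "z * Hprime m z = g z - z / (z - 1)" if "z \<in> E" for z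
        using H[of z] E(3)[OF that] that by (simp add: g_def E_def)
      have "ell m (x (Suc a)) (x (Suc b)) = (x (Suc a) - 1) * (x (Suc b) - 1) *
          (g (x (Suc b)) - g (x (Suc a))) / (x (Suc a) - x (Suc b))"
        by (rule ell_off_diagonal[OF Hz[OF za] Hz[OF zb] E(3)[OF za] E(3)[OF zb] T_dist(1)[OF x ab]])
      also have "\<dots> = - 1 * ((g (x (Suc a)) - g (x (Suc b))) *
        ((x (Suc a) - 1) * (x (Suc b) - 1) / (x (Suc a) - x (Suc b))))"
        by (rule sign)
      finally show "- 1 * ((g (x (Suc a)) - g (x (Suc b))) *
        ((x (Suc a) - 1) * (x (Suc b) - 1) / (x (Suc a) - x (Suc b)))) = ell m (x (Suc a)) (x (Suc b))" ..
    qed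
    finally show ?thesis .
  qed
  have "uniform_limit T (\<lambda>N x. ((s * sg) / C N) *
      (norm_schur N (lam N) k x / (\<Prod>a<k. norm_schur N (lam N) 1 (\<lambda>_. x (Suc a)))))
      (\<lambda>x. \<Prod>b<k. \<Prod>a<b. ell m (x (Suc a)) (x (Suc b))) sequentially"
    by (rule uniform_limit_cong[THEN iffD1, OF ev eq lim_scaled])
  moreover have "(s * sg) / C N \<noteq> 0" for N using s(1) sg C(1) by simp
  ultimately show ?thesis unfolding T_def by (intro exI[of _ "\<lambda>N. (s * sg) / C N"]) blast
qed

section \<open>Convergence on a polydisc\<close>

lemma prod_near_1:
  fixes I :: "'i set"
  assumes "finite I"
  shows "\<exists>\<epsilon>>0. \<forall>f :: 'i \<Rightarrow> complex. (\<forall>p\<in>I. norm (f p - 1) \<le> \<epsilon>) \<longrightarrow>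
    1 / 2 \<le> norm (\<Prod>p\<in>I. f p) \<and> norm (\<Prod>p\<in>I. f p) \<le> 2"
proof -
  have L: "((\<lambda>e. (1 + e) ^ card I) \<longlongrightarrow> (1 + 0) ^ card I) (at_right (0::real))"
    "((\<lambda>e. (1 - e) ^ card I) \<longlongrightarrow> (1 - 0) ^ card I) (at_right (0::real))"
    by (intro tendsto_intros)+
  have "\<forall>\<^sub>F e in at_right (0::real). (1 + e) ^ card I < 2"
    by (rule order_tendstoD(2)[OF L(1)]) simp
  moreover have "\<forall>\<^sub>F e in at_right (0::real). 1 / 2 < (1 - e) ^ card I"
    by (rule order_tendstoD(1)[OF L(2)]) simp
  moreover have "\<forall>\<^sub>F e in at_right (0::real). 0 < e \<and> e < 1"
    using eventually_at_right[of 0 "1::real"] by (auto intro: exI[of _ 1])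
  ultimately have "\<forall>\<^sub>F e in at_right (0::real). (1 + e) ^ card I < 2 \<and> 1 / 2 < (1 - e) ^ card I \<and> 0 < e \<and> e < 1"
    by eventually_elim auto
  then obtain \<epsilon> :: real where \<epsilon>: "(1 + \<epsilon>) ^ card I < 2" "1 / 2 < (1 - \<epsilon>) ^ card I" "0 < \<epsilon>" "\<epsilon> < 1"
    using eventually_happens'[OF trivial_limit_at_right_real] by blast
  show ?thesis
  proof (intro exI[of _ \<epsilon>] conjI allI impI \<epsilon>(3))
    fix f :: "'i \<Rightarrow> complex" assume f: "\<forall>p\<in>I. norm (f p - 1) \<le> \<epsilon>"
    have f': "1 - \<epsilon> \<le> norm (f p)" "norm (f p) \<le> 1 + \<epsilon>" if "p \<in> I" for p
      using f that norm_triangle_ineq2[of 1 "f p"] norm_triangle_ineq2[of "f p" 1]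
      by (force simp: norm_minus_commute)+
    have "(\<Prod>p\<in>I. 1 - \<epsilon>) \<le> (\<Prod>p\<in>I. norm (f p))" using f' \<epsilon>(4) by (intro prod_mono) auto
    thus "1 / 2 \<le> norm (\<Prod>p\<in>I. f p)" using \<epsilon>(2) by (simp add: prod_norm[symmetric])
    have "(\<Prod>p\<in>I. norm (f p)) \<le> (\<Prod>p\<in>I. 1 + \<epsilon>)" using f' by (intro prod_mono) auto
    thus "norm (\<Prod>p\<in>I. f p) \<le> 2" using \<epsilon>(1) by (simp add: prod_norm[symmetric])
  qed
qed

definition pairs :: "nat \<Rightarrow> (nat \<times> nat) set" where
  "pairs k = (SIGMA b:{..<k}. {..<b})"

lemma finite_pairs: "finite (pairs k)" by (simp add: pairs_def)

lemma prod_pairs: "(\<Prod>b<k. \<Prod>a<b. f a b) = (\<Prod>(b, a)\<in>pairs k. f a b)"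
  unfolding pairs_def by (rule prod.Sigma) auto

definition ell_prod :: "real measure \<Rightarrow> (nat \<times> nat) set \<Rightarrow> (nat \<Rightarrow> complex) \<Rightarrow> complex" where
  "ell_prod m I x = (\<Prod>(b, a)\<in>I. ell m (x (Suc a)) (x (Suc b)))"

lemma ell_sep_hol:
  assumes "Hprime m holomorphic_on ball 1 R" "i \<noteq> j"
  shows "sep_hol k R (\<lambda>x. ell m (x i) (x j))"
  unfolding sep_hol_def
proof (intro ballI)
  fix x l
  show "(\<lambda>z. ell m ((x(l := z)) i) ((x(l := z)) j)) holomorphic_on ball 1 R"
  proof (cases "l = i")
    case True
    thus ?thesis using ell_holomorphic[OF assms(1)] assms(2) by simp
  next
    case False
    thus ?thesis
      using ell_holomorphic[OF assms(1), of "x i"] by (cases "l = j") (simp_all add: ell_commute[of m "x i"])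
  qed
qed

lemma ell_prod_sep_hol:
  assumes "Hprime m holomorphic_on ball 1 R" "I \<subseteq> pairs k"
  shows "sep_hol k R (ell_prod m I)"
  unfolding ell_prod_def[abs_def]
proof (rule sep_hol_prod)
  fix p assume "p \<in> I"
  then obtain b a where "p = (b, a)" "a < b" using assms(2) by (auto simp: pairs_def)
  thus "sep_hol k R (\<lambda>x. case p of (b, a) \<Rightarrow> ell m (x (Suc a)) (x (Suc b)))"
    using ell_sep_hol[OF assms(1), of "Suc a" "Suc b" k] by simp
qed

text \<open>Of all pairs only the first two variables together matter. \<open>I1\<close> collects
  the pairs without variable 1 and \<open>I2\<close> those with variable 1 but without variable 2,
  which play the roles of \<open>u\<close> and \<open>v\<close> in
  \<open>logd12_mult_separated\<close>. Index \<open>a\<close> stands for variable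
  \<open>Suc a\<close>, and the larger index comes first.\<close>

lemma logd12_ell_prod:
  assumes hol: "Hprime m holomorphic_on ball 1 R" and k: "2 \<le> k"
    and nz: "\<And>a b. a \<in> ball 1 R \<Longrightarrow> b \<in> ball 1 R \<Longrightarrow> ell m a b \<noteq> 0"
    and x: "x \<in> polydisc1 k R"
  shows "logd12 (ell_prod m (pairs k)) x = logd12 (limit_fn m) x"
proof -
  define I1 where "I1 = {p \<in> pairs k. 1 \<le> snd p}"
  define I2 where "I2 = {p \<in> pairs k. snd p = 0 \<and> 2 \<le> fst p}"
  have split: "pairs k = insert (1, 0) (I1 \<union> I2)"
    using k by (auto simp: pairs_def I1_def I2_def)
  have fin: "finite I1" "finite I2" by (auto simp: I1_def I2_def finite_pairs)
  have disj: "I1 \<inter> I2 = {}" "(1, 0) \<notin> I1 \<union> I2" by (auto simp: I1_def I2_def)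
  have sub: "I1 \<subseteq> pairs k" "I2 \<subseteq> pairs k" by (auto simp: I1_def I2_def)
  have nzI: "ell_prod m I y \<noteq> 0" if "I \<subseteq> pairs k" "y \<in> polydisc1 k R" for I y
  proof -
    have "finite I" using that(1) finite_pairs finite_subset by blast
    moreover have "ell m (y (Suc a)) (y (Suc b)) \<noteq> 0" if "(b, a) \<in> I" for a b
    proof -
      have "(b, a) \<in> pairs k" using that \<open>I \<subseteq> pairs k\<close> by blast
      hence "Suc a \<in> {1..k}" "Suc b \<in> {1..k}" by (auto simp: pairs_def)
      thus ?thesis using polydisc1_coord[OF \<open>y \<in> polydisc1 k R\<close>] by (intro nz)
    qed
    ultimately show ?thesis by (auto simp: ell_prod_def)
  qed
  show ?thesis
  proof (rule logd12_mult_separated[OF _ ell_prod_sep_hol[OF hol sub(2)], where u = "ell_prod m I1"])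
    show "sep_hol k R (limit_fn m)"
      unfolding limit_fn_eq_ell[abs_def] by (rule ell_sep_hol[OF hol]) simp
    show "ell_prod m (pairs k) y = limit_fn m y * ell_prod m I1 y * ell_prod m I2 y" for y
      unfolding split ell_prod_def using fin disj
      by (simp add: prod.union_disjoint limit_fn_eq_ell numeral_2_eq_2 mult.assoc)
    show "limit_fn m y \<noteq> 0" if "y \<in> polydisc1 k R" for y
      unfolding limit_fn_eq_ell using polydisc1_coord[OF that, of 1] polydisc1_coord[OF that, of 2] k
      by (intro nz) auto
    show "ell_prod m I1 (y(1 := z)) = ell_prod m I1 y" for y z
      unfolding ell_prod_def by (intro prod.cong refl) (auto simp: I1_def pairs_def)
    show "ell_prod m I2 (y(2 := z)) = ell_prod m I2 y" for y z
      unfolding ell_prod_def by (intro prod.cong refl) (auto simp: I2_def pairs_def)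
  qed (use nzI sub k x in auto)
qed

text \<open>The limit depends on the first two coordinates only.\<close>

lemma logd123_limit_fn: "logd123 (limit_fn m) x = 0"
  by (simp add: logd123_def logd12_def pd_def limit_fn_def)

section \<open>Dividing by the one-variable factors\<close>

lemma norm_schur_1_hol:
  assumes "R \<le> 1 / 2" "0 < R"
  shows "(\<lambda>z. norm_schur N lam 1 (\<lambda>_. z)) holomorphic_on ball 1 R"
proof -
  have "(\<lambda>_. 1) \<in> polydisc1 1 R" using assms by (simp add: polydisc1_def)
  from sep_holD[OF norm_schur_sep_hol[OF assms(1)] this, of 1 N lam]
  have "(\<lambda>z. norm_schur N lam 1 ((\<lambda>_. 1)(1 := z))) holomorphic_on ball 1 R" by simp
  \<comment> \<open>The two arguments differ at index 0, which satisfies \<open>i \<le> 1\<close>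
    but is never an entry of a tableau.\<close>
  moreover have "norm_schur N lam 1 ((\<lambda>_. 1)(1 := z)) = norm_schur N lam 1 (\<lambda>_. z)" for z
  proof -
    have "schur N lam (\<lambda>i. if i \<le> 1 then ((\<lambda>_. 1)(1 := z)) i else 1) = schur N lam (\<lambda>i. if i \<le> 1 then z else 1)"
      unfolding schur_def
    proof (intro arg_cong2[where f = "(*)"] arg_cong2[where f = "(powi)"] prod.cong sum.cong refl)
      fix T c assume "T \<in> ssyt N lam" "c \<in> diagram N lam"
      hence "T c \<in> {1..N}" by (auto simp: ssyt_def)
      thus "(if T c \<le> 1 then ((\<lambda>_. 1)(1 := z)) (T c) else 1) = (if T c \<le> 1 then z else 1)" by auto
    qed auto
    thus ?thesis unfolding norm_schur_def by (simp only:)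
  qed
  ultimately show ?thesis by simp
qed

lemma schur_quotient_sep_hol:
  assumes R: "R \<le> 1 / 2" "0 < R"
    and nz1: "\<And>z. z \<in> ball 1 R \<Longrightarrow> norm_schur N lam 1 (\<lambda>_. z) \<noteq> 0"
  shows "sep_hol k R (\<lambda>x. C * (norm_schur N lam k x / (\<Prod>a<k. norm_schur N lam 1 (\<lambda>_. x (Suc a)))))"
    and "a < k \<Longrightarrow> sep_hol k R (\<lambda>x. norm_schur N lam 1 (\<lambda>_. x (Suc a)))"
proof -
  show 1: "sep_hol k R (\<lambda>x. norm_schur N lam 1 (\<lambda>_. x (Suc a)))" for a
    unfolding sep_hol_def
  proof (intro ballI)
    fix x i
    show "(\<lambda>z. norm_schur N lam 1 (\<lambda>_. (x(i := z)) (Suc a))) holomorphic_on ball 1 R"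
      using norm_schur_1_hol[OF R, of N lam] by (cases "i = Suc a") auto
  qed
  show "sep_hol k R (\<lambda>x. C * (norm_schur N lam k x / (\<Prod>a<k. norm_schur N lam 1 (\<lambda>_. x (Suc a)))))"
    using nz1 polydisc1_coord
    by (intro sep_hol_mult sep_hol_const sep_hol_divide norm_schur_sep_hol R(1) sep_hol_prod 1) auto
qed

text \<open>The one-variable factor of \<open>x 1\<close>, together with the constant, is free of
  \<open>x 2\<close>; the remaining factors are free of \<open>x 1\<close>.\<close>

lemma logd12_schur_quotient:
  assumes R: "R \<le> 1 / 2" "0 < R" and C: "C \<noteq> 0"
    and nz1: "\<And>z. z \<in> ball 1 R \<Longrightarrow> norm_schur N lam 1 (\<lambda>_. z) \<noteq> 0" and k: "2 \<le> k"
    and nz: "\<And>x. x \<in> polydisc1 k R \<Longrightarrow> norm_schur N lam k x \<noteq> 0"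
    and x: "x \<in> polydisc1 k R"
  shows "logd12 (norm_schur N lam k) x =
    logd12 (\<lambda>x. C * (norm_schur N lam k x / (\<Prod>a<k. norm_schur N lam 1 (\<lambda>_. x (Suc a))))) x"
proof -
  define s1 where "s1 z = norm_schur N lam 1 (\<lambda>_. z)" for z
  have s1_nz: "s1 (y (Suc a)) \<noteq> 0" if "y \<in> polydisc1 k R" "a < k" for y a
    unfolding s1_def using polydisc1_coord[OF that(1), of "Suc a"] that(2) by (intro nz1) auto
  have split: "{..<k} = insert 0 {1..<k}" using k by auto
  show ?thesis unfolding s1_def[symmetric]
  proof (rule logd12_mult_separated[where u = "\<lambda>x. \<Prod>a=1..<k. s1 (x (Suc a))" and v = "\<lambda>x. s1 (x (Suc 0)) * (1 / C)" and R = R and k = k])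
    show "sep_hol k R (\<lambda>x. C * (norm_schur N lam k x / (\<Prod>a<k. s1 (x (Suc a)))))"
      unfolding s1_def by (rule schur_quotient_sep_hol(1)[OF R nz1])
    show "sep_hol k R (\<lambda>x. s1 (x (Suc 0)) * (1 / C))"
      unfolding s1_def using k by (intro sep_hol_mult sep_hol_const schur_quotient_sep_hol(2)[OF R nz1]) auto
    fix y assume y: "y \<in> polydisc1 k R"
    have P: "(\<Prod>a<k. s1 (y (Suc a))) = s1 (y (Suc 0)) * (\<Prod>a=1..<k. s1 (y (Suc a)))"
      unfolding split by simp
    have nz': "s1 (y (Suc 0)) \<noteq> 0" "(\<Prod>a=1..<k. s1 (y (Suc a))) \<noteq> 0" "(\<Prod>a<k. s1 (y (Suc a))) \<noteq> 0"
      using s1_nz[OF y] k by auto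
    show "norm_schur N lam k y = C * (norm_schur N lam k y / (\<Prod>a<k. s1 (y (Suc a)))) *
        (\<Prod>a=1..<k. s1 (y (Suc a))) * (s1 (y (Suc 0)) * (1 / C))"
      unfolding P using nz'(1,2) C by simp
    show "C * (norm_schur N lam k y / (\<Prod>a<k. s1 (y (Suc a)))) \<noteq> 0" using nz[OF y] nz'(3) C by simp
    show "(\<Prod>a=1..<k. s1 (y (Suc a))) \<noteq> 0" "s1 (y (Suc 0)) * (1 / C) \<noteq> 0" using nz' C by auto
  next
    show "(\<Prod>a=1..<k. s1 ((y(1 := z)) (Suc a))) = (\<Prod>a=1..<k. s1 (y (Suc a)))" for y z
      by (intro prod.cong) auto
  qed (use k x in auto)
qed

theorem mainTheorem17:
  fixes lam :: "nat \<Rightarrow> nat \<Rightarrow> int" and m :: "real measure" and k :: nat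
  assumes sig: "\<And>N. is_signature N (lam N)"
    and reg: "regular_seq lam"
    and m_prob: "real_distribution m"
    and m_cpt: "\<exists>K. compact K \<and> measure m K = 1"
    and conv: "weak_conv_m (\<lambda>N. emp_measure N (lam N)) m"
    and k: "2 \<le> k"
  shows "\<exists>e>0.
     (\<forall>\<^sub>F N in sequentially. \<forall>x\<in>polydisc1 k e. norm_schur N (lam N) k x \<noteq> 0) \<and>
     uniform_limit (polydisc1 k e) (\<lambda>N. logd12 (norm_schur N (lam N) k))
        (logd12 (limit_fn m)) sequentially \<and>
     (3 \<le> k \<longrightarrow> uniform_limit (polydisc1 k e) (\<lambda>N. logd123 (norm_schur N (lam N) k))
        (\<lambda>_. 0) sequentially)"
proof -
  obtain A1 where A1: "A1 \<ge> 1" "\<And>N j. j < N \<Longrightarrow> \<bar>real_of_int (lcoord N (lam N) j)\<bar> \<le> A1 * real N"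
    using regular_lcoord_bound[OF reg] by blast
  obtain A2 where A2: "A2 \<ge> 1" "AE x in m. \<bar>x\<bar> \<le> A2"
    using compact_support_bounded[OF m_prob m_cpt] by blast
  define A where "A = max A1 A2"
  have A: "A \<ge> 1" using A1(1) by (simp add: A_def)
  have mA: "AE x in m. \<bar>x\<bar> \<le> A" using A2(2) by eventually_elim (simp add: A_def le_max_iff_disj)
  have bd: "\<bar>emp_point N (lam N) j\<bar> \<le> A" if "j < N" for N j
  proof -
    have "\<bar>emp_point N (lam N) j\<bar> \<le> A1"
      using A1(2)[OF that] that by (simp add: emp_point_def abs_divide pos_divide_le_eq)
    thus ?thesis by (simp add: A_def le_max_iff_disj)
  qed
  define \<mu> where "\<mu> = moments m"
  have mb: "moment_bound A \<mu>" unfolding \<mu>_def by (rule moments_bound(2)[OF m_prob A mA])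
  have lim: "(\<lambda>N. emp_moment N (lam N) n) \<longlonglongrightarrow> \<mu> n" for n
    unfolding \<mu>_def by (rule emp_moment_tendsto[OF m_prob A mA bd conv])
  have ct: "cauchy_tr m z = moment_series \<mu> (1 / z)" if "norm z > A" for z
    unfolding \<mu>_def by (rule cauchy_tr_moments[OF m_prob A mA that])
  obtain r0 where r0: "0 < r0" "r0 \<le> 1 / 2" "Hprime m holomorphic_on ball 1 r0"
    "\<And>z. z \<in> ball 1 r0 \<Longrightarrow> z \<noteq> 1 \<Longrightarrow> z * Hprime m z = 1 / moment_inverse A \<mu> (Ln z) - z / (z - 1)"
    using Hprime_near_1[OF mb ct] by metis
  have "1 / (64000 * A) > 0" using A by simp
  then obtain r1 where r1: "0 < r1" "r1 \<le> 1 / 2" "\<And>z. z \<in> ball 1 r1 \<Longrightarrow> Ln z \<in> ball 0 (1 / (64000 * A))"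
    using Ln_ball by blast
  obtain M where M: "M \<ge> 0" "\<And>a b. a \<in> ball 1 (r0 / 2) \<Longrightarrow> b \<in> ball 1 (r0 / 2) \<Longrightarrow>
    norm (ell m a b - 1) \<le> norm (a - 1) * norm (b - 1) * M"
    using ell_near_1[OF r0(3,1)] by blast
  obtain \<epsilon> where \<epsilon>: "\<epsilon> > 0" "\<And>f :: nat \<times> nat \<Rightarrow> complex. (\<And>p. p \<in> pairs k \<Longrightarrow> norm (f p - 1) \<le> \<epsilon>) \<Longrightarrow>
    1 / 2 \<le> norm (\<Prod>p\<in>pairs k. f p) \<and> norm (\<Prod>p\<in>pairs k. f p) \<le> 2"
    using prod_near_1[OF finite_pairs[of k]] by blast
  \<comment> \<open>The cap \<open>1 / 2\<close> makes each single factor \<open>ell\<close>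
    nonzero, in addition to the bounds on the whole product.\<close>
  define \<epsilon>' where "\<epsilon>' = min \<epsilon> (1 / 2)"
  define r where "r = min r0 r1"
  have r: "0 < r" "r \<le> r0" "r \<le> r1" "r \<le> 1 / 2" using r0 r1 by (auto simp: r_def)
  have Hr: "Hprime m holomorphic_on ball 1 r" using r(2) by (intro holomorphic_on_subset[OF r0(3)]) auto
  \<comment> \<open>\<open>k\<close> distinct radii below \<open>r\<close>, the smallest of which is
    \<open>r / (k + 1)\<close>.\<close>
  define \<rho> where "\<rho> i = r * real i / real (k + 1)" for i :: nat
  have \<rho>: "0 < \<rho> i \<and> \<rho> i < r" if "i \<in> {1..k}" for i
  proof -
    have "r * real i < r * real (k + 1)" using that r(1) by (intro mult_strict_left_mono) auto
    thus ?thesis using that r(1) by (simp add: \<rho>_def pos_divide_less_eq)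
  qed
  have \<rho>_inj: "inj_on \<rho> {1..k}" using r(1) by (auto simp: inj_on_def \<rho>_def)
  define W where "W C N x = C N * (norm_schur N (lam N) k x / (\<Prod>a<k. norm_schur N (lam N) 1 (\<lambda>_. x (Suc a))))"
    for C :: "nat \<Rightarrow> complex" and N x
  obtain C where C: "\<And>N. C N \<noteq> 0" "uniform_limit {x. \<forall>i\<in>{1..k}. norm (x i - 1) = \<rho> i}
    (W C) (ell_prod m (pairs k)) sequentially"
  proof -
    have "\<exists>C. (\<forall>N. C N \<noteq> 0) \<and> uniform_limit {x. \<forall>i\<in>{1..k}. norm (x i - 1) = \<rho> i}
      (\<lambda>N x. C N * (norm_schur N (lam N) k x / (\<Prod>a<k. norm_schur N (lam N) 1 (\<lambda>_. x (Suc a)))))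
      (\<lambda>x. \<Prod>b<k. \<Prod>a<b. ell m (x (Suc a)) (x (Suc b))) sequentially"
    proof (rule schur_ratio_uniform_limit_torus[OF sig A bd mb lim r(4)])
      show "Ln z \<in> ball 0 (1 / (64000 * A))" if "z \<in> ball 1 r" for z
        using that r(3) by (intro r1(3)) auto
      show "z * Hprime m z = 1 / moment_inverse A \<mu> (Ln z) - z / (z - 1)" if "z \<in> ball 1 r" "z \<noteq> 1" for z
        using that r(2) by (intro r0(4)) auto
    qed (use \<rho> \<rho>_inj k in auto)
    thus ?thesis using that unfolding prod_pairs W_def[abs_def] ell_prod_def[abs_def] by blast
  qed
  \<comment> \<open>At \<open>z = 1\<close> the amplitude formula degenerates, but there the
    normalized function is 1; elsewhere the Laplace integral does not vanish.\<close>
  have nz1: "norm_schur N (lam N) 1 (\<lambda>_. z) \<noteq> 0" if N: "10 ^ 10 \<le> N" and z: "z \<in> ball 1 r" for N z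
  proof (cases "z = 1")
    case True
    thus ?thesis using schur_ones_nonzero[OF sig] by (simp add: norm_schur_def)
  next
    case False
    have z': "z \<in> ball 1 r1" using z r(3) by auto
    note np = near_1_props[OF z' r1(2)]
    have N1: "1 \<le> N" using N by (cases N) auto
    obtain c where c: "c \<noteq> 0" "\<forall>z. z \<noteq> 0 \<longrightarrow> norm_schur N (lam N) 1 (\<lambda>_. z) * (z - 1) ^ (N - 1) = c * amp N (lam N) 0 z"
      using norm_schur_1[OF sig N1] by (elim exE conjE)
    have "amp N (lam N) 0 (exp (Ln z)) \<noteq> 0"
      using r1(3)[OF z'] np(3)[OF False] bd by (intro amp_ratio_emp(1)[OF sig N A]) auto
    thus ?thesis using c(1) c(2)[rule_format, OF np(1)] np(4) by auto
  qed
  have ev_N: "\<forall>\<^sub>F N in sequentially. (10 ^ 10 :: nat) \<le> N" by (rule eventually_ge_at_top)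
  have W_hol: "sep_hol k r (W C N)" if "10 ^ 10 \<le> N" for N
    unfolding W_def[abs_def] by (rule schur_quotient_sep_hol(1)[OF r(4,1)]) (rule nz1[OF that])
  \<comment> \<open>In this order: the polydisc inside the smallest circle of the torus; the domain
    of the estimate for \<open>ell\<close>; second factor at most 1 in that estimate; and closeness
    of \<open>ell\<close> to 1, with \<open>M + 1\<close> in place of \<open>M\<close> because
    \<open>M\<close> may be 0.\<close>
  define R where "R = min (r / real (k + 1)) (min (r0 / 2) (min 1 (\<epsilon>' / (M + 1))))"
  have R: "0 < R" "R \<le> r / real (k + 1)" "R \<le> r0 / 2" "R \<le> 1" "R \<le> \<epsilon>' / (M + 1)"
  proof -
    have "0 < r / real (k + 1)" "0 < r0 / 2" "0 < \<epsilon>' / (M + 1)"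
      using r(1) r0(1) \<epsilon>(1) M(1) by (auto simp: \<epsilon>'_def)
    thus "0 < R" unfolding R_def by linarith
  qed (unfold R_def, linarith+)
  have Rr: "R \<le> r"
  proof -
    have "r / real (k + 1) \<le> r / 1" using r(1) by (intro divide_left_mono) auto
    thus ?thesis using R(2) by simp
  qed
  have R_half: "R \<le> 1 / 2" using Rr r(4) by simp
  have ell_close: "norm (ell m a b - 1) \<le> \<epsilon>'" if "a \<in> ball 1 R" "b \<in> ball 1 R" for a b
  proof -
    have ab: "norm (a - 1) \<le> R" "norm (b - 1) \<le> 1"
      using that R(4) by (auto simp: dist_norm norm_minus_commute)
    have "norm (ell m a b - 1) \<le> norm (a - 1) * norm (b - 1) * M"
      using that R(3) by (intro M(2)) auto
    also have "\<dots> \<le> R * 1 * (M + 1)"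
      using ab M(1) R(1) by (intro mult_mono) auto
    also have "\<dots> \<le> \<epsilon>'" using R(5) M(1) by (simp add: pos_le_divide_eq)
    finally show ?thesis .
  qed
  have ell_nz: "ell m a b \<noteq> 0" if "a \<in> ball 1 R" "b \<in> ball 1 R" for a b
    using ell_close[OF that] by (auto simp: \<epsilon>'_def)
  have HR: "Hprime m holomorphic_on ball 1 R" using Rr by (intro holomorphic_on_subset[OF Hr]) auto
  have P_bounds: "1 / 2 \<le> norm (ell_prod m (pairs k) x) \<and> norm (ell_prod m (pairs k) x) \<le> 2"
    if x: "x \<in> polydisc1 k R" for x
    unfolding ell_prod_def
  proof (rule \<epsilon>(2))
    fix p assume "p \<in> pairs k"
    then obtain a b where p: "p = (b, a)" "Suc a \<in> {1..k}" "Suc b \<in> {1..k}" by (auto simp: pairs_def)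
    have "norm (ell m (x (Suc a)) (x (Suc b)) - 1) \<le> \<epsilon>'"
      by (rule ell_close[OF polydisc1_coord[OF x p(2)] polydisc1_coord[OF x p(3)]])
    thus "norm ((case p of (b, a) \<Rightarrow> ell m (x (Suc a)) (x (Suc b))) - 1) \<le> \<epsilon>"
      by (simp add: p(1) \<epsilon>'_def)
  qed
  \<comment> \<open>The difference is separately holomorphic on the larger polydisc of radius
    \<open>r\<close>, so its size on the torus bounds it on all points inside, including the
    diagonals and \<open>x i = 1\<close>.\<close>
  have limW: "uniform_limit (polydisc1 k R) (W C) (ell_prod m (pairs k)) sequentially"
  proof (rule uniform_limitI)
    fix e :: real assume e: "e > 0"
    hence "e / 2 > 0" by simp
    from uniform_limitD[OF C(2) this] ev_N
    show "\<forall>\<^sub>F N in sequentially. \<forall>x\<in>polydisc1 k R. dist (W C N x) (ell_prod m (pairs k) x) < e"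
    proof eventually_elim
      case (elim N)
      show ?case
      proof
        fix x assume x: "x \<in> polydisc1 k R"
        have hol: "sep_hol k r (\<lambda>x. W C N x - ell_prod m (pairs k) x)"
          by (intro sep_hol_diff W_hol elim(2) ell_prod_sep_hol[OF Hr]) auto
        have "norm (W C N x - ell_prod m (pairs k) x) \<le> e / 2"
        proof (rule sep_hol_bound_torus[OF hol, where \<rho> = \<rho>])
          fix y :: "nat \<Rightarrow> complex" assume "\<And>i. i \<in> {1..k} \<Longrightarrow> norm (y i - 1) = \<rho> i"
          hence "y \<in> {x. \<forall>i\<in>{1..k}. norm (x i - 1) = \<rho> i}" by simp
          with elim(1) have "dist (W C N y) (ell_prod m (pairs k) y) < e / 2" by blast
          thus "norm (W C N y - ell_prod m (pairs k) y) \<le> e / 2" by (simp add: dist_norm)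
        next
          fix i assume i: "i \<in> {1..k}"
          have "norm (x i - 1) < R" using x i by (simp add: polydisc1_def)
          also have "R \<le> r * 1 / real (k + 1)" using R(2) by simp
          also have "\<dots> \<le> \<rho> i" unfolding \<rho>_def using i r(1) by (intro divide_right_mono mult_left_mono) auto
          finally show "norm (x i - 1) \<le> \<rho> i" by simp
        qed (rule \<rho>)
        thus "dist (W C N x) (ell_prod m (pairs k) x) < e" using e by (simp add: dist_norm)
      qed
    qed
  qed
  have W_hol_R: "\<forall>\<^sub>F N in sequentially. sep_hol k R (W C N)"
    using ev_N by eventually_elim (rule sep_hol_subset[OF W_hol Rr])
  have P_hol: "sep_hol k R (ell_prod m (pairs k))" by (rule ell_prod_sep_hol[OF HR]) simp
  note lims = uniform_limit_log_derivatives[OF R(1) W_hol_R P_hol limW _ _ k]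
  have W_nz: "\<forall>\<^sub>F N in sequentially. \<forall>x\<in>polydisc1 k R. W C N x \<noteq> 0"
    by (rule lims(1)) (use P_bounds in auto)
  have R4: "polydisc1 k (R / 4) \<subseteq> polydisc1 k R" using R(1) by (intro polydisc1_mono) auto
  have S_nz: "\<forall>\<^sub>F N in sequentially. \<forall>x\<in>polydisc1 k R. norm_schur N (lam N) k x \<noteq> 0"
    using W_nz by eventually_elim (auto simp: W_def)
  \<comment> \<open>The quotient \<open>W\<close> and the Schur function itself have the same mixed
    logarithmic derivative once both are free of zeros.\<close>
  have logS: "\<forall>\<^sub>F N in sequentially. \<forall>x\<in>polydisc1 k R. logd12 (norm_schur N (lam N) k) x = logd12 (W C N) x"
    using S_nz ev_N
  proof eventually_elim
    case (elim N)
    show ?case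
    proof
      fix x assume x: "x \<in> polydisc1 k R"
      show "logd12 (norm_schur N (lam N) k) x = logd12 (W C N) x"
        unfolding W_def[abs_def]
        by (rule logd12_schur_quotient[OF R_half R(1) C(1) _ k _ x])
          (use elim Rr nz1[OF elim(2)] in auto)
    qed
  qed
  have logP: "logd12 (ell_prod m (pairs k)) x = logd12 (limit_fn m) x" if "x \<in> polydisc1 k R" for x
    by (rule logd12_ell_prod[OF HR k ell_nz that])
  have lim12: "uniform_limit (polydisc1 k (R / 4)) (\<lambda>N. logd12 (norm_schur N (lam N) k)) (logd12 (limit_fn m)) sequentially"
  proof (rule uniform_limit_cong[THEN iffD1, OF _ _ lims(2)])
    show "\<forall>\<^sub>F N in sequentially. \<forall>x\<in>polydisc1 k (R / 4). logd12 (W C N) x = logd12 (norm_schur N (lam N) k) x"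
      using logS by eventually_elim (use R4 in auto)
    show "logd12 (ell_prod m (pairs k)) x = logd12 (limit_fn m) x" if "x \<in> polydisc1 k (R / 4)" for x
      using logP that R4 by auto
  qed (use P_bounds in auto)
  have lim123: "uniform_limit (polydisc1 k (R / 4)) (\<lambda>N. logd123 (norm_schur N (lam N) k)) (\<lambda>_. 0) sequentially"
    if "3 \<le> k"
  proof (rule uniform_limit_cong[THEN iffD1, OF _ _ lims(3)])
    have k3: "3 \<in> {1..k}" using that by simp
    show "\<forall>\<^sub>F N in sequentially. \<forall>x\<in>polydisc1 k (R / 4). logd123 (W C N) x = logd123 (norm_schur N (lam N) k) x"
      using logS
    proof eventually_elim
      case (elim N)
      show ?case
      proof
        fix x assume "x \<in> polydisc1 k (R / 4)"
        hence x: "x \<in> polydisc1 k R" using R4 by auto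
        show "logd123 (W C N) x = logd123 (norm_schur N (lam N) k) x"
          unfolding logd123_def by (rule pd_cong[OF _ x k3]) (use elim in auto)
      qed
    qed
    show "logd123 (ell_prod m (pairs k)) x = 0" if "x \<in> polydisc1 k (R / 4)" for x
    proof -
      have x: "x \<in> polydisc1 k R" using R4 that by auto
      have "logd123 (ell_prod m (pairs k)) x = logd123 (limit_fn m) x"
        unfolding logd123_def by (rule pd_cong[OF logP x k3])
      thus ?thesis by (simp add: logd123_limit_fn)
    qed
  qed (use P_bounds that in auto)
  have "\<forall>\<^sub>F N in sequentially. \<forall>x\<in>polydisc1 k (R / 4). norm_schur N (lam N) k x \<noteq> 0"
    using S_nz by eventually_elim (use R4 in auto)
  thus ?thesis using R(1) lim12 lim123 by (intro exI[of _ "R / 4"]) auto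
qed

end
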